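(* Let $N=\{N(\mathbf{s}),\ \mathbf{s}\in A\}$ be the Poisson random field with underlying correlation $\rho(\mathbf{h})$ and mean function $\lambda(\mathbf{s})=\mathbb{E}(N(\mathbf{s}))>0$ (as defined in the context). Let $\mathbf{s}_i,\mathbf{s}_j\in A$ be two distinct locations, and write $\lambda_i=\lambda(\mathbf{s}_i)$, $\lambda_j=\lambda(\mathbf{s}_j)$, $\rho=\rho(\mathbf{s}_i-\mathbf{s}_j)$, and $p_{nm}=\Pr(N(\mathbf{s}_i)=n,\,N(\mathbf{s}_j)=m)$ for integers $n,m\ge 0$. Assume $|\rho|<1$, and in case (c) also $\rho\neq 0$. Then: (a) For $n=m=0$: $$p_{00}=-1+e^{-\lambda_i}+e^{-\lambda_j}+(1-\rho^2)\sum_{k=0}^{\infty}\rho^{2k}\,\gamma^{\star}\!\left(k+1,\frac{\lambda_i}{1-\rho^2},\frac{\lambda_j}{1-\rho^2}\right).$$ (b) For $n\ge 1$, $m=0$: $p_{n0}=g(n,\lambda_i,\lambda_j,\rho)$; and for $m\ge 1$, $n=0$: $p_{0m}=g(m,\lambda_j,\lambda_i,\rho)$, where $$g(b,x,y,\rho)=\frac{x^b}{b!}e^{-x}-x^b e^{-\frac{x}{1-\rho^2}}\sum_{\ell=0}^{\infty}\left(\frac{\rho^2x}{1-\rho^2}\right)^{\ell}\,{}_1\widetilde{\mathrm{F}}_1\!\left(b;\,b+\ell+1;\,\frac{\rho^2x}{1-\rho^2}\right)\gamma^{*}\!\left(\ell+1,\frac{y}{1-\rho^2}\right).$$ (c)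 For $n=m\ge 1$: $$\begin{aligned}p_{nn}=&-(1-\rho^2)^n\sum_{k=0}^{\infty}\frac{\rho^{2k}(n)_k}{k!}\,\gamma^{\star}\!\left(n+k,\frac{\lambda_i}{1-\rho^2},\frac{\lambda_j}{1-\rho^2}\right)\\ &+\left(\frac{1-\rho^2}{\rho^2}\right)^n\sum_{k=0}^{\infty}\sum_{\ell=0}^{1}\frac{(n)_k}{k!}\,e^{-\lambda_i(1-\ell)-\lambda_j\ell}\,\gamma^{\star}\!\left(n+k,\frac{\rho^{2(1-\ell)}\lambda_i}{1-\rho^2},\frac{\rho^{2\ell}\lambda_j}{1-\rho^2}\right)\\ &+(1-\rho^2)^{n+1}\sum_{k=0}^{\infty}\sum_{\ell=0}^{\infty}\frac{\rho^{2k+2\ell}(n)_\ell}{\ell!}\,\gamma^{\star}\!\left(n+\ell+k+1,\frac{\lambda_i}{1-\rho^2},\frac{\lambda_j}{1-\rho^2}\right).\end{aligned}$$ (d) For $n\ge 2$, $m\ge 1$ with $n>m$: $p_{nm}=h(n,m,\lambda_i,\lambda_j,\rho)$; and for $m\ge 2$, $n\ge 1$ with $m>n$: $p_{nm}=h(m,n,\lambda_j,\lambda_i,\rho)$, where $$\begin{aligned}h(a,b,x,y,\rho)=x^{a}e^{-\frac{x}{1-\rho^2}}\Bigg[&\sum_{\ell=0}^{\infty}\frac{(b)_\ell}{\ell!}\left(\frac{\rho^2x}{1-\rho^2}\right)^{\ell}{}_1\widetilde{\mathrm{F}}_1\!\left(a-b+1;\,a+\ell+1;\,\frac{\rho^2x}{1-\rho^2}\right)\gamma^{*}\!\left(b+\ell,\frac{y}{1-\rho^2}\right)\\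 &-\sum_{k=0}^{\infty}\sum_{\ell=0}^{\infty}\frac{(b)_\ell}{\ell!}\left(\frac{\rho^2x}{1-\rho^2}\right)^{k+\ell}{}_1\widetilde{\mathrm{F}}_1\!\left(a-b;\,a+k+\ell+1;\,\frac{\rho^2x}{1-\rho^2}\right)\gamma^{*}\!\left(b+k+\ell+1,\frac{y}{1-\rho^2}\right)\Bigg].\end{aligned}$$
   Context: Let $A\subset\mathbb{R}^d$ and let $G=\{G(\mathbf{s}),\ \mathbf{s}\in A\}$ be a real-valued, zero-mean, unit-variance, weakly stationary Gaussian random field with correlation function $\rho(\mathbf{h})=\mathrm{Corr}(G(\mathbf{s}_i),G(\mathbf{s}_j))$, $\mathbf{h}=\mathbf{s}_i-\mathbf{s}_j$ (the "underlying correlation"). Let $\lambda(\mathbf{s})>0$ be a non-random function on $A$. With $G_1,G_2$ two independent copies of $G$, define the random field $$W(\mathbf{s})=\frac{1}{2\lambda(\mathbf{s})}\big(G_1^2(\mathbf{s})+G_2^2(\mathbf{s})\big),$$ which has exponential marginals with rate $\lambda(\mathbf{s})$ (mean $1/\lambda(\mathbf{s})$). Let $Y_1,Y_2,\ldots$ be an infinite sequence of independent copies of the random field $W$, and set $S_n(\mathbf{s})=\sum_{k=1}^n Y_k(\mathbf{s})$. The Poisson random field $N=\{N(\mathbf{s}),\ \mathbf{s}\in A\}$ with underlying correlation $\rho(\mathbf{h})$ and mean function $\lambda(\mathbf{s})$ is $$N(\mathbf{s})=\begin{cases}0 & \text{if } S_1(\mathbf{s})>1,\\ \max\{n\ge 1:\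 S_n(\mathbf{s})\le 1\} & \text{if } S_1(\mathbf{s})\le 1,\end{cases}$$ (the common observation time is set to $t=1$). For each $\mathbf{s}$, $N(\mathbf{s})$ is Poisson distributed with mean $\lambda(\mathbf{s})$. Special functions: $\gamma^{*}(a,x)=\frac{1}{\Gamma(a)}\int_0^x t^{a-1}e^{-t}\,dt$ is the regularized lower incomplete Gamma function; $\gamma^{\star}(a,x,x')=\gamma^{*}(a,x)\,\gamma^{*}(a,x')$; $(a)_k=\Gamma(a+k)/\Gamma(a)$ is the Pochhammer symbol (rising factorial); and $${}_1\widetilde{\mathrm{F}}_1(a;b;x)=\frac{{}_1\mathrm{F}_1(a;b;x)}{\Gamma(b)}=\sum_{k=0}^{\infty}\frac{(a)_k\,x^k}{\Gamma(b+k)\,k!}$$ is the regularized confluent hypergeometric function. The convention $0^0=1$ is used in the power series. *)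

theory Defs
  imports "HOL-Probability.Probability"
begin

section \<open>Random fields\<close>

text \<open>
  A random field on \<open>A\<close> is a map \<open>X\<close> from locations to real random variables on \<open>M\<close>; only its
  values at locations in \<open>A\<close> matter. It is also viewed as a single random element of the product
  space of real functions on \<open>A\<close>, so that the law of a field is determined by its
  finite-dimensional distributions.
\<close>

definition random_field :: "'w measure \<Rightarrow> 's set \<Rightarrow> ('s \<Rightarrow> 'w \<Rightarrow> real) \<Rightarrow> bool" where
  "random_field M A X \<longleftrightarrow> (\<forall>s\<in>A. X s \<in> borel_measurable M)"

definition field_path :: "'s set \<Rightarrow> ('s \<Rightarrow> 'w \<Rightarrow> real) \<Rightarrow> 'w \<Rightarrow> 's \<Rightarrow> real" where
  "field_path A X \<omega> = (\<lambda>s\<in>A. X s \<omega>)"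

definition field_law :: "'w measure \<Rightarrow> 's set \<Rightarrow> ('s \<Rightarrow> 'w \<Rightarrow> real) \<Rightarrow> ('s \<Rightarrow> real) measure" where
  "field_law M A X = distr M (\<Pi>\<^sub>M s\<in>A. borel) (field_path A X)"

text \<open>Mutually independent fields \<open>X k\<close>, \<open>k \<in> I\<close>, each with the same law as the field \<open>Z\<close>.\<close>

definition independent_copies ::
  "'w measure \<Rightarrow> 's set \<Rightarrow> 'i set \<Rightarrow> ('i \<Rightarrow> 's \<Rightarrow> 'w \<Rightarrow> real) \<Rightarrow> ('s \<Rightarrow> 'w \<Rightarrow> real) \<Rightarrow> bool" where
  "independent_copies M A I X Z \<longleftrightarrow>
     (\<forall>k\<in>I. random_field M A (X k) \<and> field_law M A (X k) = field_law M A Z) \<and>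
     prob_space.indep_vars M (\<lambda>_. \<Pi>\<^sub>M s\<in>A. borel) (\<lambda>k. field_path A (X k)) I"

text \<open>Degenerate (constant) variables count as Gaussian, as usual for linear combinations.\<close>

definition gaussian_rv :: "'w measure \<Rightarrow> ('w \<Rightarrow> real) \<Rightarrow> bool" where
  "gaussian_rv M X \<longleftrightarrow> X \<in> borel_measurable M \<and>
     ((\<exists>\<mu> \<sigma>. \<sigma> > 0 \<and> distributed M lborel X (\<lambda>x. ennreal (normal_density \<mu> \<sigma> x))) \<or>
      (\<exists>\<mu>. AE \<omega> in M. X \<omega> = \<mu>))"

definition gaussian_field :: "'w measure \<Rightarrow> 's set \<Rightarrow> ('s \<Rightarrow> 'w \<Rightarrow> real) \<Rightarrow> bool" where
  "gaussian_field M A G \<longleftrightarrow> random_field M A G \<and>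
     (\<forall>F c. finite F \<and> F \<subseteq> A \<longrightarrow> gaussian_rv M (\<lambda>\<omega>. \<Sum>s\<in>F. c s * G s \<omega>))"

definition mean :: "'w measure \<Rightarrow> ('w \<Rightarrow> real) \<Rightarrow> real" where
  "mean M X = (\<integral>\<omega>. X \<omega> \<partial>M)"

definition covariance :: "'w measure \<Rightarrow> ('w \<Rightarrow> real) \<Rightarrow> ('w \<Rightarrow> real) \<Rightarrow> real" where
  "covariance M X Y = (\<integral>\<omega>. (X \<omega> - mean M X) * (Y \<omega> - mean M Y) \<partial>M)"

definition correlation :: "'w measure \<Rightarrow> ('w \<Rightarrow> real) \<Rightarrow> ('w \<Rightarrow> real) \<Rightarrow> real" where
  "correlation M X Y = covariance M X Y / sqrt (covariance M X X * covariance M Y Y)"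

text \<open>
  Weak stationarity is the constancy of mean and variance together with the fact that the
  correlation is a function \<open>\<rho>\<close> of the separation vector.
\<close>

definition standard_stationary_gaussian_field ::
  "'w measure \<Rightarrow> (real ^ 'd) set \<Rightarrow> (real ^ 'd \<Rightarrow> real) \<Rightarrow> (real ^ 'd \<Rightarrow> 'w \<Rightarrow> real) \<Rightarrow> bool" where
  "standard_stationary_gaussian_field M A \<rho> G \<longleftrightarrow>
     gaussian_field M A G \<and>
     (\<forall>s\<in>A. mean M (G s) = 0 \<and> covariance M (G s) (G s) = 1) \<and>
     (\<forall>s\<in>A. \<forall>t\<in>A. correlation M (G s) (G t) = \<rho> (s - t))"

section \<open>The Poisson random field\<close>

definition exponential_field ::
  "('s \<Rightarrow> real) \<Rightarrow> ('s \<Rightarrow> 'w \<Rightarrow> real) \<Rightarrow> ('s \<Rightarrow> 'w \<Rightarrow> real) \<Rightarrow> 's \<Rightarrow> 'w \<Rightarrow> real" where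
  "exponential_field lam G1 G2 s \<omega> = 1 / (2 * lam s) * ((G1 s \<omega>)\<^sup>2 + (G2 s \<omega>)\<^sup>2)"

definition arrival :: "(nat \<Rightarrow> 's \<Rightarrow> 'w \<Rightarrow> real) \<Rightarrow> nat \<Rightarrow> 's \<Rightarrow> 'w \<Rightarrow> real" where
  "arrival Y n s \<omega> = (\<Sum>k=1..n. Y k s \<omega>)"

text \<open>
  The set under \<open>Max\<close> is infinite only on a null set when the \<open>Y k\<close> are independent copies of an
  exponential field; there \<open>Max\<close> is some fixed natural number.
\<close>

definition arrival_count :: "(nat \<Rightarrow> 's \<Rightarrow> 'w \<Rightarrow> real) \<Rightarrow> 's \<Rightarrow> 'w \<Rightarrow> nat" where
  "arrival_count Y s \<omega> =
     (if arrival Y 1 s \<omega> > 1 then 0 else Max {n. n \<ge> 1 \<and> arrival Y n s \<omega> \<le> 1})"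

definition poisson_random_field ::
  "'w measure \<Rightarrow> (real ^ 'd) set \<Rightarrow> (real ^ 'd \<Rightarrow> real) \<Rightarrow> (real ^ 'd \<Rightarrow> real)
    \<Rightarrow> (real ^ 'd \<Rightarrow> 'w \<Rightarrow> nat) \<Rightarrow> bool" where
  "poisson_random_field M A \<rho> lam N \<longleftrightarrow>
     prob_space M \<and> (\<forall>s\<in>A. lam s > 0) \<and>
     (\<exists>G Gc Y.
        standard_stationary_gaussian_field M A \<rho> G \<and>
        independent_copies M A {1, 2 :: nat} Gc G \<and>
        independent_copies M A {1..} Y (exponential_field lam (Gc 1) (Gc 2)) \<and>
        (\<forall>s\<in>A. \<forall>\<omega>\<in>space M. N s \<omega> = arrival_count Y s \<omega>))"

definition joint_prob ::
  "'w measure \<Rightarrow> ('s \<Rightarrow> 'w \<Rightarrow> nat) \<Rightarrow> 's \<Rightarrow> 's \<Rightarrow> nat \<Rightarrow> nat \<Rightarrow> real" where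
  "joint_prob M N s t n m = measure M {\<omega> \<in> space M. N s \<omega> = n \<and> N t \<omega> = m}"

section \<open>Special functions\<close>

definition lower_gamma_reg :: "real \<Rightarrow> real \<Rightarrow> real" where
  "lower_gamma_reg a x = 1 / Gamma a * integral {0..x} (\<lambda>t. t powr (a - 1) * exp (- t))"

definition lower_gamma_reg2 :: "real \<Rightarrow> real \<Rightarrow> real \<Rightarrow> real" where
  "lower_gamma_reg2 a x x' = lower_gamma_reg a x * lower_gamma_reg a x'"

definition hyp1F1_reg :: "real \<Rightarrow> real \<Rightarrow> real \<Rightarrow> real" where
  "hyp1F1_reg a b x = (\<Sum>k. pochhammer a k * x ^ k / (Gamma (b + real k) * fact k))"

definition g_fun :: "nat \<Rightarrow> real \<Rightarrow> real \<Rightarrow> real \<Rightarrow> real" where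
  "g_fun b x y r =
     x ^ b / fact b * exp (- x)
     - x ^ b * exp (- x / (1 - r\<^sup>2)) *
       (\<Sum>l. (r\<^sup>2 * x / (1 - r\<^sup>2)) ^ l
             * hyp1F1_reg (real b) (real (b + l + 1)) (r\<^sup>2 * x / (1 - r\<^sup>2))
             * lower_gamma_reg (real (l + 1)) (y / (1 - r\<^sup>2)))"

text \<open>Used for \<open>b < a\<close> only, where the truncated subtraction \<open>a - b\<close> is the true difference.\<close>

definition h_fun :: "nat \<Rightarrow> nat \<Rightarrow> real \<Rightarrow> real \<Rightarrow> real \<Rightarrow> real" where
  "h_fun a b x y r =
     x ^ a * exp (- x / (1 - r\<^sup>2)) *
     ((\<Sum>l. pochhammer (real b) l / fact l * (r\<^sup>2 * x / (1 - r\<^sup>2)) ^ l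
            * hyp1F1_reg (real (a - b + 1)) (real (a + l + 1)) (r\<^sup>2 * x / (1 - r\<^sup>2))
            * lower_gamma_reg (real (b + l)) (y / (1 - r\<^sup>2)))
      - (\<Sum>k. \<Sum>l. pochhammer (real b) l / fact l * (r\<^sup>2 * x / (1 - r\<^sup>2)) ^ (k + l)
            * hyp1F1_reg (real (a - b)) (real (a + k + l + 1)) (r\<^sup>2 * x / (1 - r\<^sup>2))
            * lower_gamma_reg (real (b + k + l + 1)) (y / (1 - r\<^sup>2))))"

end

theory Submission
  imports Defs
begin

text \<open>
  Every joint probability of the two counts is an inclusion-exclusion combination of
  \<open>P(S\<^sub>a(s) \<le> 1, S\<^sub>b(t) \<le> 1)\<close>. With \<open>\<theta> = 1 - r\<^sup>2\<close>, let \<open>K\<^sub>\<alpha>\<close> be the mixture over \<open>k\<close>, with weights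
  \<open>\<theta>\<^sup>\<alpha> r\<^bsup>2k\<^esup> (\<alpha>)\<^sub>k / k!\<close>, of the products of two Gamma laws with shape \<open>\<alpha> + k\<close> and scale \<open>\<theta>\<close>.
  Expanding the bivariate normal density in even powers of the product of its arguments shows
  that \<open>(G(s)\<^sup>2/2, G(t)\<^sup>2/2)\<close> has law \<open>K\<^sub>1\<^sub>/\<^sub>2\<close>, and \<open>K\<^sub>\<alpha> * K\<^sub>\<beta> = K\<^sub>\<alpha>\<^sub>+\<^sub>\<beta>\<close> by the Vandermonde identity, so that
  \<open>(\<lambda>(s) S\<^sub>n(s), \<lambda>(t) S\<^sub>n(t))\<close> has law \<open>K\<^sub>n\<close>. For \<open>a \<ge> b\<close> the difference
  \<open>P(S\<^sub>a(s) \<le> 1, S\<^sub>b(t) \<le> 1) - P(S\<^sub>a\<^sub>+\<^sub>1(s) \<le> 1, S\<^sub>b(t) \<le> 1)\<close> is the probability of exactly \<open>a - b\<close> further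
  arrivals of a Poisson process started at \<open>S\<^sub>b(s)\<close>; integrating it against \<open>K\<^sub>b\<close> gives the stated series.
\<close>

section \<open>Uniqueness of planar characteristic functions\<close>

text \<open>The field is Gaussian only in the sense that linear combinations are, so the joint
  density of \<open>(G s, G t)\<close> is not given: it is recovered from one-dimensional
  characteristic functions, hence a planar uniqueness theorem. Only even powers survive because half
  squares do not see signs: reflecting one argument turns the exponential cross factor into a cosh.
  Series and integrals are interchanged in \<open>ennreal\<close>, where Tonelli is free; real
  summability is read off afterwards from the finiteness of a probability. The scale \<theta> shapes
  the answer: exp(-u/\<theta>) = exp(-u) exp(-r^2 u/\<theta>). Against a unit-rate Poisson process
  the leftover factor, expanded in powers of x - u, yields the confluent hypergeometric functions;
  when no further arrival is asked for, it is absorbed into a Gamma law of scale \<theta>/r^2, which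
  gives the middle term of (c) and forces r to be nonzero there. Off the diagonal the four
  inclusion-exclusion terms are paired into differences at b and b + 1, and the double series arise
  because the mixture coefficients for b + 1 are partial sums of those for b.\<close>

lemma finite_measure_eqI_char:
  fixes P Q :: "real measure"
  assumes P: "finite_measure P" "sets P = sets borel"
    and Q: "finite_measure Q" "sets Q = sets borel"
    and char: "\<And>t. char P t = char Q t"
  shows "P = Q"
proof -
  interpret P: finite_measure P by fact
  interpret Q: finite_measure Q by fact
  note [measurable_cong] = P(2) Q(2)
  have spP: "space P = UNIV" and spQ: "space Q = UNIV"
    using sets_eq_imp_space_eq[OF P(2)] sets_eq_imp_space_eq[OF Q(2)] by auto
  \<comment> \<open>Agreement at t = 0 gives equal total masses, so both measures can be normalised
    by the same constant and handed to \<open>Levy_uniqueness\<close>; mass zero is the trivial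
    case.\<close>
  define c where "c = measure P UNIV"
  have c_Q: "c = measure Q UNIV"
    using char[of 0] by (simp add: char_def c_def spP spQ)
  have emP: "emeasure P UNIV = ennreal c" and emQ: "emeasure Q UNIV = ennreal c"
    using P.emeasure_eq_measure[of UNIV] Q.emeasure_eq_measure[of UNIV] c_def c_Q by auto
  show ?thesis
  proof (cases "c = 0")
    case True
    have "emeasure P A = emeasure Q A" for A
      using emeasure_space[of P A] emeasure_space[of Q A] emP emQ True by (simp add: spP spQ)
    then show ?thesis by (intro measure_eqI) (use P Q in auto)
  next
    case False
    then have c: "c > 0" by (simp add: c_def zero_less_measure_iff order_less_le)
    define P' where "P' = density P (\<lambda>_. ennreal (1 / c))"
    define Q' where "Q' = density Q (\<lambda>_. ennreal (1 / c))"
    have one: "ennreal (1 / c) * ennreal c = 1"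
      using c by (simp add: ennreal_mult[symmetric])
    have "real_distribution P'" "real_distribution Q'"
      unfolding real_distribution_def real_distribution_axioms_def P'_def Q'_def
      using one P(2) Q(2)
      by (auto intro!: prob_spaceI simp: emeasure_density nn_integral_cmult spP spQ emP emQ)
    moreover have "char P' = char Q'"
    proof
      fix t
      have "char P' t = (1 / c) *\<^sub>R char P t" "char Q' t = (1 / c) *\<^sub>R char Q t"
        unfolding P'_def Q'_def char_def using c by (subst integral_density; simp)+
      then show "char P' t = char Q' t" by (simp add: char)
    qed
    ultimately have eq: "P' = Q'" by (rule Levy_uniqueness)
    have "emeasure P A = emeasure Q A" if A: "A \<in> sets borel" for A
    proof -
      have "ennreal (1 / c) * emeasure P A = ennreal (1 / c) * emeasure Q A"
        using arg_cong[OF eq, of "\<lambda>M. emeasure M A"] A P(2) Q(2)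
        by (simp add: P'_def Q'_def emeasure_density nn_integral_cmult_indicator)
      then show ?thesis
        using c by (simp add: ennreal_mult_cancel_left)
    qed
    then show ?thesis by (intro measure_eqI) (use P Q in auto)
  qed
qed

lemma iexp_conv_cos_sin: "iexp x = complex_of_real (cos x) + \<i> * complex_of_real (sin x)"
  by (simp add: cis_conv_exp[symmetric] complex_eq_iff)

text \<open>One-dimensional uniqueness is used twice. Applied to weighted first marginals, it shows
  that the integrals of cos(t v + \<theta>) over the strip \<open>fst z \<in> B\<close> agree. These
  integrals are the real and imaginary parts of the characteristic function of the second coordinate
  on that strip, so a second application gives agreement on all rectangles.\<close>

lemma pair_measure_eqI_char:
  fixes P Q :: "(real \<times> real) measure"
  assumes P: "prob_space P" "sets P = sets (borel \<Otimes>\<^sub>M borel)"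
    and Q: "prob_space Q" "sets Q = sets (borel \<Otimes>\<^sub>M borel)"
    and char: "\<And>s t. (CLINT z|P. iexp (s * fst z + t * snd z)) = (CLINT z|Q. iexp (s * fst z + t * snd z))"
  shows "P = Q"
proof -
  define w :: "real \<Rightarrow> real \<Rightarrow> real \<times> real \<Rightarrow> real" where "w = (\<lambda>t \<theta> z. 2 + cos (t * snd z + \<theta>))"
  have w_pos: "w t \<theta> z > 0" and w_le: "w t \<theta> z \<le> 3" for t \<theta> z
    using cos_ge_minus_one[of "t * snd z + \<theta>"] cos_le_one[of "t * snd z + \<theta>"]
    unfolding w_def by linarith+
  have w_nonneg [simp]: "w t \<theta> z \<ge> 0" for t \<theta> z using w_pos[of t \<theta> z] by simp
  \<comment> \<open>Weighting the first marginal by the positive function \<open>2 + cos (t v + \<theta>)\<close> gives a finite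
    measure whose characteristic function is a combination of values of the joint one.\<close>
  have w_facts:
    "w t \<theta> \<in> borel_measurable M"
    "sets (distr (density M (w t \<theta>)) borel fst) = sets borel"
    "finite_measure (distr (density M (w t \<theta>)) borel fst)"
    "char (distr (density M (w t \<theta>)) borel fst) s =
       2 * (CLINT z|M. iexp (s * fst z + 0 * snd z))
        + (iexp \<theta> * (CLINT z|M. iexp (s * fst z + t * snd z))
           + iexp (-\<theta>) * (CLINT z|M. iexp (s * fst z + (-t) * snd z))) / 2"
    if M: "prob_space M" "sets M = sets (borel \<Otimes>\<^sub>M borel)" for M :: "(real \<times> real) measure" and t \<theta> s
  proof -
    interpret M: prob_space M by fact
    note [measurable_cong] = M(2)
    show m [measurable]: "w t \<theta> \<in> borel_measurable M" unfolding w_def by measurable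
    show "sets (distr (density M (w t \<theta>)) borel fst) = sets borel" by simp
    show "finite_measure (distr (density M (w t \<theta>)) borel fst)"
    proof (intro finite_measure.finite_measure_distr finite_measureI)
      have "emeasure (density M (w t \<theta>)) (space M) = (\<integral>\<^sup>+z. ennreal (w t \<theta> z) * indicator (space M) z \<partial>M)"
        by (rule emeasure_density) auto
      also have "\<dots> \<le> (\<integral>\<^sup>+z. ennreal 3 \<partial>M)"
        by (intro nn_integral_mono) (use ennreal_leI[OF w_le[of t \<theta>]] in \<open>auto split: split_indicator\<close>)
      also have "\<dots> < \<infinity>" by (simp add: M.emeasure_space_1)
      finally show "emeasure (density M (w t \<theta>)) (space (density M (w t \<theta>))) \<noteq> \<infinity>" by simp
    qed simp
    have int: "integrable M (\<lambda>z. iexp (a * fst z + b * snd z))" for a b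
      by (rule M.integrable_const_bound[of _ 1]) auto
    have pw: "w t \<theta> z *\<^sub>R iexp (s * fst z) = 2 * iexp (s * fst z + 0 * snd z)
        + (iexp \<theta> * iexp (s * fst z + t * snd z) + iexp (-\<theta>) * iexp (s * fst z + (-t) * snd z)) / 2" for z
    proof -
      have c: "complex_of_real (cos y) = (iexp y + iexp (- y)) / 2" for y
        using iexp_conv_cos_sin[of y] iexp_conv_cos_sin[of "-y"] by (simp add: field_simps)
      have a: "iexp (x + y) = iexp x * iexp y" for x y
        by (simp add: exp_add[symmetric] algebra_simps)
      have "w t \<theta> z *\<^sub>R iexp (s * fst z)
          = (2 + (iexp (t * snd z + \<theta>) + iexp (- t * snd z + - \<theta>)) / 2) * iexp (s * fst z)"
        using c[of "t * snd z + \<theta>"] by (simp add: w_def scaleR_conv_of_real)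
      also have "\<dots> = 2 * iexp (s * fst z + 0 * snd z)
        + (iexp \<theta> * iexp (s * fst z + t * snd z) + iexp (-\<theta>) * iexp (s * fst z + (-t) * snd z)) / 2"
        unfolding a by (simp add: field_simps)
      finally show ?thesis .
    qed
    have "char (distr (density M (w t \<theta>)) borel fst) s = (CLINT z|M. w t \<theta> z *\<^sub>R iexp (s * fst z))"
      unfolding char_def by (subst integral_distr, simp, simp, subst integral_density) auto
    also have "\<dots> = 2 * (CLINT z|M. iexp (s * fst z + 0 * snd z))
        + (iexp \<theta> * (CLINT z|M. iexp (s * fst z + t * snd z))
           + iexp (-\<theta>) * (CLINT z|M. iexp (s * fst z + (-t) * snd z))) / 2"
      unfolding pw using int[of s 0] int[of s t] int[of s "-t"] by simp
    finally show "char (distr (density M (w t \<theta>)) borel fst) s = \<dots>" .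
  qed
  define I :: "(real \<times> real) measure \<Rightarrow> real set \<Rightarrow> (real \<times> real \<Rightarrow> real) \<Rightarrow> real"
    where "I = (\<lambda>M B f. LINT z|M. indicator B (fst z) * f z)"
  \<comment> \<open>Since \<open>w 0 0\<close> is the constant 3, the factor 2 / 3 subtracts exactly
    the contribution of the summand 2 in \<open>w t \<theta>\<close> and leaves the bare
    cosine.\<close>
  have I_trig: "I M B (\<lambda>z. cos (t * snd z + \<theta>))
      = measure (distr (density M (w t \<theta>)) borel fst) B - 2 / 3 * measure (distr (density M (w 0 0)) borel fst) B"
    if M: "prob_space M" "sets M = sets (borel \<Otimes>\<^sub>M borel)" and B: "B \<in> sets borel"
    for M :: "(real \<times> real) measure" and B t \<theta>
  proof -
    interpret M: prob_space M by fact
    note [measurable_cong] = M(2)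
    note [measurable] = B w_facts(1)[OF M]
    have meas: "measure (distr (density M (w t \<theta>)) borel fst) B = (LINT z|M. indicator B (fst z) * w t \<theta> z)" for t \<theta>
    proof -
      interpret D: finite_measure "distr (density M (w t \<theta>)) borel fst" by (rule w_facts[OF M])
      have "measure (distr (density M (w t \<theta>)) borel fst) B = (LINT x|distr (density M (w t \<theta>)) borel fst. indicator B x)"
        by simp
      also have "\<dots> = (LINT z|M. w t \<theta> z * indicator B (fst z))"
        by (subst integral_distr, simp, simp, subst integral_density) auto
      finally show ?thesis by (simp add: mult.commute)
    qed
    have "integrable M (\<lambda>z. indicator B (fst z) * cos (t * snd z + \<theta>))"
      by (rule M.integrable_const_bound[of _ 1]) (auto split: split_indicator)
    moreover have "integrable M (\<lambda>z. indicator B (fst z) :: real)"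
      by (rule M.integrable_const_bound[of _ 1]) auto
    ultimately show ?thesis
      unfolding meas I_def by (simp add: w_def algebra_simps)
  qed
  have I_eq: "I P B (\<lambda>z. cos (t * snd z + \<theta>)) = I Q B (\<lambda>z. cos (t * snd z + \<theta>))"
    if B: "B \<in> sets borel" for B t \<theta>
  proof -
    have "distr (density P (w t \<theta>)) borel fst = distr (density Q (w t \<theta>)) borel fst" for t \<theta>
      by (rule finite_measure_eqI_char[OF w_facts(3)[OF P] _ w_facts(3)[OF Q]])
         (simp_all only: w_facts(4)[OF P] w_facts(4)[OF Q] char sets_distr)
    then show ?thesis
      unfolding I_trig[OF P B] I_trig[OF Q B] by simp
  qed
  have prod_eq: "emeasure P (B \<times> C) = emeasure Q (B \<times> C)" if B: "B \<in> sets borel" and C: "C \<in> sets borel" for B C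
  proof -
    \<comment> \<open>The law of the second coordinate restricted to the strip over B. The phases 0
      and -pi/2 turn the cosine into the real and imaginary parts of its characteristic
      function.\<close>
    define D where "D = (\<lambda>M. distr (density M (\<lambda>z. ennreal (indicator B (fst z :: real)))) borel (snd :: real \<times> real \<Rightarrow> real))"
    have D_facts: "finite_measure (D M)"
      "char (D M) t = complex_of_real (I M B (\<lambda>z. cos (t * snd z + 0))) + \<i> * complex_of_real (I M B (\<lambda>z. cos (t * snd z + (- pi / 2))))"
      "emeasure (D M) C = emeasure M (B \<times> C)"
      if M: "prob_space M" "sets M = sets (borel \<Otimes>\<^sub>M borel)" for M :: "(real \<times> real) measure" and t
    proof -
      interpret M: prob_space M by fact
      note [measurable_cong] = M(2)
      note [measurable] = B C
      have spM: "space M = UNIV" using sets_eq_imp_space_eq[OF M(2)] by (simp add: space_pair_measure)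
      show "finite_measure (D M)"
        unfolding D_def
      proof (intro finite_measure.finite_measure_distr finite_measureI)
        have "emeasure (density M (\<lambda>z. ennreal (indicator B (fst z)))) (space M)
            = (\<integral>\<^sup>+z. ennreal (indicator B (fst z)) * indicator (space M) z \<partial>M)"
          by (rule emeasure_density) auto
        also have "\<dots> \<le> (\<integral>\<^sup>+z. 1 \<partial>M)"
          by (intro nn_integral_mono) (auto split: split_indicator)
        also have "\<dots> < \<infinity>" by (simp add: M.emeasure_space_1)
        finally show "emeasure (density M (\<lambda>z. ennreal (indicator B (fst z)))) (space (density M (\<lambda>z. ennreal (indicator B (fst z))))) \<noteq> \<infinity>" by simp
      qed simp
      have i: "integrable M (\<lambda>z. indicator B (fst z) * cos (t * snd z + \<theta>))" for \<theta>
        by (rule M.integrable_const_bound[of _ 1]) (auto split: split_indicator)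
      have ci: "complex_integrable M (\<lambda>z. complex_of_real (indicator B (fst z) * cos (t * snd z + \<theta>)))" for \<theta>
        using i by (rule integrable_of_real)
      have "char (D M) t = (CLINT z|M. indicator B (fst z) *\<^sub>R iexp (t * snd z))"
        unfolding char_def D_def by (subst integral_distr, simp, simp, subst integral_density) auto
      also have "\<dots> = (CLINT z|M. complex_of_real (indicator B (fst z) * cos (t * snd z + 0))
           + \<i> * complex_of_real (indicator B (fst z) * cos (t * snd z + (- pi / 2))))"
        by (intro Bochner_Integration.integral_cong refl)
          (use iexp_conv_cos_sin[of "t * _"] in \<open>auto simp: cos_diff split: split_indicator\<close>)
      also have "\<dots> = complex_of_real (I M B (\<lambda>z. cos (t * snd z + 0))) + \<i> * complex_of_real (I M B (\<lambda>z. cos (t * snd z + (- pi / 2))))"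
        unfolding I_def
        by (simp only: Bochner_Integration.integral_add ci integrable_mult_right
              Bochner_Integration.integral_mult_right_zero integral_complex_of_real)
      finally show "char (D M) t = \<dots>" .
      have "snd -` C \<inter> space M \<in> sets M" by measurable
      then have vC: "snd -` C \<in> sets M" by (simp add: spM)
      have "emeasure (D M) C = (\<integral>\<^sup>+z. ennreal (indicator B (fst z)) * indicator C (snd z) \<partial>M)"
        unfolding D_def
        by (subst emeasure_distr, simp, simp, subst emeasure_density)
           (auto intro!: nn_integral_cong split: split_indicator simp: spM vC)
      also have "\<dots> = (\<integral>\<^sup>+z. indicator (B \<times> C) z \<partial>M)"
        by (intro nn_integral_cong) (auto split: split_indicator)
      finally show "emeasure (D M) C = emeasure M (B \<times> C)" by simp
    qed
    have "D P = D Q"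
      by (rule finite_measure_eqI_char[OF D_facts(1)[OF P] _ D_facts(1)[OF Q]])
         (simp_all only: D_facts(2)[OF P] D_facts(2)[OF Q] I_eq[OF B], simp_all add: D_def)
    with D_facts(3)[OF P] D_facts(3)[OF Q] show ?thesis by metis
  qed
  interpret P: prob_space P by fact
  show ?thesis
  proof (rule measure_eqI_generator_eq[where E="{B \<times> C | B C. B \<in> sets (borel :: real measure) \<and> C \<in> sets (borel :: real measure)}"
        and \<Omega>=UNIV and A="\<lambda>_. UNIV"])
    show "Int_stable {B \<times> C | B C. B \<in> sets (borel :: real measure) \<and> C \<in> sets (borel :: real measure)}"
      using Int_stable_pair_measure_generator[of borel borel] by (simp add: Int_stable_def)
    show "range (\<lambda>_. UNIV) \<subseteq> {B \<times> C | B C. B \<in> sets (borel :: real measure) \<and> C \<in> sets (borel :: real measure)}"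
      by (auto intro!: exI[of _ UNIV])
  qed (use prod_eq P Q P.emeasure_finite in \<open>auto simp: sets_pair_measure\<close>)
qed

section \<open>The Kibble convolution semigroup\<close>

lemma ennreal_suminf_swap:
  fixes F :: "nat \<Rightarrow> nat \<Rightarrow> ennreal"
  shows "(\<Sum>k. \<Sum>l. F k l) = (\<Sum>l. \<Sum>k. F k l)"
proof -
  \<comment> \<open>A series is an integral over counting measure, so the swap is an instance of
    integrating a series termwise.\<close>
  have "(\<Sum>k. \<Sum>l. F k l) = (\<integral>\<^sup>+k. (\<Sum>l. F k l) \<partial>count_space UNIV)"
    by (simp add: nn_integral_count_space_nat)
  also have "\<dots> = (\<Sum>l. \<Sum>k. F k l)"
    by (subst nn_integral_suminf) (simp_all add: nn_integral_count_space_nat)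
  finally show ?thesis .
qed

text \<open>Row k is shifted right by k places and padded with zeros; the column sums of the padded
  array are the diagonal sums.\<close>

lemma ennreal_suminf_diagonal:
  fixes F :: "nat \<Rightarrow> nat \<Rightarrow> ennreal"
  shows "(\<Sum>k. \<Sum>l. F k l) = (\<Sum>m. \<Sum>k\<le>m. F k (m - k))"
proof -
  define G where "G = (\<lambda>k m. if k \<le> m then F k (m - k) else 0)"
  have "(\<Sum>l. F k l) = (\<Sum>m. G k m)" for k
  proof -
    have "(\<Sum>m. G k m) = (\<Sum>m. G k (m + k)) + (\<Sum>m<k. G k m)"
      by (rule suminf_offset) simp
    then show ?thesis by (simp add: G_def)
  qed
  moreover have "(\<Sum>k. G k m) = (\<Sum>k\<le>m. F k (m - k))" for m
    by (subst suminf_finite[of "{..m}"]) (auto simp: G_def)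
  ultimately show ?thesis
    by (simp add: ennreal_suminf_swap[of G])
qed

text \<open>Serves the double series of (c) and (d), whose terms depend on k only through k + l. The
  computation is done in \<open>ennreal\<close>; finiteness of the diagonal series then yields
  summability of every inner series and of the outer one, so that the real \<open>suminf\<close>
  values are genuine sums.\<close>

lemma suminf_diagonal_nonneg:
  fixes c T :: "nat \<Rightarrow> real"
  assumes c: "\<And>l. c l \<ge> 0" and T: "\<And>m. T m \<ge> 0"
    and sm: "summable (\<lambda>m. (\<Sum>l\<le>m. c l) * T m)"
  shows "(\<Sum>k. \<Sum>l. c l * T (k + l)) = (\<Sum>m. (\<Sum>l\<le>m. c l) * T m)"
proof -
  let ?E = "\<lambda>l k. ennreal (c l * T (k + l))"
  have nn: "c l * T (k + l) \<ge> 0" "(\<Sum>l\<le>m. c l) * T m \<ge> 0" for k l m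
    by (auto intro!: mult_nonneg_nonneg sum_nonneg c T)
  have "(\<Sum>k. \<Sum>l. ?E l k) = (\<Sum>m. \<Sum>l\<le>m. ?E l (m - l))"
    by (subst ennreal_suminf_swap) (rule ennreal_suminf_diagonal)
  also have "\<dots> = (\<Sum>m. ennreal ((\<Sum>l\<le>m. c l) * T m))"
    by (intro arg_cong[where f=suminf] ext) (simp add: sum_distrib_right sum_ennreal c T)
  also have "\<dots> = ennreal (\<Sum>m. (\<Sum>l\<le>m. c l) * T m)"
    by (rule suminf_ennreal2[OF nn(2) sm])
  finally have tot: "(\<Sum>k. \<Sum>l. ?E l k) = ennreal (\<Sum>m. (\<Sum>l\<le>m. c l) * T m)" .
  have inner: "summable (\<lambda>l. c l * T (k + l))" for k
  proof (rule summable_suminf_not_top)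
    have "(\<Sum>l. ?E l k) \<le> (\<Sum>k. \<Sum>l. ?E l k)"
      using sum_le_suminf[of "\<lambda>k. \<Sum>l. ?E l k" "{k}"] by simp
    also have "\<dots> < top" unfolding tot by simp
    finally show "(\<Sum>l. ?E l k) \<noteq> top" by simp
  qed (rule nn)
  have inner_eq: "(\<Sum>l. ?E l k) = ennreal (\<Sum>l. c l * T (k + l))" for k
    by (rule suminf_ennreal2[OF nn(1) inner])
  have inner_nn: "(\<Sum>l. c l * T (k + l)) \<ge> 0" for k
    by (rule suminf_nonneg[OF inner nn(1)])
  have outer: "summable (\<lambda>k. \<Sum>l. c l * T (k + l))"
    by (rule summable_suminf_not_top) (use inner_nn tot inner_eq in auto)
  have "ennreal (\<Sum>k. \<Sum>l. c l * T (k + l)) = ennreal (\<Sum>m. (\<Sum>l\<le>m. c l) * T m)"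
    using suminf_ennreal2[OF inner_nn outer] tot by (simp add: inner_eq)
  then show ?thesis
    by (subst (asm) ennreal_inj) (auto intro!: suminf_nonneg outer inner_nn sm nn)
qed

text \<open>Shape a, scale \<theta>. Real shapes are needed because the half square of a single
  Gaussian contributes shape 1/2.\<close>

definition gamma_density :: "real \<Rightarrow> real \<Rightarrow> real \<Rightarrow> real" where
  "gamma_density a \<theta> x =
     (if x > 0 then x powr (a - 1) * exp (- x / \<theta>) / (Gamma a * \<theta> powr a) else 0)"

lemma gamma_density_nonneg: "a > 0 \<Longrightarrow> gamma_density a \<theta> x \<ge> 0"
  by (simp add: gamma_density_def Gamma_real_nonneg)

lemma gamma_density_measurable [measurable]: "gamma_density a \<theta> \<in> borel_measurable borel"
  unfolding gamma_density_def by measurable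

text \<open>The substitution y = x t reduces this to the Beta integral on the unit interval. It
  serves both the convolution of Gamma densities and the termwise integration behind the
  hypergeometric series.\<close>

lemma nn_integral_Beta_scaled:
  fixes a b x :: real
  assumes "a > 0" "b > 0" "x > 0"
  shows "(\<integral>\<^sup>+y. ennreal (indicator {0<..<x} y * ((x - y) powr (a - 1) * y powr (b - 1))) \<partial>lborel)
           = ennreal (x powr (a + b - 1) * Beta a b)"
proof -
  have "(\<integral>\<^sup>+y. ennreal (indicator {0<..<x} y * ((x - y) powr (a - 1) * y powr (b - 1))) \<partial>lborel)
      = \<bar>x\<bar> * (\<integral>\<^sup>+t. ennreal (indicator {0<..<x} (0 + x * t) * ((x - (0 + x * t)) powr (a - 1) * (0 + x * t) powr (b - 1))) \<partial>lborel)"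
    using assms by (intro nn_integral_real_affine) auto
  also have "(\<integral>\<^sup>+t. ennreal (indicator {0<..<x} (0 + x * t) * ((x - (0 + x * t)) powr (a - 1) * (0 + x * t) powr (b - 1))) \<partial>lborel)
      = (\<integral>\<^sup>+t. ennreal (x powr (a + b - 2)) * ennreal (indicator {0..1} t * (t powr (b - 1) * (1 - t) powr (a - 1))) \<partial>lborel)"
  proof (intro nn_integral_cong)
    fix t :: real
    show "ennreal (indicator {0<..<x} (0 + x * t) * ((x - (0 + x * t)) powr (a - 1) * (0 + x * t) powr (b - 1)))
      = ennreal (x powr (a + b - 2)) * ennreal (indicator {0..1} t * (t powr (b - 1) * (1 - t) powr (a - 1)))"
    proof (cases "0 < t \<and> t < 1")
      case True
      have *: "x - x * t = x * (1 - t)" by (simp add: algebra_simps)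
      have "(x - x * t) powr (a - 1) * (x * t) powr (b - 1)
          = x powr (a + b - 2) * (t powr (b - 1) * (1 - t) powr (a - 1))"
      proof -
        have "x powr (a + b - 2) = x powr (a - 1) * x powr (b - 1)"
          by (simp add: powr_add[symmetric] algebra_simps)
        moreover have "(x * (1 - t)) powr (a - 1) = x powr (a - 1) * (1 - t) powr (a - 1)"
          using True assms by (simp add: powr_mult)
        moreover have "(x * t) powr (b - 1) = x powr (b - 1) * t powr (b - 1)"
          using True assms by (simp add: powr_mult)
        ultimately show ?thesis
          by (simp add: *)
      qed
      then show ?thesis
        using True assms by (simp add: ennreal_mult[symmetric] mult_less_cancel_left2)
    next
      case False
      \<comment> \<open>The open interval on one side and the closed one on the other do not clash:
        at t = 0 and t = 1 the product vanishes because \<open>0 powr a = 0\<close>.\<close>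
      then have "t \<le> 0 \<or> t \<ge> 1" by auto
      moreover have "x * t \<notin> {0<..<x}"
        using False assms by (auto simp: zero_less_mult_iff mult_less_cancel_left2)
      ultimately show ?thesis by (auto split: split_indicator)
    qed
  qed
  also have "\<dots> = ennreal (x powr (a + b - 2)) * ennreal (Beta b a)"
    using nn_integral_has_integral_lebesgue[OF _ has_integral_Beta_real[OF assms(2,1)]]
    by (subst nn_integral_cmult) auto
  also have "ennreal \<bar>x\<bar> * \<dots> = ennreal (x powr (a + b - 1) * Beta a b)"
  proof -
    have "x * x powr (a + b - 2) = x powr (a + b - 1)"
      using assms by (simp add: powr_mult_base)
    moreover have "Beta b a \<ge> 0"
      using assms by (simp add: Beta_def Gamma_real_nonneg)
    ultimately show ?thesis
      using assms by (simp add: ennreal_mult[symmetric] Beta_commute mult.assoc[symmetric])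
  qed
  finally show ?thesis .
qed

text \<open>Equal scales make the exponential factor exp(-x/\<theta>) independent of y; the
  remaining Beta integral trades Gamma a * Gamma b for Gamma (a + b).\<close>

lemma gamma_density_convolution:
  assumes "a > 0" "b > 0" "\<theta> > 0"
  shows "(\<integral>\<^sup>+y. ennreal (gamma_density a \<theta> (x - y)) * ennreal (gamma_density b \<theta> y) \<partial>lborel)
           = ennreal (gamma_density (a + b) \<theta> x)"
proof (cases "x > 0")
  case True
  let ?C = "exp (- x / \<theta>) / (Gamma a * Gamma b * \<theta> powr (a + b))"
  have G: "Gamma a > 0" "Gamma b > 0" "Gamma (a + b) > 0"
    using assms by (auto intro: Gamma_real_pos)
  have "(\<integral>\<^sup>+y. ennreal (gamma_density a \<theta> (x - y)) * ennreal (gamma_density b \<theta> y) \<partial>lborel)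
      = (\<integral>\<^sup>+y. ennreal ?C * ennreal (indicator {0<..<x} y * ((x - y) powr (a - 1) * y powr (b - 1))) \<partial>lborel)"
  proof (intro nn_integral_cong)
    fix y
    have e: "exp (- (x - y) / \<theta>) * exp (- y / \<theta>) = exp (- x / \<theta>)"
      using assms by (simp add: exp_add[symmetric] field_simps)
    have "gamma_density a \<theta> (x - y) * gamma_density b \<theta> y
        = ?C * (indicator {0<..<x} y * ((x - y) powr (a - 1) * y powr (b - 1)))"
      unfolding e[symmetric] using assms
      by (auto simp: gamma_density_def powr_add field_simps split: split_indicator)
    then show "ennreal (gamma_density a \<theta> (x - y)) * ennreal (gamma_density b \<theta> y)
        = ennreal ?C * ennreal (indicator {0<..<x} y * ((x - y) powr (a - 1) * y powr (b - 1)))"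
      using assms G by (simp add: ennreal_mult'[symmetric] gamma_density_nonneg)
  qed
  also have "\<dots> = ennreal (?C * (x powr (a + b - 1) * Beta a b))"
    using assms True G
    by (subst nn_integral_cmult) (auto simp: nn_integral_Beta_scaled ennreal_mult'[symmetric])
  also have "?C * (x powr (a + b - 1) * Beta a b) = gamma_density (a + b) \<theta> x"
    using True G by (simp add: gamma_density_def Beta_def mult.commute)
  finally show ?thesis .
next
  case False
  have z: "ennreal (gamma_density a \<theta> (x - y)) * ennreal (gamma_density b \<theta> y) = 0" for y
    using False by (simp add: gamma_density_def)
  show ?thesis
    unfolding z using False by (simp add: gamma_density_def)
qed

text \<open>The convolution in the form tested against f, which can be applied to one coordinate of
  a planar integral while the other is held fixed.\<close>

lemma nn_integral_gamma_density_add: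
  fixes f :: "real \<Rightarrow> ennreal"
  assumes [measurable]: "f \<in> borel_measurable borel" and "a > 0" "b > 0" "\<theta> > 0"
  shows "(\<integral>\<^sup>+x. ennreal (gamma_density a \<theta> x) * (\<integral>\<^sup>+y. ennreal (gamma_density b \<theta> y) * f (x + y) \<partial>lborel) \<partial>lborel)
           = (\<integral>\<^sup>+z. ennreal (gamma_density (a + b) \<theta> z) * f z \<partial>lborel)"
proof -
  have "(\<integral>\<^sup>+x. ennreal (gamma_density a \<theta> x) * (\<integral>\<^sup>+y. ennreal (gamma_density b \<theta> y) * f (x + y) \<partial>lborel) \<partial>lborel)
      = (\<integral>\<^sup>+x. \<integral>\<^sup>+y. ennreal (gamma_density a \<theta> x) * (ennreal (gamma_density b \<theta> y) * f (x + y)) \<partial>lborel \<partial>lborel)"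
    by (simp add: nn_integral_cmult)
  also have "\<dots> = (\<integral>\<^sup>+y. \<integral>\<^sup>+x. ennreal (gamma_density a \<theta> x) * (ennreal (gamma_density b \<theta> y) * f (x + y)) \<partial>lborel \<partial>lborel)"
    by (rule lborel_pair.Fubini'[symmetric]) measurable
  also have "\<dots> = (\<integral>\<^sup>+y. \<integral>\<^sup>+z. ennreal (gamma_density a \<theta> (z - y)) * (ennreal (gamma_density b \<theta> y) * f z) \<partial>lborel \<partial>lborel)"
  proof (rule nn_integral_cong)
    fix y
    show "(\<integral>\<^sup>+x. ennreal (gamma_density a \<theta> x) * (ennreal (gamma_density b \<theta> y) * f (x + y)) \<partial>lborel)
        = (\<integral>\<^sup>+z. ennreal (gamma_density a \<theta> (z - y)) * (ennreal (gamma_density b \<theta> y) * f z) \<partial>lborel)"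
      by (subst nn_integral_real_affine[where c=1 and t="-y"]) auto
  qed
  also have "\<dots> = (\<integral>\<^sup>+z. \<integral>\<^sup>+y. ennreal (gamma_density a \<theta> (z - y)) * (ennreal (gamma_density b \<theta> y) * f z) \<partial>lborel \<partial>lborel)"
    by (rule lborel_pair.Fubini'[symmetric]) measurable
  also have "\<dots> = (\<integral>\<^sup>+z. (\<integral>\<^sup>+y. ennreal (gamma_density a \<theta> (z - y)) * ennreal (gamma_density b \<theta> y) \<partial>lborel) * f z \<partial>lborel)"
    by (simp add: nn_integral_multc mult.assoc[symmetric])
  also have "\<dots> = (\<integral>\<^sup>+z. ennreal (gamma_density (a + b) \<theta> z) * f z \<partial>lborel)"
    using assms by (simp add: gamma_density_convolution)
  finally show ?thesis .
qed

text \<open>The law of \<open>n\<close>-fold sums of the pairs \<open>(W(s), W(t))\<close>: a negative binomial mixture of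
  products of Gamma laws (Kibble's bivariate Gamma distribution).\<close>

definition kibble_weight :: "real \<Rightarrow> real \<Rightarrow> nat \<Rightarrow> real" where
  "kibble_weight a r k = (1 - r\<^sup>2) powr a * r ^ (2 * k) * pochhammer a k / fact k"

text \<open>Valued in \<open>ennreal\<close>, so that the mixture needs no convergence
  argument.\<close>

definition kibble_density :: "real \<Rightarrow> real \<Rightarrow> real \<times> real \<Rightarrow> ennreal" where
  "kibble_density a r z = (\<Sum>k. ennreal (kibble_weight a r k) *
     (ennreal (gamma_density (a + real k) (1 - r\<^sup>2) (fst z)) * ennreal (gamma_density (a + real k) (1 - r\<^sup>2) (snd z))))"

definition kibble :: "real \<Rightarrow> real \<Rightarrow> (real \<times> real) measure" where
  "kibble a r = density (lborel \<Otimes>\<^sub>M lborel) (kibble_density a r)"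

lemma kibble_weight_nonneg: "a > 0 \<Longrightarrow> kibble_weight a r k \<ge> 0"
  by (simp add: kibble_weight_def pochhammer_nonneg)

lemma kibble_density_measurable [measurable]:
  "kibble_density a r \<in> borel_measurable (borel \<Otimes>\<^sub>M borel)"
  unfolding kibble_density_def by measurable

lemma sets_kibble [measurable_cong, simp]: "sets (kibble a r) = sets (borel \<Otimes>\<^sub>M borel)"
  unfolding kibble_def by (simp cong: sets_pair_measure_cong)

lemma space_kibble [simp]: "space (kibble a r) = UNIV"
  unfolding kibble_def by (simp add: space_pair_measure)

text \<open>Tonelli turns an integral under the mixture into a series of iterated integrals, since
  the two coordinates are independent given the mixture index. The later computations with
  \<open>kibble\<close> start from this form.\<close>

lemma nn_integral_kibble:
  fixes f :: "real \<times> real \<Rightarrow> ennreal"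
  assumes [measurable]: "f \<in> borel_measurable (borel \<Otimes>\<^sub>M borel)"
  shows "(\<integral>\<^sup>+z. f z \<partial>kibble a r) = (\<Sum>k. ennreal (kibble_weight a r k) *
     (\<integral>\<^sup>+x. ennreal (gamma_density (a + real k) (1 - r\<^sup>2) x) *
        (\<integral>\<^sup>+y. ennreal (gamma_density (a + real k) (1 - r\<^sup>2) y) * f (x, y) \<partial>lborel) \<partial>lborel))"
proof -
  have "(\<integral>\<^sup>+z. f z \<partial>kibble a r) = (\<integral>\<^sup>+z. kibble_density a r z * f z \<partial>(lborel \<Otimes>\<^sub>M lborel))"
    unfolding kibble_def by (rule nn_integral_density) auto
  also have "\<dots> = (\<integral>\<^sup>+x. \<integral>\<^sup>+y. kibble_density a r (x, y) * f (x, y) \<partial>lborel \<partial>lborel)"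
    by (rule lborel.nn_integral_fst[symmetric]) measurable
  also have "\<dots> = (\<integral>\<^sup>+x. \<integral>\<^sup>+y. (\<Sum>k. ennreal (kibble_weight a r k) *
     (ennreal (gamma_density (a + real k) (1 - r\<^sup>2) x) * (ennreal (gamma_density (a + real k) (1 - r\<^sup>2) y) * f (x, y)))) \<partial>lborel \<partial>lborel)"
    unfolding kibble_density_def by (simp add: ennreal_suminf_multc[symmetric] mult.assoc)
  also have "\<dots> = (\<Sum>k. ennreal (kibble_weight a r k) *
     (\<integral>\<^sup>+x. ennreal (gamma_density (a + real k) (1 - r\<^sup>2) x) *
        (\<integral>\<^sup>+y. ennreal (gamma_density (a + real k) (1 - r\<^sup>2) y) * f (x, y) \<partial>lborel) \<partial>lborel))"
    by (simp add: nn_integral_suminf nn_integral_cmult)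
  finally show ?thesis .
qed

lemma kibble_weight_convolution:
  assumes "\<bar>r\<bar> < 1"
  shows "(\<Sum>k\<le>m. kibble_weight a r k * kibble_weight b r (m - k)) = kibble_weight (a + b) r m"
proof -
  have r: "1 - r\<^sup>2 > 0" using assms by (simp add: abs_square_less_1)
  have "(\<Sum>k\<le>m. kibble_weight a r k * kibble_weight b r (m - k))
      = (\<Sum>k\<le>m. (1 - r\<^sup>2) powr (a + b) * r ^ (2 * m) / fact m * (of_nat (m choose k) * pochhammer a k * pochhammer b (m - k)))"
  proof (intro sum.cong refl)
    fix k assume "k \<in> {..m}"
    then have k: "k \<le> m" by simp
    have "r ^ (2 * k) * r ^ (2 * (m - k)) = r ^ (2 * m)"
      using k by (simp add: power_add[symmetric] algebra_simps)
    moreover have "real (m choose k) = fact m / (fact k * fact (m - k))"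
      using k by (rule binomial_fact)
    ultimately show "kibble_weight a r k * kibble_weight b r (m - k)
      = (1 - r\<^sup>2) powr (a + b) * r ^ (2 * m) / fact m * (of_nat (m choose k) * pochhammer a k * pochhammer b (m - k))"
      by (simp add: kibble_weight_def powr_add field_simps)
  qed
  also have "\<dots> = kibble_weight (a + b) r m"
    unfolding sum_distrib_left[symmetric] by (simp add: kibble_weight_def pochhammer_binomial_sum)
  finally show ?thesis .
qed

text \<open>Given the mixture indices k and l, each coordinate is a sum of two independent Gamma
  variables and has shape a + b + (k + l). The result depends on k + l alone, so the weights can be
  collected along diagonals, where they convolve.\<close>

lemma nn_integral_kibble_add:
  fixes f :: "real \<times> real \<Rightarrow> ennreal"
  assumes [measurable]: "f \<in> borel_measurable (borel \<Otimes>\<^sub>M borel)"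
    and ab: "a > 0" "b > 0" and r: "\<bar>r\<bar> < 1"
  shows "(\<integral>\<^sup>+z. \<integral>\<^sup>+z'. f (fst z + fst z', snd z + snd z') \<partial>kibble b r \<partial>kibble a r) = (\<integral>\<^sup>+z. f z \<partial>kibble (a + b) r)"
proof -
  define \<theta> where "\<theta> = 1 - r\<^sup>2"
  have \<theta>: "\<theta> > 0" using r by (simp add: \<theta>_def abs_square_less_1)
  define g where "g = (\<lambda>a k x. ennreal (gamma_density (a + real k) \<theta> x))"
  have g [measurable]: "g a k \<in> borel_measurable borel" for a k unfolding g_def by measurable
  have g_add: "(\<integral>\<^sup>+x. g a k x * (\<integral>\<^sup>+y. g b l y * h (x + y) \<partial>lborel) \<partial>lborel) = (\<integral>\<^sup>+z. g (a + b) (k + l) z * h z \<partial>lborel)"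
    if "h \<in> borel_measurable borel" for h :: "real \<Rightarrow> ennreal" and k l
    using nn_integral_gamma_density_add[OF that, of "a + real k" "b + real l" \<theta>] ab \<theta>
    by (simp add: g_def ac_simps)
  have kib: "(\<integral>\<^sup>+z. h z \<partial>kibble a r) = (\<Sum>k. ennreal (kibble_weight a r k) *
      (\<integral>\<^sup>+x. g a k x * (\<integral>\<^sup>+y. g a k y * h (x, y) \<partial>lborel) \<partial>lborel))"
    if "h \<in> borel_measurable (borel \<Otimes>\<^sub>M borel)" for h :: "real \<times> real \<Rightarrow> ennreal" and a
    using nn_integral_kibble[OF that, of a r] by (simp add: g_def \<theta>_def)
  define T where "T = (\<lambda>m. \<integral>\<^sup>+x. g (a + b) m x * (\<integral>\<^sup>+y. g (a + b) m y * f (x, y) \<partial>lborel) \<partial>lborel)"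
  \<comment> \<open>Exchanging the integrations over y and x' brings the two second coordinates
    together, then the two first ones; each pair is merged by \<open>g_add\<close>.\<close>
  have four: "(\<integral>\<^sup>+x. g a k x * (\<integral>\<^sup>+y. g a k y * (\<integral>\<^sup>+x'. g b l x' *
         (\<integral>\<^sup>+y'. g b l y' * f (x + x', y + y') \<partial>lborel) \<partial>lborel) \<partial>lborel) \<partial>lborel) = T (k + l)" for k l
  proof -
    have "(\<integral>\<^sup>+y. g a k y * (\<integral>\<^sup>+x'. g b l x' * (\<integral>\<^sup>+y'. g b l y' * f (x + x', y + y') \<partial>lborel) \<partial>lborel) \<partial>lborel)
        = (\<integral>\<^sup>+x'. g b l x' * (\<integral>\<^sup>+y. g (a + b) (k + l) y * f (x + x', y) \<partial>lborel) \<partial>lborel)" (is "?L x = ?R x") for x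
    proof -
      have "?L x = (\<integral>\<^sup>+y. \<integral>\<^sup>+x'. g b l x' * (g a k y * (\<integral>\<^sup>+y'. g b l y' * f (x + x', y + y') \<partial>lborel)) \<partial>lborel \<partial>lborel)"
        by (simp add: nn_integral_cmult[symmetric] ac_simps)
      also have "\<dots> = (\<integral>\<^sup>+x'. \<integral>\<^sup>+y. g b l x' * (g a k y * (\<integral>\<^sup>+y'. g b l y' * f (x + x', y + y') \<partial>lborel)) \<partial>lborel \<partial>lborel)"
        by (rule lborel_pair.Fubini') measurable
      also have "\<dots> = (\<integral>\<^sup>+x'. g b l x' * (\<integral>\<^sup>+y. g a k y * (\<integral>\<^sup>+y'. g b l y' * f (x + x', y + y') \<partial>lborel) \<partial>lborel) \<partial>lborel)"
        by (simp add: nn_integral_cmult)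
      also have "\<dots> = ?R x"
      proof (rule nn_integral_cong, rule arg_cong2[where f="(*)", OF refl])
        fix x'
        show "(\<integral>\<^sup>+y. g a k y * (\<integral>\<^sup>+y'. g b l y' * f (x + x', y + y') \<partial>lborel) \<partial>lborel)
          = (\<integral>\<^sup>+y. g (a + b) (k + l) y * f (x + x', y) \<partial>lborel)"
          by (rule g_add[of "\<lambda>y. f (x + x', y)"]) measurable
      qed
      finally show ?thesis .
    qed
    then have "(\<integral>\<^sup>+x. g a k x * ?L x \<partial>lborel) = (\<integral>\<^sup>+x. g a k x * ?R x \<partial>lborel)" by simp
    also have "\<dots> = T (k + l)"
      unfolding T_def by (rule g_add[of "\<lambda>u. \<integral>\<^sup>+y. g (a + b) (k + l) y * f (u, y) \<partial>lborel"]) measurable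
    finally show ?thesis .
  qed
  have "(\<integral>\<^sup>+z. \<integral>\<^sup>+z'. f (fst z + fst z', snd z + snd z') \<partial>kibble b r \<partial>kibble a r)
      = (\<integral>\<^sup>+z. (\<Sum>l. ennreal (kibble_weight b r l) *
      (\<integral>\<^sup>+x'. g b l x' * (\<integral>\<^sup>+y'. g b l y' * f (fst z + x', snd z + y') \<partial>lborel) \<partial>lborel)) \<partial>kibble a r)"
    by (intro nn_integral_cong, subst kib) auto
  also have "\<dots> = (\<Sum>l. ennreal (kibble_weight b r l) * (\<integral>\<^sup>+z. 
      (\<integral>\<^sup>+x'. g b l x' * (\<integral>\<^sup>+y'. g b l y' * f (fst z + x', snd z + y') \<partial>lborel) \<partial>lborel) \<partial>kibble a r))"
    by (simp add: nn_integral_suminf nn_integral_cmult)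
  also have "\<dots> = (\<Sum>l. ennreal (kibble_weight b r l) * (\<Sum>k. ennreal (kibble_weight a r k) * T (k + l)))"
    by (subst kib) (auto simp: four)
  also have "\<dots> = (\<Sum>l. \<Sum>k. ennreal (kibble_weight b r l) * (ennreal (kibble_weight a r k) * T (k + l)))"
    by (simp add: ennreal_suminf_cmult)
  also have "\<dots> = (\<Sum>k. \<Sum>l. ennreal (kibble_weight b r l) * (ennreal (kibble_weight a r k) * T (k + l)))"
    by (rule ennreal_suminf_swap)
  also have "\<dots> = (\<Sum>m. \<Sum>k\<le>m. ennreal (kibble_weight b r (m - k)) * (ennreal (kibble_weight a r k) * T (k + (m - k))))"
    by (rule ennreal_suminf_diagonal)
  also have "\<dots> = (\<Sum>m. ennreal (kibble_weight (a + b) r m) * T m)"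
  proof (intro arg_cong[where f=suminf] ext)
    fix m
    have "(\<Sum>k\<le>m. ennreal (kibble_weight b r (m - k)) * (ennreal (kibble_weight a r k) * T (k + (m - k))))
        = (\<Sum>k\<le>m. ennreal (kibble_weight a r k * kibble_weight b r (m - k)) * T m)"
      using ab by (intro sum.cong) (auto simp: ennreal_mult kibble_weight_nonneg ac_simps)
    also have "\<dots> = (\<Sum>k\<le>m. ennreal (kibble_weight a r k * kibble_weight b r (m - k))) * T m"
      by (simp add: sum_distrib_right)
    also have "(\<Sum>k\<le>m. ennreal (kibble_weight a r k * kibble_weight b r (m - k))) = ennreal (kibble_weight (a + b) r m)"
      using ab r by (subst sum_ennreal) (auto simp: kibble_weight_nonneg kibble_weight_convolution)
    finally show "(\<Sum>k\<le>m. ennreal (kibble_weight b r (m - k)) * (ennreal (kibble_weight a r k) * T (k + (m - k))))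
        = ennreal (kibble_weight (a + b) r m) * T m" .
  qed
  also have "\<dots> = (\<integral>\<^sup>+z. f z \<partial>kibble (a + b) r)"
    unfolding T_def by (rule kib[symmetric]) measurable
  finally show ?thesis .
qed

section \<open>Half squares of correlated Gaussians\<close>

text \<open>The substitution x = u^2/2 on the half line. It is carried out on compact intervals and
  extended by monotone convergence.\<close>

lemma nn_integral_half_square_pos:
  fixes h :: "real \<Rightarrow> ennreal"
  assumes [measurable]: "h \<in> borel_measurable borel"
  shows "(\<integral>\<^sup>+u. h (u\<^sup>2 / 2) * indicator {0<..} u \<partial>lborel)
           = (\<integral>\<^sup>+x. ennreal (1 / sqrt (2 * x)) * h x * indicator {0<..} x \<partial>lborel)"
proof -
  \<comment> \<open>Carries the Jacobian: dx = u du and 1/sqrt(2x) = 1/u for u > 0, so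
    \<open>F (u\<^sup>2 / 2) * u\<close> is h again.\<close>
  define F where "F = (\<lambda>x. ennreal (1 / sqrt (2 * x)) * h x * indicator {0<..} x)"
  have [measurable]: "F \<in> borel_measurable borel" unfolding F_def by measurable
  have F_sq: "F (u\<^sup>2 / 2) * ennreal u = h (u\<^sup>2 / 2) * indicator {0<..} u" if "u \<ge> 0" for u
  proof (cases "u = 0")
    case False
    with that have u: "u > 0" by simp
    have "ennreal (1 / u) * ennreal u = 1" using u by (simp add: ennreal_mult[symmetric])
    moreover have "F (u\<^sup>2 / 2) * ennreal u = h (u\<^sup>2 / 2) * (ennreal (1 / u) * ennreal u)"
      using u by (simp add: F_def ac_simps)
    ultimately show ?thesis using u by simp
  qed simp
  have SUP_ind: "(SUP n. G x * indicator {0..c n} x) = (G x * indicator {0..} x :: ennreal)"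
    if c: "\<And>x. \<exists>n. x \<le> c n" for G :: "real \<Rightarrow> ennreal" and c :: "nat \<Rightarrow> real" and x
  proof (rule antisym)
    show "(SUP n. G x * indicator {0..c n} x) \<le> G x * indicator {0..} x"
      by (intro SUP_least) (auto split: split_indicator)
    obtain n where "c n \<ge> x" using c by blast
    then show "G x * indicator {0..} x \<le> (SUP n. G x * indicator {0..c n} x)"
      by (intro SUP_upper2[of n]) (auto split: split_indicator)
  qed
  have mono: "incseq (\<lambda>n x. G x * indicator {0..c n} x :: ennreal)"
    if "incseq c" for G :: "real \<Rightarrow> ennreal" and c :: "nat \<Rightarrow> real"
    using that by (fastforce simp: incseq_def le_fun_def split: split_indicator intro: order_trans)
  have lim: "\<exists>n. y \<le> real (Suc n)" "\<exists>n. y \<le> (real (Suc n))\<^sup>2 / 2" for y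
  proof -
    \<comment> \<open>The lower bound 2 ensures (n + 1)^2 / 2 \<ge> n + 1, so one n serves both
      exhaustions.\<close>
    obtain n where n: "max 2 y \<le> real n" using real_arch_simple by blast
    then show "\<exists>n. y \<le> real (Suc n)" by (intro exI[of _ n]) auto
    have "2 * real (Suc n) \<le> real (Suc n) * real (Suc n)"
      using n by (intro mult_right_mono) auto
    then show "\<exists>n. y \<le> (real (Suc n))\<^sup>2 / 2"
      using n by (intro exI[of _ n]) (auto simp: power2_eq_square)
  qed
  have "(\<integral>\<^sup>+u. h (u\<^sup>2 / 2) * indicator {0<..} u \<partial>lborel)
      = (\<integral>\<^sup>+u. (F (u\<^sup>2 / 2) * ennreal u) * indicator {0..} u \<partial>lborel)"
    by (intro nn_integral_cong) (auto simp: F_sq split: split_indicator)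
  also have "\<dots> = (\<integral>\<^sup>+u. (SUP n. (F (u\<^sup>2 / 2) * ennreal u) * indicator {0..real (Suc n)} u) \<partial>lborel)"
    by (subst SUP_ind[OF lim(1), of "\<lambda>u. F (u\<^sup>2 / 2) * ennreal u"]) simp
  also have "\<dots> = (SUP n. \<integral>\<^sup>+u. (F (u\<^sup>2 / 2) * ennreal u) * indicator {0..real (Suc n)} u \<partial>lborel)"
    by (rule nn_integral_monotone_convergence_SUP[OF mono[of "\<lambda>n. real (Suc n)" "\<lambda>u. F (u\<^sup>2 / 2) * ennreal u"]])
       (auto simp: incseq_def)
  also have "\<dots> = (SUP n. \<integral>\<^sup>+x. F x * indicator {0..(real (Suc n))\<^sup>2 / 2} x \<partial>lborel)"
  proof (rule arg_cong[where f=Sup], rule image_cong[OF refl])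
    fix n :: nat
    have "(\<integral>\<^sup>+x. F x * indicator {0\<^sup>2/2..(real (Suc n))\<^sup>2 / 2} x \<partial>lborel)
        = (\<integral>\<^sup>+u. F (u\<^sup>2 / 2) * ennreal u * indicator {0..real (Suc n)} u \<partial>lborel)"
      by (rule nn_integral_substitution_aux[where g = "\<lambda>u. u\<^sup>2 / 2" and g' = "\<lambda>u. u"])
         (auto intro!: derivative_eq_intros continuous_intros)
    then show "(\<integral>\<^sup>+u. (F (u\<^sup>2 / 2) * ennreal u) * indicator {0..real (Suc n)} u \<partial>lborel)
        = (\<integral>\<^sup>+x. F x * indicator {0..(real (Suc n))\<^sup>2 / 2} x \<partial>lborel)" by simp
  qed
  also have "\<dots> = (\<integral>\<^sup>+x. (SUP n. F x * indicator {0..(real (Suc n))\<^sup>2 / 2} x) \<partial>lborel)"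
    by (rule nn_integral_monotone_convergence_SUP[OF mono[of "\<lambda>n. (real (Suc n))\<^sup>2 / 2" F], symmetric])
       (auto simp: incseq_def intro!: power_mono)
  also have "\<dots> = (\<integral>\<^sup>+x. F x * indicator {0..} x \<partial>lborel)"
    by (subst SUP_ind[OF lim(2), of F]) simp
  also have "\<dots> = (\<integral>\<^sup>+x. F x \<partial>lborel)"
    by (intro nn_integral_cong) (auto simp: F_def split: split_indicator)
  finally show ?thesis unfolding F_def .
qed

lemma nn_integral_reflect:
  fixes h :: "real \<Rightarrow> ennreal"
  assumes [measurable]: "h \<in> borel_measurable borel"
  shows "(\<integral>\<^sup>+u. h (- u) \<partial>lborel) = (\<integral>\<^sup>+u. h u \<partial>lborel)"
  using nn_integral_real_affine[OF assms, of "-1" 0] by simp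

text \<open>The square hides the sign, so the two half lines contribute equally and the density
  doubles; the origin is a null set.\<close>

lemma nn_integral_half_square:
  fixes h :: "real \<Rightarrow> ennreal"
  assumes [measurable]: "h \<in> borel_measurable borel"
  shows "(\<integral>\<^sup>+u. h (u\<^sup>2 / 2) \<partial>lborel)
           = (\<integral>\<^sup>+x. ennreal (indicator {0<..} x * (2 / sqrt (2 * x))) * h x \<partial>lborel)"
proof -
  have "(\<integral>\<^sup>+u. h (u\<^sup>2 / 2) \<partial>lborel)
      = (\<integral>\<^sup>+u. h (u\<^sup>2 / 2) * indicator {0<..} u + h (u\<^sup>2 / 2) * indicator {0<..} (- u) \<partial>lborel)"
    by (rule nn_integral_cong_AE) (use AE_lborel_singleton[of "0::real"] in
        \<open>auto elim!: eventually_mono split: split_indicator\<close>)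
  also have "\<dots> = (\<integral>\<^sup>+u. h (u\<^sup>2 / 2) * indicator {0<..} u \<partial>lborel)
      + (\<integral>\<^sup>+u. h ((- u)\<^sup>2 / 2) * indicator {0<..} (- u) \<partial>lborel)"
    by (subst nn_integral_add) auto
  also have "\<dots> = 2 * (\<integral>\<^sup>+u. h (u\<^sup>2 / 2) * indicator {0<..} u \<partial>lborel)"
    by (subst nn_integral_reflect[of "\<lambda>u. h (u\<^sup>2 / 2) * indicator {0<..} u"]) (auto simp: mult_2)
  also have "\<dots> = (\<integral>\<^sup>+x. 2 * (ennreal (1 / sqrt (2 * x)) * h x * indicator {0<..} x) \<partial>lborel)"
    by (simp add: nn_integral_half_square_pos nn_integral_cmult)
  also have "\<dots> = (\<integral>\<^sup>+x. ennreal (indicator {0<..} x * (2 / sqrt (2 * x))) * h x \<partial>lborel)"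
  proof (rule nn_integral_cong)
    fix x :: real
    have "(2 :: ennreal) * ennreal (1 / sqrt (2 * x)) = ennreal (2 / sqrt (2 * x))" if "x > 0"
      using that ennreal_mult[of 2 "1 / sqrt (2 * x)"] by simp
    then show "2 * (ennreal (1 / sqrt (2 * x)) * h x * indicator {0<..} x)
        = ennreal (indicator {0<..} x * (2 / sqrt (2 * x))) * h x"
      by (auto simp: mult.assoc[symmetric] split: split_indicator)
  qed
  finally show ?thesis .
qed

section \<open>From the cosh series to Gamma laws of half-integer shape\<close>

lemma cosh_sums_even: "(\<lambda>k. x ^ (2 * k) / fact (2 * k)) sums cosh (x :: real)"
proof -
  have "(\<lambda>k. (if even (2 * k) then x ^ (2 * k) /\<^sub>R fact (2 * k) else 0)) sums cosh x
      \<longleftrightarrow> (\<lambda>n. if even n then x ^ n /\<^sub>R fact n else 0) sums cosh x"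
    by (rule sums_mono_reindex[of "\<lambda>k. 2 * k"]) (auto simp: strict_mono_def elim!: evenE)
  then show ?thesis
    using cosh_converges[of x] by (simp add: field_simps)
qed

text \<open>Converts the factorials of the cosh series into the Pochhammer symbols of
  \<open>kibble_weight (1 / 2)\<close>.\<close>

lemma fact_double_pochhammer: "fact (2 * k) = 4 ^ k * pochhammer (1 / 2) k * (fact k :: real)"
proof (induction k)
  case (Suc k)
  have "fact (2 * Suc k) = (2 * real k + 2) * (2 * real k + 1) * (fact (2 * k) :: real)"
    by (simp add: algebra_simps)
  then show ?case
    unfolding Suc.IH by (simp add: pochhammer_Suc field_simps)
qed simp

lemma Gamma_half_plus_nat: "Gamma (1 / 2 + real k) = sqrt pi * pochhammer (1 / 2) k"
proof -
  have "(1 / 2 :: real) \<notin> \<int>\<^sub>\<le>\<^sub>0" by (auto dest: nonpos_Ints_nonpos)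
  from pochhammer_Gamma[OF this, of k] show ?thesis
    by (simp add: Gamma_one_half_real)
qed

text \<open>The left side is the product of both Jacobians, the Gaussian factor without its cross
  term, and the k-th cosh term after u^2 = 2x and y^2 = 2z. The weight has one Pochhammer symbol in
  the numerator and the two Gamma densities have two in the denominator; the one that remains below
  is the one hidden in (2k)!.\<close>

lemma kibble_half_term:
  fixes r x z :: real
  assumes r: "\<bar>r\<bar> < 1" and xz: "x > 0" "z > 0"
  defines "\<theta> \<equiv> 1 - r\<^sup>2"
  shows "2 / sqrt (2 * x) * (2 / sqrt (2 * z)) * (exp (- x / \<theta>) * exp (- z / \<theta>) / (2 * pi * sqrt \<theta>))
           * ((4 * (r / \<theta>)\<^sup>2) ^ k / fact (2 * k) * x ^ k * z ^ k)
         = kibble_weight (1 / 2) r k * (gamma_density (1 / 2 + real k) \<theta> x * gamma_density (1 / 2 + real k) \<theta> z)"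
proof -
  have \<theta>: "\<theta> > 0" using r by (simp add: \<theta>_def abs_square_less_1)
  define P where "P = pochhammer (1 / 2 :: real) k"
  have P: "P > 0" unfolding P_def by (rule pochhammer_pos) simp
  have pw: "y powr (real k - 1 / 2) = y ^ k / sqrt y" if "y > 0" for y :: real
    using that by (simp add: powr_diff powr_realpow powr_half_sqrt)
  have pw': "\<theta> powr (1 / 2 + real k) = sqrt \<theta> * \<theta> ^ k"
    using \<theta> by (simp add: powr_add powr_realpow powr_half_sqrt)
  have sq: "sqrt \<theta> * sqrt \<theta> = \<theta>" "sqrt pi * sqrt pi = pi" "sqrt 2 * sqrt 2 = (2 :: real)"
    using \<theta> by auto
  have kp: "(4 * (r / \<theta>)\<^sup>2) ^ k = 4 ^ k * r ^ (2 * k) / (\<theta> ^ k * \<theta> ^ k)"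
    by (simp add: power_mult_distrib power_divide power_mult[symmetric] power_add[symmetric] mult_2)
  have L: "2 / sqrt (2 * x) * (2 / sqrt (2 * z)) * (exp (- x / \<theta>) * exp (- z / \<theta>) / (2 * pi * sqrt \<theta>))
           * ((4 * (r / \<theta>)\<^sup>2) ^ k / fact (2 * k) * x ^ k * z ^ k)
        = 4 / (sqrt 2 * sqrt 2 * (sqrt x * sqrt z)) * (exp (- x / \<theta>) * exp (- z / \<theta>) / (2 * pi * sqrt \<theta>))
           * (r ^ (2 * k) / (\<theta> ^ k * \<theta> ^ k * P * fact k) * x ^ k * z ^ k)"
    unfolding kp fact_double_pochhammer P_def[symmetric] by (simp add: real_sqrt_mult)
  have R: "kibble_weight (1 / 2) r k * (gamma_density (1 / 2 + real k) \<theta> x * gamma_density (1 / 2 + real k) \<theta> z)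
        = sqrt \<theta> * r ^ (2 * k) * P / fact k * ((x ^ k / sqrt x * exp (- x / \<theta>) / (sqrt pi * P * (sqrt \<theta> * \<theta> ^ k)))
           * (z ^ k / sqrt z * exp (- z / \<theta>) / (sqrt pi * P * (sqrt \<theta> * \<theta> ^ k))))"
    unfolding kibble_weight_def gamma_density_def \<theta>_def[symmetric] Gamma_half_plus_nat P_def[symmetric]
    using xz \<theta> by (simp add: pw pw' powr_half_sqrt)
  show ?thesis
    unfolding L R sq using xz \<theta> P by (simp add: field_simps)
qed

text \<open>In the variables u and y = r u + sqrt(1 - r^2) v the weight is the bivariate normal
  density. Everything in the integrand except the cross factor depends on squares, so that factor
  may be replaced by its even part and expanded.\<close>

lemma nn_integral_gaussian_half_squares:
  fixes f :: "real \<times> real \<Rightarrow> ennreal"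
  assumes [measurable]: "f \<in> borel_measurable (borel \<Otimes>\<^sub>M borel)" and r: "\<bar>r\<bar> < 1"
  shows "(\<integral>\<^sup>+u. ennreal (std_normal_density u) * (\<integral>\<^sup>+v. ennreal (std_normal_density v) *
           f (u\<^sup>2 / 2, (r * u + sqrt (1 - r\<^sup>2) * v)\<^sup>2 / 2) \<partial>lborel) \<partial>lborel) = (\<integral>\<^sup>+z. f z \<partial>kibble (1 / 2) r)"
proof -
  define \<theta> where "\<theta> = 1 - r\<^sup>2"
  have \<theta>: "\<theta> > 0" using r by (simp add: \<theta>_def abs_square_less_1)
  define s where "s = sqrt \<theta>"
  have s: "s > 0" and s2: "s\<^sup>2 = \<theta>" using \<theta> by (auto simp: s_def)
  \<comment> \<open>The coefficient of u y in the exponent of the bivariate normal density with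
    correlation r.\<close>
  define \<kappa> where "\<kappa> = r / \<theta>"
  define E where "E = (\<lambda>x z. exp (- x / \<theta>) * exp (- z / \<theta>) / (2 * pi * s))"
  have [measurable]: "case_prod E \<in> borel_measurable (borel \<Otimes>\<^sub>M borel)" unfolding E_def by measurable
  have E_pos: "E x z > 0" for x z using s by (simp add: E_def)
  define K where "K = (\<lambda>x z. f (x, z) * ennreal (E x z))"
  have [measurable]: "case_prod K \<in> borel_measurable (borel \<Otimes>\<^sub>M borel)" unfolding K_def by measurable
  have [measurable]: "(cosh :: real \<Rightarrow> real) \<in> borel_measurable borel"
    by (intro borel_measurable_continuous_onI continuous_intros)
  define I where "I = (\<integral>\<^sup>+u. ennreal (std_normal_density u) * (\<integral>\<^sup>+v. ennreal (std_normal_density v) *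
           f (u\<^sup>2 / 2, (r * u + sqrt (1 - r\<^sup>2) * v)\<^sup>2 / 2) \<partial>lborel) \<partial>lborel)"
  \<comment> \<open>Completing the square backwards: u^2 + (y - r u)^2/\<theta> = (u^2 - 2 r u y +
    y^2)/\<theta>.\<close>
  have joint: "std_normal_density u * (std_normal_density ((y - r * u) / s) / s)
      = E (u\<^sup>2 / 2) (y\<^sup>2 / 2) * exp (\<kappa> * u * y)" for u y
  proof -
    have "- (u\<^sup>2 / 2) + - ((y - r * u)\<^sup>2 / \<theta> / 2) = - (u\<^sup>2 / 2) / \<theta> + (- (y\<^sup>2 / 2) / \<theta> + \<kappa> * u * y)"
      using \<theta> unfolding \<kappa>_def
      by (simp add: field_simps) (simp add: \<theta>_def power2_eq_square algebra_simps)
    then have "exp (- (u\<^sup>2 / 2)) * exp (- ((y - r * u)\<^sup>2 / \<theta> / 2))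
        = exp (- (u\<^sup>2 / 2) / \<theta>) * (exp (- (y\<^sup>2 / 2) / \<theta>) * exp (\<kappa> * u * y))"
      by (simp only: exp_add[symmetric])
    moreover have "sqrt (2 * pi) * sqrt (2 * pi) = 2 * pi" by simp
    ultimately show ?thesis
      unfolding std_normal_density_def E_def power_divide s2 using s
      by (simp add: field_simps)
  qed
  have inner: "ennreal (std_normal_density u) * (\<integral>\<^sup>+v. ennreal (std_normal_density v) *
           f (u\<^sup>2 / 2, (r * u + sqrt (1 - r\<^sup>2) * v)\<^sup>2 / 2) \<partial>lborel)
      = (\<integral>\<^sup>+y. K (u\<^sup>2 / 2) (y\<^sup>2 / 2) * ennreal (exp (\<kappa> * u * y)) \<partial>lborel)" for u
  proof -
    have "(\<integral>\<^sup>+y. K (u\<^sup>2 / 2) (y\<^sup>2 / 2) * ennreal (exp (\<kappa> * u * y)) \<partial>lborel)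
        = (\<integral>\<^sup>+y. ennreal (std_normal_density u) * (ennreal (std_normal_density ((y - r * u) / s) / s) * f (u\<^sup>2 / 2, y\<^sup>2 / 2)) \<partial>lborel)"
    proof (rule nn_integral_cong)
      fix y
      have "ennreal (E (u\<^sup>2 / 2) (y\<^sup>2 / 2)) * ennreal (exp (\<kappa> * u * y))
          = ennreal (E (u\<^sup>2 / 2) (y\<^sup>2 / 2) * exp (\<kappa> * u * y))"
        using less_imp_le[OF E_pos] by (intro ennreal_mult[symmetric]) auto
      also have "\<dots> = ennreal (std_normal_density u) * ennreal (std_normal_density ((y - r * u) / s) / s)"
        unfolding joint[symmetric] using s by (intro ennreal_mult) auto
      finally have "ennreal (E (u\<^sup>2 / 2) (y\<^sup>2 / 2)) * ennreal (exp (\<kappa> * u * y))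
          = ennreal (std_normal_density u) * ennreal (std_normal_density ((y - r * u) / s) / s)" .
      then show "K (u\<^sup>2 / 2) (y\<^sup>2 / 2) * ennreal (exp (\<kappa> * u * y))
        = ennreal (std_normal_density u) * (ennreal (std_normal_density ((y - r * u) / s) / s) * f (u\<^sup>2 / 2, y\<^sup>2 / 2))"
        unfolding K_def mult.assoc by (simp add: ac_simps)
    qed
    also have "\<dots> = ennreal (std_normal_density u) * (\<integral>\<^sup>+y. ennreal (std_normal_density ((y - r * u) / s) / s) * f (u\<^sup>2 / 2, y\<^sup>2 / 2) \<partial>lborel)"
      by (rule nn_integral_cmult) measurable
    also have "(\<integral>\<^sup>+y. ennreal (std_normal_density ((y - r * u) / s) / s) * f (u\<^sup>2 / 2, y\<^sup>2 / 2) \<partial>lborel)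
        = ennreal \<bar>s\<bar> * (\<integral>\<^sup>+v. ennreal (std_normal_density ((r * u + s * v - r * u) / s) / s) * f (u\<^sup>2 / 2, (r * u + s * v)\<^sup>2 / 2) \<partial>lborel)"
      using s by (intro nn_integral_real_affine) auto
    also have "\<dots> = (\<integral>\<^sup>+v. ennreal \<bar>s\<bar> * (ennreal (std_normal_density ((r * u + s * v - r * u) / s) / s) * f (u\<^sup>2 / 2, (r * u + s * v)\<^sup>2 / 2)) \<partial>lborel)"
      by (rule nn_integral_cmult[symmetric]) measurable
    also have "\<dots> = (\<integral>\<^sup>+v. ennreal (std_normal_density v) * f (u\<^sup>2 / 2, (r * u + s * v)\<^sup>2 / 2) \<partial>lborel)"
      using s by (intro nn_integral_cong) (auto simp: mult.assoc[symmetric] ennreal_mult[symmetric])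
    finally show ?thesis by (simp add: s_def \<theta>_def)
  qed
  have I1: "I = (\<integral>\<^sup>+u. \<integral>\<^sup>+y. K (u\<^sup>2 / 2) (y\<^sup>2 / 2) * ennreal (exp (\<kappa> * u * y)) \<partial>lborel \<partial>lborel)"
    unfolding I_def inner ..
  \<comment> \<open>Reflecting u flips the sign of the cross term and nothing else; averaging with
    \<open>I1\<close> produces the cosh.\<close>
  have I2: "I = (\<integral>\<^sup>+u. \<integral>\<^sup>+y. K (u\<^sup>2 / 2) (y\<^sup>2 / 2) * ennreal (exp (- (\<kappa> * u * y))) \<partial>lborel \<partial>lborel)"
    unfolding I1 by (subst nn_integral_reflect[symmetric]) simp_all
  have "2 * I = (\<integral>\<^sup>+u. \<integral>\<^sup>+y. 2 * (K (u\<^sup>2 / 2) (y\<^sup>2 / 2) * ennreal (cosh (\<kappa> * u * y))) \<partial>lborel \<partial>lborel)"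
  proof -
    have "2 * I = I + I" by (simp add: mult_2)
    also have "\<dots> = (\<integral>\<^sup>+u. (\<integral>\<^sup>+y. K (u\<^sup>2 / 2) (y\<^sup>2 / 2) * ennreal (exp (\<kappa> * u * y)) \<partial>lborel)
        + (\<integral>\<^sup>+y. K (u\<^sup>2 / 2) (y\<^sup>2 / 2) * ennreal (exp (- (\<kappa> * u * y))) \<partial>lborel) \<partial>lborel)"
      by (subst (1) I1, subst I2, rule nn_integral_add[symmetric]) measurable
    also have "\<dots> = (\<integral>\<^sup>+u. \<integral>\<^sup>+y. K (u\<^sup>2 / 2) (y\<^sup>2 / 2) * ennreal (exp (\<kappa> * u * y))
        + K (u\<^sup>2 / 2) (y\<^sup>2 / 2) * ennreal (exp (- (\<kappa> * u * y))) \<partial>lborel \<partial>lborel)"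
      by (rule nn_integral_cong, rule nn_integral_add[symmetric]) measurable
    also have "\<dots> = (\<integral>\<^sup>+u. \<integral>\<^sup>+y. 2 * (K (u\<^sup>2 / 2) (y\<^sup>2 / 2) * ennreal (cosh (\<kappa> * u * y))) \<partial>lborel \<partial>lborel)"
    proof (rule nn_integral_cong, rule nn_integral_cong)
      fix u y :: real
      have "ennreal (exp (\<kappa> * u * y)) + ennreal (exp (- (\<kappa> * u * y))) = 2 * ennreal (cosh (\<kappa> * u * y))"
      proof -
        have "exp (\<kappa> * u * y) + exp (- (\<kappa> * u * y)) = 2 * cosh (\<kappa> * u * y)"
          by (simp add: cosh_def)
        then have "ennreal (exp (\<kappa> * u * y)) + ennreal (exp (- (\<kappa> * u * y))) = ennreal (2 * cosh (\<kappa> * u * y))"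
          by (subst ennreal_plus[symmetric]) (simp_all del: ennreal_plus)
        then show ?thesis
          by (subst (asm) ennreal_mult) (simp_all add: cosh_real_nonneg)
      qed
      then show "K (u\<^sup>2 / 2) (y\<^sup>2 / 2) * ennreal (exp (\<kappa> * u * y)) + K (u\<^sup>2 / 2) (y\<^sup>2 / 2) * ennreal (exp (- (\<kappa> * u * y)))
          = 2 * (K (u\<^sup>2 / 2) (y\<^sup>2 / 2) * ennreal (cosh (\<kappa> * u * y)))"
        unfolding distrib_left[symmetric] by (simp add: ac_simps)
    qed
    finally show ?thesis .
  qed
  also have "\<dots> = 2 * (\<integral>\<^sup>+u. \<integral>\<^sup>+y. K (u\<^sup>2 / 2) (y\<^sup>2 / 2) * ennreal (cosh (\<kappa> * u * y)) \<partial>lborel \<partial>lborel)"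
    by (subst nn_integral_cmult[symmetric], measurable, rule nn_integral_cong, rule nn_integral_cmult, measurable)
  finally have "I = (\<integral>\<^sup>+u. \<integral>\<^sup>+y. K (u\<^sup>2 / 2) (y\<^sup>2 / 2) * ennreal (cosh (\<kappa> * u * y)) \<partial>lborel \<partial>lborel)"
    by (simp add: ennreal_mult_cancel_left)
  also have "\<dots> = (\<integral>\<^sup>+u. \<integral>\<^sup>+y. (\<Sum>k. K (u\<^sup>2 / 2) (y\<^sup>2 / 2) * ennreal ((4 * \<kappa>\<^sup>2) ^ k / fact (2 * k) * (u\<^sup>2 / 2) ^ k * (y\<^sup>2 / 2) ^ k)) \<partial>lborel \<partial>lborel)"
  proof (rule nn_integral_cong, rule nn_integral_cong)
    fix u y :: real
    have e: "(\<kappa> * u * y) ^ (2 * k) = (4 * \<kappa>\<^sup>2) ^ k * (u\<^sup>2 / 2) ^ k * (y\<^sup>2 / 2) ^ k" for k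
    proof -
      have "(\<kappa> * u * y)\<^sup>2 = 4 * \<kappa>\<^sup>2 * (u\<^sup>2 / 2) * (y\<^sup>2 / 2)" by (simp add: power2_eq_square)
      then show ?thesis by (simp only: power_mult power_mult_distrib)
    qed
    have "(\<Sum>k. ennreal ((\<kappa> * u * y) ^ (2 * k) / fact (2 * k))) = ennreal (cosh (\<kappa> * u * y))"
      by (rule suminf_ennreal_eq[OF _ cosh_sums_even]) (simp add: zero_le_even_power)
    then show "K (u\<^sup>2 / 2) (y\<^sup>2 / 2) * ennreal (cosh (\<kappa> * u * y))
        = (\<Sum>k. K (u\<^sup>2 / 2) (y\<^sup>2 / 2) * ennreal ((4 * \<kappa>\<^sup>2) ^ k / fact (2 * k) * (u\<^sup>2 / 2) ^ k * (y\<^sup>2 / 2) ^ k))"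
      by (simp add: ennreal_suminf_cmult e)
  qed
  also have "\<dots> = (\<Sum>k. \<integral>\<^sup>+u. \<integral>\<^sup>+y. K (u\<^sup>2 / 2) (y\<^sup>2 / 2) * ennreal ((4 * \<kappa>\<^sup>2) ^ k / fact (2 * k) * (u\<^sup>2 / 2) ^ k * (y\<^sup>2 / 2) ^ k) \<partial>lborel \<partial>lborel)"
    by (subst nn_integral_suminf[symmetric], measurable, rule nn_integral_cong, rule nn_integral_suminf, measurable)
  also have "\<dots> = (\<Sum>k. ennreal (kibble_weight (1 / 2) r k) *
     (\<integral>\<^sup>+x. ennreal (gamma_density (1 / 2 + real k) (1 - r\<^sup>2) x) *
        (\<integral>\<^sup>+y. ennreal (gamma_density (1 / 2 + real k) (1 - r\<^sup>2) y) * f (x, y) \<partial>lborel) \<partial>lborel))"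
  proof (rule arg_cong[where f=suminf], rule ext)
    fix k
    let ?d = "\<lambda>x::real. indicator {0<..} x * (2 / sqrt (2 * x))"
    let ?T = "\<lambda>x z. K x z * ennreal ((4 * \<kappa>\<^sup>2) ^ k / fact (2 * k) * x ^ k * z ^ k)"
    let ?w = "ennreal (kibble_weight (1 / 2) r k)"
    let ?g = "\<lambda>x. ennreal (gamma_density (1 / 2 + real k) (1 - r\<^sup>2) x)"
    have "(\<integral>\<^sup>+u. \<integral>\<^sup>+y. ?T (u\<^sup>2 / 2) (y\<^sup>2 / 2) \<partial>lborel \<partial>lborel)
        = (\<integral>\<^sup>+u. \<integral>\<^sup>+z. ennreal (?d z) * ?T (u\<^sup>2 / 2) z \<partial>lborel \<partial>lborel)"
      by (rule nn_integral_cong, rule nn_integral_half_square) measurable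
    also have "\<dots> = (\<integral>\<^sup>+x. ennreal (?d x) * (\<integral>\<^sup>+z. ennreal (?d z) * ?T x z \<partial>lborel) \<partial>lborel)"
      by (rule nn_integral_half_square[of "\<lambda>x. \<integral>\<^sup>+z. ennreal (?d z) * ?T x z \<partial>lborel"]) measurable
    also have "\<dots> = (\<integral>\<^sup>+x. \<integral>\<^sup>+z. ennreal (?d x) * (ennreal (?d z) * ?T x z) \<partial>lborel \<partial>lborel)"
      by (rule nn_integral_cong, rule nn_integral_cmult[symmetric]) measurable
    also have "\<dots> = (\<integral>\<^sup>+x. \<integral>\<^sup>+z. ?w * (?g x * (?g z * f (x, z))) \<partial>lborel \<partial>lborel)"
    proof (rule nn_integral_cong, rule nn_integral_cong)
      fix x z :: real
      show "ennreal (?d x) * (ennreal (?d z) * ?T x z) = ?w * (?g x * (?g z * f (x, z)))"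
      proof (cases "x > 0 \<and> z > 0")
        case True
        have "ennreal (?d x) * ennreal (?d z) * ennreal (E x z) * ennreal ((4 * \<kappa>\<^sup>2) ^ k / fact (2 * k) * x ^ k * z ^ k)
            = ennreal (?d x * ?d z * E x z * ((4 * \<kappa>\<^sup>2) ^ k / fact (2 * k) * x ^ k * z ^ k))"
        proof -
          have mult4: "ennreal a * ennreal b * ennreal c * ennreal d = ennreal (a * b * c * d)"
            if "a \<ge> 0" "b \<ge> 0" "c \<ge> 0" "d \<ge> 0" for a b c d
            using that by (simp add: ennreal_mult)
          show ?thesis
            using True less_imp_le[OF E_pos[of x z]] by (intro mult4) auto
        qed
        also have "?d x * ?d z * E x z * ((4 * \<kappa>\<^sup>2) ^ k / fact (2 * k) * x ^ k * z ^ k)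
            = kibble_weight (1 / 2) r k * (gamma_density (1 / 2 + real k) \<theta> x * gamma_density (1 / 2 + real k) \<theta> z)"
          using kibble_half_term[OF r, of x z k] True unfolding \<theta>_def[symmetric] \<kappa>_def E_def s_def by simp
        also have "ennreal \<dots> = ?w * (?g x * ?g z)"
          unfolding \<theta>_def by (simp add: ennreal_mult gamma_density_nonneg kibble_weight_nonneg)
        finally have eq: "ennreal (?d x) * ennreal (?d z) * ennreal (E x z) * ennreal ((4 * \<kappa>\<^sup>2) ^ k / fact (2 * k) * x ^ k * z ^ k)
            = ?w * (?g x * ?g z)" .
        have "ennreal (?d x) * (ennreal (?d z) * ?T x z)
            = ennreal (?d x) * ennreal (?d z) * ennreal (E x z) * ennreal ((4 * \<kappa>\<^sup>2) ^ k / fact (2 * k) * x ^ k * z ^ k) * f (x, z)"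
          unfolding K_def by (simp only: mult_ac)
        then show ?thesis unfolding eq by (simp only: mult_ac)
      qed (auto simp: gamma_density_def)
    qed
    also have "\<dots> = ?w * (\<integral>\<^sup>+x. ?g x * (\<integral>\<^sup>+y. ?g y * f (x, y) \<partial>lborel) \<partial>lborel)"
    proof -
      have "(\<integral>\<^sup>+z. ?w * (?g x * (?g z * f (x, z))) \<partial>lborel) = ?w * (?g x * (\<integral>\<^sup>+z. ?g z * f (x, z) \<partial>lborel))" for x
        by (subst nn_integral_cmult, measurable, subst nn_integral_cmult, measurable)
      then show ?thesis
        by (simp only:, subst nn_integral_cmult, measurable)
    qed
    finally show "(\<integral>\<^sup>+u. \<integral>\<^sup>+y. ?T (u\<^sup>2 / 2) (y\<^sup>2 / 2) \<partial>lborel \<partial>lborel)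
        = ?w * (\<integral>\<^sup>+x. ?g x * (\<integral>\<^sup>+y. ?g y * f (x, y) \<partial>lborel) \<partial>lborel)" .
  qed
  also have "\<dots> = (\<integral>\<^sup>+z. f z \<partial>kibble (1 / 2) r)"
    by (rule nn_integral_kibble[symmetric]) fact
  finally show ?thesis unfolding I_def .
qed

text \<open>The argument 1 suffices because coefficients are absorbed into Z by the caller. The
  constant case has to be treated since \<open>gaussian_rv\<close> admits it; centring then forces Z
  = 0 almost surely and v = 0.\<close>

lemma gaussian_char:
  assumes M: "prob_space M" and Z: "gaussian_rv M Z" and mean0: "mean M Z = 0"
    and var: "(LINT \<omega>|M. (Z \<omega>)\<^sup>2) = v"
  shows "(CLINT \<omega>|M. iexp (Z \<omega>)) = exp (complex_of_real (- v / 2))"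
proof -
  interpret prob_space M by fact
  have [measurable]: "Z \<in> borel_measurable M" using Z by (simp add: gaussian_rv_def)
  from Z consider
      (normal) \<mu> \<sigma> where "\<sigma> > 0" "distributed M lborel Z (\<lambda>x. ennreal (normal_density \<mu> \<sigma> x))"
    | (const) \<mu> where "AE \<omega> in M. Z \<omega> = \<mu>"
    unfolding gaussian_rv_def by blast
  then show ?thesis
  proof cases
    case normal
    have \<mu>: "\<mu> = 0"
      using normal_distributed_expectation[OF normal] mean0 by (simp add: mean_def)
    have v: "v = \<sigma>\<^sup>2"
      using normal_distributed_variance[OF normal] mean0 var by (simp add: mean_def)
    have D: "distributed M lborel (\<lambda>\<omega>. Z \<omega> / \<sigma>) std_normal_density"
      using normal_standard_normal_convert[OF normal(1), of Z \<mu>] normal(2) \<mu> by simp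
    then have d: "distr M borel (\<lambda>\<omega>. Z \<omega> / \<sigma>) = std_normal_distribution"
      unfolding distributed_def by (simp cong: distr_cong)
    have "(CLINT \<omega>|M. iexp (Z \<omega>)) = (CLINT \<omega>|M. iexp (\<sigma> * (Z \<omega> / \<sigma>)))"
      using normal by simp
    also have "\<dots> = char (distr M borel (\<lambda>\<omega>. Z \<omega> / \<sigma>)) \<sigma>"
      unfolding char_def by (subst integral_distr) auto
    also have "\<dots> = exp (complex_of_real (- v / 2))"
      unfolding d char_std_normal_distribution v by (simp add: exp_of_real[symmetric])
    finally show ?thesis .
  next
    case const
    have "mean M Z = \<mu>"
      unfolding mean_def by (subst integral_cong_AE[of _ _ "\<lambda>_. \<mu>"]) (use const prob_space in auto)
    then have AE: "AE \<omega> in M. Z \<omega> = 0" using const mean0 by simp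
    have "v = (LINT \<omega>|M. 0)"
      unfolding var[symmetric] by (rule integral_cong_AE) (use AE in auto)
    moreover have "(CLINT \<omega>|M. iexp (Z \<omega>)) = (CLINT \<omega>|M. 1)"
      by (rule integral_cong_AE) (use AE in auto)
    ultimately show ?thesis using prob_space by simp
  qed
qed

lemma char_std_normal_pair:
  "(CLINT z|(std_normal_distribution \<Otimes>\<^sub>M std_normal_distribution). iexp (s * fst z + t * snd z))
     = exp (complex_of_real (- (s\<^sup>2 + t\<^sup>2) / 2))"
proof -
  interpret N: real_distribution std_normal_distribution by (rule real_dist_normal_dist)
  interpret NN: pair_prob_space std_normal_distribution std_normal_distribution ..
  have int: "complex_integrable (std_normal_distribution \<Otimes>\<^sub>M std_normal_distribution) (\<lambda>z. iexp (s * fst z + t * snd z))"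
    by (rule NN.P.integrable_const_bound[of _ 1]) auto
  have "(CLINT z|(std_normal_distribution \<Otimes>\<^sub>M std_normal_distribution). iexp (s * fst z + t * snd z))
      = (CLINT x|std_normal_distribution. CLINT y|std_normal_distribution. iexp (s * x + t * y))"
    using NN.integral_fst'[OF int] by simp
  also have "\<dots> = (CLINT x|std_normal_distribution. CLINT y|std_normal_distribution. iexp (s * x) * iexp (t * y))"
    by (simp add: exp_add[symmetric] algebra_simps)
  also have "\<dots> = char std_normal_distribution s * char std_normal_distribution t"
    by (simp add: char_def)
  also have "\<dots> = exp (complex_of_real (- (s\<^sup>2 + t\<^sup>2) / 2))"
    by (simp add: char_std_normal_distribution exp_of_real[symmetric] exp_add[symmetric] field_simps)
  finally show ?thesis .
qed

text \<open>The Cramer-Wold argument: every linear combination of X and the normalised residual is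
  again one of X and Y, hence centred Gaussian, and its variance is a^2 + b^2. So the planar
  characteristic function is that of two independent standard normals.\<close>

lemma gaussian_pair_standardize:
  assumes M: "prob_space M" and lin: "\<And>a b. gaussian_rv M (\<lambda>\<omega>. a * X \<omega> + b * Y \<omega>)"
    and mean: "mean M X = 0" "mean M Y = 0"
    and var: "covariance M X X = 1" "covariance M Y Y = 1" and cov: "covariance M X Y = r"
    and r: "\<bar>r\<bar> < 1"
  shows "distr M (borel \<Otimes>\<^sub>M borel) (\<lambda>\<omega>. (X \<omega>, (Y \<omega> - r * X \<omega>) / sqrt (1 - r\<^sup>2)))
           = std_normal_distribution \<Otimes>\<^sub>M std_normal_distribution"
proof -
  interpret prob_space M by fact
  have r2: "1 - r\<^sup>2 > 0" using r by (simp add: abs_square_less_1)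
  define s where "s = sqrt (1 - r\<^sup>2)"
  have s: "s > 0" and s2: "s\<^sup>2 = 1 - r\<^sup>2" using r2 by (auto simp: s_def)
  have [measurable]: "X \<in> borel_measurable M" "Y \<in> borel_measurable M"
    using lin[of 1 0] lin[of 0 1] by (auto simp: gaussian_rv_def)
  have X2: "(LINT \<omega>|M. (X \<omega>)\<^sup>2) = 1" and Y2: "(LINT \<omega>|M. (Y \<omega>)\<^sup>2) = 1" and XY: "(LINT \<omega>|M. X \<omega> * Y \<omega>) = r"
    using var cov mean by (simp_all add: covariance_def power2_eq_square)
  \<comment> \<open>The Bochner integral of a non-integrable function is 0, so the value 1 certifies
    integrability.\<close>
  have iX2: "integrable M (\<lambda>\<omega>. (X \<omega>)\<^sup>2)" and iY2: "integrable M (\<lambda>\<omega>. (Y \<omega>)\<^sup>2)"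
    using X2 Y2 not_integrable_integral_eq by fastforce+
  have iX: "integrable M X" and iY: "integrable M Y"
    using square_integrable_imp_integrable[OF _ iX2] square_integrable_imp_integrable[OF _ iY2] by auto
  \<comment> \<open>That trick fails for the product, whose integral r may be 0; domination by X^2 +
    Y^2 is used instead.\<close>
  have iXY: "integrable M (\<lambda>\<omega>. X \<omega> * Y \<omega>)"
  proof (rule Bochner_Integration.integrable_bound[OF Bochner_Integration.integrable_add[OF iX2 iY2]])
    have "\<bar>x * y\<bar> \<le> x\<^sup>2 + y\<^sup>2" for x y :: real
    proof -
      have "0 \<le> (\<bar>x\<bar> - \<bar>y\<bar>)\<^sup>2" by simp
      then have "2 * (\<bar>x\<bar> * \<bar>y\<bar>) \<le> x\<^sup>2 + y\<^sup>2" by (simp add: power2_diff)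
      moreover have "0 \<le> \<bar>x\<bar> * \<bar>y\<bar>" by simp
      ultimately show ?thesis unfolding abs_mult by linarith
    qed
    then show "AE \<omega> in M. norm (X \<omega> * Y \<omega>) \<le> norm ((X \<omega>)\<^sup>2 + (Y \<omega>)\<^sup>2)" by auto
  qed measurable
  show ?thesis
  proof (rule pair_measure_eqI_char)
    show "prob_space (distr M (borel \<Otimes>\<^sub>M borel) (\<lambda>\<omega>. (X \<omega>, (Y \<omega> - r * X \<omega>) / sqrt (1 - r\<^sup>2))))"
      by (rule prob_space_distr) measurable
    interpret N: real_distribution std_normal_distribution by (rule real_dist_normal_dist)
    interpret NN: pair_prob_space std_normal_distribution std_normal_distribution ..
    show "prob_space (std_normal_distribution \<Otimes>\<^sub>M std_normal_distribution)" by (rule NN.P.prob_space_axioms)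
    show "sets (std_normal_distribution \<Otimes>\<^sub>M std_normal_distribution) = sets (borel \<Otimes>\<^sub>M borel :: (real \<times> real) measure)"
      by (rule sets_pair_measure_cong) auto
    fix a b :: real
    \<comment> \<open>The coefficients of X and Y after expanding the residual; they satisfy a' + r
      b' = a and b' s = b, which is what makes the variance collapse.\<close>
    define a' b' where "a' = a - b * r / s" and "b' = b / s"
    define Z where "Z = (\<lambda>\<omega>. a' * X \<omega> + b' * Y \<omega>)"
    have "mean M Z = 0"
      using iX iY mean by (simp add: mean_def Z_def)
    moreover have "(LINT \<omega>|M. (Z \<omega>)\<^sup>2) = a\<^sup>2 + b\<^sup>2"
    proof -
      have "(LINT \<omega>|M. (Z \<omega>)\<^sup>2) = (LINT \<omega>|M. a'\<^sup>2 * (X \<omega>)\<^sup>2 + b'\<^sup>2 * (Y \<omega>)\<^sup>2 + (2 * a' * b') * (X \<omega> * Y \<omega>))"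
        by (intro Bochner_Integration.integral_cong) (auto simp: Z_def power2_eq_square algebra_simps)
      also have "\<dots> = a'\<^sup>2 + b'\<^sup>2 + 2 * a' * b' * r"
        using iX2 iY2 iXY X2 Y2 XY by simp
      also have "\<dots> = (a' + r * b')\<^sup>2 + (b' * s)\<^sup>2"
        by (simp add: power_mult_distrib s2) (simp add: power2_eq_square algebra_simps)
      also have "\<dots> = a\<^sup>2 + b\<^sup>2" using s by (simp add: a'_def b'_def)
      finally show ?thesis .
    qed
    ultimately have char: "(CLINT \<omega>|M. iexp (Z \<omega>)) = exp (complex_of_real (- (a\<^sup>2 + b\<^sup>2) / 2))"
      using gaussian_char[OF M, of Z] lin[of a' b'] unfolding Z_def by blast
    have Z: "a * X \<omega> + b * ((Y \<omega> - r * X \<omega>) / sqrt (1 - r\<^sup>2)) = Z \<omega>" for \<omega>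
      using s by (simp add: Z_def a'_def b'_def s_def[symmetric] field_simps)
    have "(CLINT z|distr M (borel \<Otimes>\<^sub>M borel) (\<lambda>\<omega>. (X \<omega>, (Y \<omega> - r * X \<omega>) / sqrt (1 - r\<^sup>2))). iexp (a * fst z + b * snd z))
        = (CLINT \<omega>|M. iexp (a * X \<omega> + b * ((Y \<omega> - r * X \<omega>) / sqrt (1 - r\<^sup>2))))"
      by (subst integral_distr) auto
    then show "(CLINT z|distr M (borel \<Otimes>\<^sub>M borel) (\<lambda>\<omega>. (X \<omega>, (Y \<omega> - r * X \<omega>) / sqrt (1 - r\<^sup>2))). iexp (a * fst z + b * snd z))
        = (CLINT z|(std_normal_distribution \<Otimes>\<^sub>M std_normal_distribution). iexp (a * fst z + b * snd z))"
      unfolding char_std_normal_pair Z char .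
  qed simp
qed

text \<open>Y is r X plus sqrt(1 - r^2) times the residual, so both half squares are functions of
  two independent standard normals.\<close>

lemma gaussian_pair_half_squares:
  assumes M: "prob_space M" and lin: "\<And>a b. gaussian_rv M (\<lambda>\<omega>. a * X \<omega> + b * Y \<omega>)"
    and mean: "mean M X = 0" "mean M Y = 0"
    and var: "covariance M X X = 1" "covariance M Y Y = 1" and cov: "covariance M X Y = r"
    and r: "\<bar>r\<bar> < 1"
  shows "distr M (borel \<Otimes>\<^sub>M borel) (\<lambda>\<omega>. ((X \<omega>)\<^sup>2 / 2, (Y \<omega>)\<^sup>2 / 2)) = kibble (1 / 2) r"
proof (rule measure_eqI)
  have [measurable]: "X \<in> borel_measurable M" "Y \<in> borel_measurable M"
    using lin[of 1 0] lin[of 0 1] by (auto simp: gaussian_rv_def)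
  interpret N: real_distribution std_normal_distribution by (rule real_dist_normal_dist)
  let ?s = "sqrt (1 - r\<^sup>2)"
  have s: "?s > 0" using r by (simp add: abs_square_less_1)
  fix A assume "A \<in> sets (distr M (borel \<Otimes>\<^sub>M borel) (\<lambda>\<omega>. ((X \<omega>)\<^sup>2 / 2, (Y \<omega>)\<^sup>2 / 2)))"
  then have [measurable]: "A \<in> sets (borel \<Otimes>\<^sub>M borel)" by simp
  define F where "F = (\<lambda>z. indicator A ((fst z)\<^sup>2 / 2, (r * fst z + ?s * snd z)\<^sup>2 / 2) :: ennreal)"
  have [measurable]: "F \<in> borel_measurable (borel \<Otimes>\<^sub>M borel)" unfolding F_def by measurable
  have "emeasure (distr M (borel \<Otimes>\<^sub>M borel) (\<lambda>\<omega>. ((X \<omega>)\<^sup>2 / 2, (Y \<omega>)\<^sup>2 / 2))) A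
      = (\<integral>\<^sup>+\<omega>. indicator A ((X \<omega>)\<^sup>2 / 2, (Y \<omega>)\<^sup>2 / 2) \<partial>M)"
    by (subst nn_integral_indicator[symmetric], simp, subst nn_integral_distr) auto
  also have "\<dots> = (\<integral>\<^sup>+\<omega>. F (X \<omega>, (Y \<omega> - r * X \<omega>) / ?s) \<partial>M)"
    using s by (intro nn_integral_cong) (simp add: F_def)
  also have "\<dots> = (\<integral>\<^sup>+z. F z \<partial>distr M (borel \<Otimes>\<^sub>M borel) (\<lambda>\<omega>. (X \<omega>, (Y \<omega> - r * X \<omega>) / ?s)))"
    by (subst nn_integral_distr) auto
  also have "\<dots> = (\<integral>\<^sup>+z. F z \<partial>(std_normal_distribution \<Otimes>\<^sub>M std_normal_distribution))"
    by (subst gaussian_pair_standardize[OF assms]) simp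
  also have "\<dots> = (\<integral>\<^sup>+u. \<integral>\<^sup>+v. F (u, v) \<partial>std_normal_distribution \<partial>std_normal_distribution)"
    by (rule N.nn_integral_fst[symmetric]) measurable
  also have "\<dots> = (\<integral>\<^sup>+u. ennreal (std_normal_density u) * (\<integral>\<^sup>+v. ennreal (std_normal_density v) * F (u, v) \<partial>lborel) \<partial>lborel)"
    by (simp add: nn_integral_density)
  also have "\<dots> = (\<integral>\<^sup>+z. indicator A z \<partial>kibble (1 / 2) r)"
    using nn_integral_gaussian_half_squares[of "indicator A" r] r by (simp add: F_def)
  finally show "emeasure (distr M (borel \<Otimes>\<^sub>M borel) (\<lambda>\<omega>. ((X \<omega>)\<^sup>2 / 2, (Y \<omega>)\<^sup>2 / 2))) A = emeasure (kibble (1 / 2) r) A"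
    by simp
qed simp

section \<open>Incomplete Gamma and confluent hypergeometric integrals\<close>

text \<open>Scaling by \<theta> identifies the distribution function of the Gamma law with the gauge
  integral in \<open>lower_gamma_reg\<close>. Nonnegativity is recorded as well, because every later
  passage between \<open>real\<close> and \<open>ennreal\<close> needs it.\<close>

lemma lower_gamma_reg_nn_integral:
  assumes a: "a > 0" and \<theta>: "\<theta> > 0" and y: "y \<ge> 0"
  shows "(\<integral>\<^sup>+x. ennreal (gamma_density a \<theta> x) * indicator {..y} x \<partial>lborel) = ennreal (lower_gamma_reg a (y / \<theta>))"
    and "lower_gamma_reg a (y / \<theta>) \<ge> 0"
proof -
  define z where "z = y / \<theta>"
  define f where "f = (\<lambda>t::real. t powr (a - 1) * exp (- t))"
  have G: "Gamma a > 0" using a by (rule Gamma_real_pos)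
  have [measurable]: "f \<in> borel_measurable borel" unfolding f_def by measurable
  \<comment> \<open>For a < 1 the integrand is unbounded near 0, so integrability is inherited from
    the full Gamma integral rather than from continuity.\<close>
  have "f integrable_on {0..z}"
  proof (rule integrable_on_subinterval)
    show "f integrable_on {0..}"
      using has_integral_integrable[OF Gamma_integral_real[OF a]] by (simp add: f_def exp_minus divide_inverse)
  qed auto
  then have hi: "(f has_integral integral {0..z} f) {0..z}" by (rule integrable_integral)
  have f_nonneg: "f t \<ge> 0" for t by (simp add: f_def)
  have I_nonneg: "integral {0..z} f \<ge> 0" by (rule has_integral_nonneg[OF hi f_nonneg])
  then show "lower_gamma_reg a (y / \<theta>) \<ge> 0"
    using G by (simp add: lower_gamma_reg_def z_def f_def)
  have "(\<integral>\<^sup>+x. ennreal (gamma_density a \<theta> x) * indicator {..y} x \<partial>lborel)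
      = ennreal \<bar>\<theta>\<bar> * (\<integral>\<^sup>+t. ennreal (gamma_density a \<theta> (0 + \<theta> * t)) * indicator {..y} (0 + \<theta> * t) \<partial>lborel)"
    using \<theta> by (intro nn_integral_real_affine) auto
  also have "\<dots> = (\<integral>\<^sup>+t. ennreal \<bar>\<theta>\<bar> * (ennreal (gamma_density a \<theta> (0 + \<theta> * t)) * indicator {..y} (0 + \<theta> * t)) \<partial>lborel)"
    by (rule nn_integral_cmult[symmetric]) measurable
  also have "\<dots> = (\<integral>\<^sup>+t. ennreal (1 / Gamma a) * (ennreal (f t) * indicator {0..z} t) \<partial>lborel)"
  proof (rule nn_integral_cong)
    fix t :: real
    show "ennreal \<bar>\<theta>\<bar> * (ennreal (gamma_density a \<theta> (0 + \<theta> * t)) * indicator {..y} (0 + \<theta> * t))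
      = ennreal (1 / Gamma a) * (ennreal (f t) * indicator {0..z} t)"
    proof (cases "t > 0")
      case True
      have "\<theta> * \<theta> powr (a - 1) = \<theta> powr a" using \<theta> by (simp add: powr_mult_base)
      moreover have "\<theta> * gamma_density a \<theta> (\<theta> * t) = (\<theta> * \<theta> powr (a - 1)) / \<theta> powr a * (1 / Gamma a * f t)"
        using True \<theta> by (simp add: gamma_density_def f_def powr_mult ac_simps)
      ultimately have "\<theta> * gamma_density a \<theta> (\<theta> * t) = 1 / Gamma a * f t"
        using \<theta> by simp
      moreover have "\<theta> * t \<le> y \<longleftrightarrow> t \<le> z" using \<theta> by (simp add: z_def field_simps)
      ultimately show ?thesis
        using True \<theta> G f_nonneg a
        by (auto simp: ennreal_mult[symmetric] gamma_density_nonneg split: split_indicator)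
    next
      case False
      then have "\<not> \<theta> * t > 0" using \<theta> by (simp add: zero_less_mult_iff)
      with False show ?thesis by (auto simp: gamma_density_def f_def split: split_indicator)
    qed
  qed
  also have "\<dots> = ennreal (1 / Gamma a) * ennreal (integral {0..z} f)"
    by (subst nn_integral_cmult, measurable, subst nn_integral_has_integral_lebesgue'[OF f_nonneg hi]) simp
  also have "\<dots> = ennreal (lower_gamma_reg a (y / \<theta>))"
    using G I_nonneg by (subst ennreal_mult[symmetric]) (auto simp: lower_gamma_reg_def f_def z_def)
  finally show "(\<integral>\<^sup>+x. ennreal (gamma_density a \<theta> x) * indicator {..y} x \<partial>lborel) = ennreal (lower_gamma_reg a (y / \<theta>))" .
qed

lemma nn_integral_gamma_density:
  assumes a: "a > 0" and \<theta>: "\<theta> > 0"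
  shows "(\<integral>\<^sup>+x. ennreal (gamma_density a \<theta> x) \<partial>lborel) = 1"
proof -
  have G: "Gamma a > 0" using a by (rule Gamma_real_pos)
  have "(\<integral>\<^sup>+x. ennreal (gamma_density a \<theta> x) \<partial>lborel)
      = ennreal \<bar>\<theta>\<bar> * (\<integral>\<^sup>+t. ennreal (gamma_density a \<theta> (0 + \<theta> * t)) \<partial>lborel)"
    using \<theta> by (intro nn_integral_real_affine) auto
  also have "\<dots> = (\<integral>\<^sup>+t. ennreal \<bar>\<theta>\<bar> * ennreal (gamma_density a \<theta> (0 + \<theta> * t)) \<partial>lborel)"
    by (rule nn_integral_cmult[symmetric]) measurable
  also have "\<dots> = (\<integral>\<^sup>+t. ennreal (1 / Gamma a) * ennreal (indicator {0..} t * t powr (a - 1) / exp t) \<partial>lborel)"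
  proof (rule nn_integral_cong)
    fix t :: real
    show "ennreal \<bar>\<theta>\<bar> * ennreal (gamma_density a \<theta> (0 + \<theta> * t))
      = ennreal (1 / Gamma a) * ennreal (indicator {0..} t * t powr (a - 1) / exp t)"
    proof (cases "t > 0")
      case True
      have "\<theta> * \<theta> powr (a - 1) = \<theta> powr a" using \<theta> by (simp add: powr_mult_base)
      moreover have "\<theta> * gamma_density a \<theta> (\<theta> * t)
          = (\<theta> * \<theta> powr (a - 1)) / \<theta> powr a * (1 / Gamma a * (indicator {0..} t * t powr (a - 1) / exp t))"
        using True \<theta> by (simp add: gamma_density_def powr_mult exp_minus divide_inverse ac_simps)
      ultimately have "\<theta> * gamma_density a \<theta> (\<theta> * t) = 1 / Gamma a * (indicator {0..} t * t powr (a - 1) / exp t)"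
        using \<theta> by simp
      then show ?thesis
        using True \<theta> G a by (simp add: ennreal_mult[symmetric] gamma_density_nonneg)
    next
      case False
      then have "\<not> \<theta> * t > 0" using \<theta> by (simp add: zero_less_mult_iff)
      with False show ?thesis by (auto simp: gamma_density_def split: split_indicator)
    qed
  qed
  also have "\<dots> = ennreal (1 / Gamma a) * ennreal (Gamma a)"
    by (subst nn_integral_cmult, measurable, subst Gamma_conv_nn_integral_real[OF a]) simp
  also have "\<dots> = 1"
    using G by (subst ennreal_mult[symmetric]) auto
  finally show ?thesis .
qed

text \<open>The chance of exactly m events by time z in a unit-rate Poisson process. Vanishing for
  negative z encodes that the starting point u must not lie beyond the horizon x when z = x -
  u.\<close>

definition poisson_prob :: "nat \<Rightarrow> real \<Rightarrow> real" where
  "poisson_prob m z = (if z < 0 then 0 else z ^ m * exp (- z) / fact m)"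

lemma poisson_prob_nonneg [simp]: "poisson_prob m z \<ge> 0"
  by (simp add: poisson_prob_def)

lemma poisson_prob_measurable [measurable]: "poisson_prob m \<in> borel_measurable borel"
  unfolding poisson_prob_def by measurable

lemma fact_add_pochhammer: "(fact (m + j) :: real) = fact m * pochhammer (real m + 1) j"
  using pochhammer_product'[of "1 :: real" m j] by (simp add: pochhammer_fact add.commute)

text \<open>With the upper parameter m + 1 the term is at most z^j/j!, since (m + 1)_j m! = (m + j)!
  does not exceed the factorial behind the Gamma value. Convergence thus comes from the exponential
  series.\<close>

lemma hyp1F1_reg_term_bounds:
  fixes z :: real and c m j :: nat
  assumes z: "z \<ge> 0" and c: "c \<ge> 1"
  defines "t \<equiv> \<lambda>j. pochhammer (real m + 1) j * z ^ j / (Gamma (real (c + m) + real j) * fact j)"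
  shows "t j \<ge> 0" and "t j \<le> z ^ j / fact j"
proof -
  obtain c' where c': "c = Suc c'" using c by (cases c) auto
  have G: "Gamma (real (c + m) + real j) = fact (c' + m + j)"
    using Gamma_fact[of "c' + m + j", where 'a=real] by (simp add: c' ac_simps)
  have "pochhammer (real m + 1) j * fact m = (fact (m + j) :: real)"
    by (simp add: fact_add_pochhammer)
  also have "\<dots> \<le> fact (c' + m + j)" by (rule fact_mono) simp
  finally have le: "pochhammer (real m + 1) j * fact m \<le> fact (c' + m + j)" .
  have p: "pochhammer (real m + 1) j \<ge> 0" by (rule pochhammer_nonneg) simp
  have "pochhammer (real m + 1) j * 1 \<le> pochhammer (real m + 1) j * fact m"
    using p by (intro mult_left_mono) auto
  with le have "pochhammer (real m + 1) j / fact (c' + m + j) \<le> 1" by simp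
  then have "pochhammer (real m + 1) j / fact (c' + m + j) * (z ^ j / fact j) \<le> 1 * (z ^ j / fact j)"
    using z by (intro mult_right_mono) auto
  then show "t j \<le> z ^ j / fact j" unfolding t_def G by simp
  show "t j \<ge> 0" unfolding t_def G using p z by simp
qed

lemma hyp1F1_reg_sums:
  fixes z :: real and c m :: nat
  assumes z: "z \<ge> 0" and c: "c \<ge> 1"
  shows "(\<lambda>j. pochhammer (real m + 1) j * z ^ j / (Gamma (real (c + m) + real j) * fact j))
           sums hyp1F1_reg (real m + 1) (real (c + m)) z"
    and "hyp1F1_reg (real m + 1) (real (c + m)) z \<ge> 0"
proof -
  let ?t = "\<lambda>j. pochhammer (real m + 1) j * z ^ j / (Gamma (real (c + m) + real j) * fact j)"
  note t = hyp1F1_reg_term_bounds[OF assms, of m]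
  have "summable (\<lambda>j. z ^ j / fact j)"
    using summable_exp[of z] by (simp add: divide_inverse mult.commute)
  then have sm: "summable ?t"
  proof (rule summable_comparison_test'[of _ 0])
    fix j
    show "norm (?t j) \<le> z ^ j / fact j"
      using t[of j] unfolding real_norm_def by (subst abs_of_nonneg)
  qed
  then show "?t sums hyp1F1_reg (real m + 1) (real (c + m)) z"
    unfolding hyp1F1_reg_def by (rule summable_sums)
  show "hyp1F1_reg (real m + 1) (real (c + m)) z \<ge> 0"
    unfolding hyp1F1_reg_def by (rule suminf_nonneg[OF sm t(1)])
qed

text \<open>The exponential mismatch between scale \<theta> and rate 1 is a power series in x - u.
  Each of its terms is a Beta integral, and the resulting ratios of Gamma values are the
  coefficients of the regularized confluent hypergeometric series.\<close>

lemma nn_integral_gamma_density_poisson: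
  fixes c m :: nat
  assumes r: "\<bar>r\<bar> < 1" and c: "c \<ge> 1" and x: "x > 0"
  defines "\<theta> \<equiv> 1 - r\<^sup>2"
  shows "(\<integral>\<^sup>+u. ennreal (gamma_density (real c) \<theta> u) * ennreal (poisson_prob m (x - u)) \<partial>lborel)
           = ennreal (x ^ (c + m) * exp (- x / \<theta>) / \<theta> ^ c * hyp1F1_reg (real m + 1) (real (c + m + 1)) (r\<^sup>2 * x / \<theta>))"
proof -
  have \<theta>: "\<theta> > 0" using r by (simp add: \<theta>_def abs_square_less_1)
  define \<kappa> where "\<kappa> = r\<^sup>2 / \<theta>"
  have \<kappa>: "\<kappa> \<ge> 0" using \<theta> by (simp add: \<kappa>_def)
  have G: "Gamma (real c) > 0" using c by (intro Gamma_real_pos) simp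
  define C where "C = exp (- x / \<theta>) / (Gamma (real c) * \<theta> ^ c * fact m)"
  have C: "C \<ge> 0" using G \<theta> by (simp add: C_def)
  define h where "h = (\<lambda>j u. indicator {0<..<x} u * ((x - u) powr (real (m + j + 1) - 1) * u powr (real c - 1)))"
  have [measurable]: "h j \<in> borel_measurable borel" for j unfolding h_def by measurable
  have h_nonneg: "h j u \<ge> 0" for j u by (simp add: h_def)
  \<comment> \<open>The point u = x is excluded because for m = 0 the left side is positive there,
    while every \<open>h j\<close> vanishes.\<close>
  have pt: "ennreal (gamma_density (real c) \<theta> u) * ennreal (poisson_prob m (x - u))
      = (\<Sum>j. ennreal (C * (\<kappa> ^ j / fact j)) * ennreal (h j u))" if "u \<noteq> x" for u
  proof (cases "0 < u \<and> u < x")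
    case True
    have e: "exp (- u / \<theta>) * exp (- (x - u)) = exp (- x / \<theta>) * exp (\<kappa> * (x - u))"
    proof -
      have "- u / \<theta> + - (x - u) = - x / \<theta> + \<kappa> * (x - u)"
        using \<theta> unfolding \<kappa>_def by (simp add: field_simps) (simp add: \<theta>_def algebra_simps)
      then show ?thesis by (simp only: exp_add[symmetric])
    qed
    have hj: "h j u = (x - u) ^ m * (x - u) ^ j * u powr (real c - 1)" for j
      using True by (simp add: h_def powr_realpow power_add flip: of_nat_add)
    have "(\<lambda>j. (\<kappa> * (x - u)) ^ j /\<^sub>R fact j) sums exp (\<kappa> * (x - u))" by (rule exp_converges)
    then have "(\<lambda>j. C * (x - u) ^ m * u powr (real c - 1) * ((\<kappa> * (x - u)) ^ j /\<^sub>R fact j))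
        sums (C * (x - u) ^ m * u powr (real c - 1) * exp (\<kappa> * (x - u)))"
      by (rule sums_mult)
    moreover have "C * (x - u) ^ m * u powr (real c - 1) * ((\<kappa> * (x - u)) ^ j /\<^sub>R fact j) = C * (\<kappa> ^ j / fact j) * h j u" for j
      unfolding hj power_mult_distrib by (simp add: divide_inverse ac_simps)
    moreover have "C * (x - u) ^ m * u powr (real c - 1) * exp (\<kappa> * (x - u)) = gamma_density (real c) \<theta> u * poisson_prob m (x - u)"
    proof -
      have "gamma_density (real c) \<theta> u * poisson_prob m (x - u)
          = (exp (- u / \<theta>) * exp (- (x - u))) * ((x - u) ^ m * u powr (real c - 1) / (Gamma (real c) * \<theta> ^ c * fact m))"
        using True \<theta> by (simp add: gamma_density_def poisson_prob_def powr_realpow)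
      then show ?thesis unfolding e C_def by simp
    qed
    ultimately have "(\<lambda>j. C * (\<kappa> ^ j / fact j) * h j u) sums (gamma_density (real c) \<theta> u * poisson_prob m (x - u))"
      by simp
    then have "(\<Sum>j. ennreal (C * (\<kappa> ^ j / fact j) * h j u)) = ennreal (gamma_density (real c) \<theta> u * poisson_prob m (x - u))"
      using C \<kappa> h_nonneg by (intro suminf_ennreal_eq) auto
    moreover have "ennreal (C * (\<kappa> ^ j / fact j) * h j u) = ennreal (C * (\<kappa> ^ j / fact j)) * ennreal (h j u)" for j
      using C \<kappa> h_nonneg by (intro ennreal_mult) auto
    moreover have "ennreal (gamma_density (real c) \<theta> u * poisson_prob m (x - u))
        = ennreal (gamma_density (real c) \<theta> u) * ennreal (poisson_prob m (x - u))"
      using c by (intro ennreal_mult gamma_density_nonneg) auto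
    ultimately show ?thesis by (simp only:)
  next
    case False
    with that have "u \<le> 0 \<or> u > x" by auto
    then have "gamma_density (real c) \<theta> u = 0 \<or> poisson_prob m (x - u) = 0"
      by (auto simp: gamma_density_def poisson_prob_def)
    moreover have "h j u = 0" for j using False by (simp add: h_def)
    ultimately show ?thesis by auto
  qed
  have "(\<integral>\<^sup>+u. ennreal (gamma_density (real c) \<theta> u) * ennreal (poisson_prob m (x - u)) \<partial>lborel)
      = (\<integral>\<^sup>+u. (\<Sum>j. ennreal (C * (\<kappa> ^ j / fact j)) * ennreal (h j u)) \<partial>lborel)"
    by (rule nn_integral_cong_AE) (use AE_lborel_singleton[of x] pt in \<open>auto elim!: eventually_mono\<close>)
  also have "\<dots> = (\<Sum>j. \<integral>\<^sup>+u. ennreal (C * (\<kappa> ^ j / fact j)) * ennreal (h j u) \<partial>lborel)"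
    by (rule nn_integral_suminf) measurable
  also have "\<dots> = (\<Sum>j. ennreal (x ^ (c + m) * exp (- x / \<theta>) / \<theta> ^ c *
      (pochhammer (real m + 1) j * (r\<^sup>2 * x / \<theta>) ^ j / (Gamma (real (c + 1 + m) + real j) * fact j))))"
  proof (rule arg_cong[where f=suminf], rule ext)
    fix j
    \<comment> \<open>Gamma (m + j + 1) = m! (m + 1)_j supplies the Pochhammer symbol; m! and Gamma
      c cancel against the constant C.\<close>
    have B: "x powr (real (m + j + 1) + real c - 1) * Beta (real (m + j + 1)) (real c)
        = x ^ (c + m) * x ^ j * (fact m * pochhammer (real m + 1) j * Gamma (real c) / Gamma (real (c + 1 + m) + real j))"
    proof -
      have "real (m + j + 1) + real c - 1 = real (c + m + j)" by simp
      then have "x powr (real (m + j + 1) + real c - 1) = x ^ (c + m) * x ^ j"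
        using x by (simp only: powr_realpow power_add)
      moreover have "Gamma (real (m + j + 1)) = fact m * pochhammer (real m + 1) j"
        using Gamma_fact[of "m + j", where 'a=real] unfolding fact_add_pochhammer by (simp add: ac_simps)
      ultimately show ?thesis by (simp add: Beta_def ac_simps)
    qed
    have B_nonneg: "x powr (real (m + j + 1) + real c - 1) * Beta (real (m + j + 1)) (real c) \<ge> 0"
      using c by (intro mult_nonneg_nonneg) (auto simp: Beta_def intro!: divide_nonneg_nonneg mult_nonneg_nonneg Gamma_real_nonneg)
    have "(\<integral>\<^sup>+u. ennreal (C * (\<kappa> ^ j / fact j)) * ennreal (h j u) \<partial>lborel)
        = ennreal (C * (\<kappa> ^ j / fact j)) * ennreal (x powr (real (m + j + 1) + real c - 1) * Beta (real (m + j + 1)) (real c))"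
      unfolding h_def using c x
      by (subst nn_integral_cmult, measurable, subst nn_integral_Beta_scaled) auto
    also have "\<dots> = ennreal (C * (\<kappa> ^ j / fact j) * (x powr (real (m + j + 1) + real c - 1) * Beta (real (m + j + 1)) (real c)))"
      using C \<kappa> B_nonneg by (intro ennreal_mult[symmetric]) auto
    also have "C * (\<kappa> ^ j / fact j) * (x powr (real (m + j + 1) + real c - 1) * Beta (real (m + j + 1)) (real c))
        = x ^ (c + m) * exp (- x / \<theta>) / \<theta> ^ c *
      (pochhammer (real m + 1) j * (r\<^sup>2 * x / \<theta>) ^ j / (Gamma (real (c + 1 + m) + real j) * fact j))"
    proof -
      have "(r\<^sup>2 * x / \<theta>) ^ j = \<kappa> ^ j * x ^ j" by (simp add: \<kappa>_def power_mult_distrib[symmetric])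
      then show ?thesis unfolding B C_def using G by (simp add: ac_simps)
    qed
    finally show "(\<integral>\<^sup>+u. ennreal (C * (\<kappa> ^ j / fact j)) * ennreal (h j u) \<partial>lborel) = ennreal (x ^ (c + m) * exp (- x / \<theta>) / \<theta> ^ c *
      (pochhammer (real m + 1) j * (r\<^sup>2 * x / \<theta>) ^ j / (Gamma (real (c + 1 + m) + real j) * fact j)))" .
  qed
  also have "\<dots> = ennreal (x ^ (c + m) * exp (- x / \<theta>) / \<theta> ^ c * hyp1F1_reg (real m + 1) (real (c + 1 + m)) (r\<^sup>2 * x / \<theta>))"
  proof (rule suminf_ennreal_eq)
    have z: "r\<^sup>2 * x / \<theta> \<ge> 0" using \<theta> x by simp
    show "(\<lambda>j. x ^ (c + m) * exp (- x / \<theta>) / \<theta> ^ c *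
      (pochhammer (real m + 1) j * (r\<^sup>2 * x / \<theta>) ^ j / (Gamma (real (c + 1 + m) + real j) * fact j)))
      sums (x ^ (c + m) * exp (- x / \<theta>) / \<theta> ^ c * hyp1F1_reg (real m + 1) (real (c + 1 + m)) (r\<^sup>2 * x / \<theta>))"
      by (rule sums_mult) (rule hyp1F1_reg_sums(1)[OF z], simp)
    show "0 \<le> x ^ (c + m) * exp (- x / \<theta>) / \<theta> ^ c *
      (pochhammer (real m + 1) j * (r\<^sup>2 * x / \<theta>) ^ j / (Gamma (real (c + 1 + m) + real j) * fact j))" for j
      using x \<theta> by (intro mult_nonneg_nonneg hyp1F1_reg_term_bounds(1)[OF z]) auto
  qed
  finally show ?thesis by (simp add: ac_simps)
qed

text \<open>For m = 0 the mismatch can be absorbed exactly: since 1/\<theta> - 1 = r^2/\<theta>,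
  multiplying by exp(u) turns scale \<theta> into scale \<theta>/r^2, at the cost of the normalising
  factor r^(-2c). This scale is finite only for r different from 0.\<close>

lemma nn_integral_gamma_density_poisson_0:
  fixes c :: nat
  assumes r: "\<bar>r\<bar> < 1" "r \<noteq> 0" and c: "c \<ge> 1" and x: "x > 0"
  defines "\<theta> \<equiv> 1 - r\<^sup>2"
  shows "(\<integral>\<^sup>+u. ennreal (gamma_density (real c) \<theta> u) * ennreal (poisson_prob 0 (x - u)) \<partial>lborel)
           = ennreal (exp (- x) / r ^ (2 * c) * lower_gamma_reg (real c) (r\<^sup>2 * x / \<theta>))"
proof -
  have \<theta>: "\<theta> > 0" using r by (simp add: \<theta>_def abs_square_less_1)
  have r2: "r\<^sup>2 > 0" using r by simp
  define \<theta>' where "\<theta>' = \<theta> / r\<^sup>2"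
  have \<theta>': "\<theta>' > 0" using \<theta> r2 by (simp add: \<theta>'_def)
  have "(\<integral>\<^sup>+u. ennreal (gamma_density (real c) \<theta> u) * ennreal (poisson_prob 0 (x - u)) \<partial>lborel)
      = (\<integral>\<^sup>+u. ennreal (exp (- x) / r ^ (2 * c)) * (ennreal (gamma_density (real c) \<theta>' u) * indicator {..x} u) \<partial>lborel)"
  proof (rule nn_integral_cong)
    fix u :: real
    show "ennreal (gamma_density (real c) \<theta> u) * ennreal (poisson_prob 0 (x - u))
      = ennreal (exp (- x) / r ^ (2 * c)) * (ennreal (gamma_density (real c) \<theta>' u) * indicator {..x} u)"
    proof (cases "0 < u \<and> u \<le> x")
      case True
      have "- u / \<theta> + - (x - u) = - x + - u / \<theta>'"
        using \<theta> r2 unfolding \<theta>'_def by (simp add: field_simps) (simp add: \<theta>_def algebra_simps)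
      then have e: "exp (- u / \<theta>) * exp (- (x - u)) = exp (- x) * exp (- u / \<theta>')"
        by (simp only: exp_add[symmetric])
      have "\<theta> ^ c = \<theta>' ^ c * r ^ (2 * c)"
        using r2 by (simp add: \<theta>'_def power_divide power_mult)
      then have "gamma_density (real c) \<theta> u * poisson_prob 0 (x - u)
          = (exp (- u / \<theta>) * exp (- (x - u))) * (u powr (real c - 1) / (Gamma (real c) * (\<theta>' ^ c * r ^ (2 * c))))"
        using True \<theta> by (simp add: gamma_density_def poisson_prob_def powr_realpow)
      also have "\<dots> = exp (- x) / r ^ (2 * c) * gamma_density (real c) \<theta>' u"
        unfolding e using True \<theta>' by (simp add: gamma_density_def powr_realpow ac_simps)
      finally show ?thesis
        using True c by (simp add: ennreal_mult'[symmetric] gamma_density_nonneg)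
    qed (auto simp: gamma_density_def poisson_prob_def)
  qed
  also have "\<dots> = ennreal (exp (- x) / r ^ (2 * c)) * ennreal (lower_gamma_reg (real c) (x / \<theta>'))"
    using c \<theta>' x by (subst nn_integral_cmult, measurable, subst lower_gamma_reg_nn_integral) auto
  also have "\<dots> = ennreal (exp (- x) / r ^ (2 * c) * lower_gamma_reg (real c) (x / \<theta>'))"
    using c \<theta>' x by (intro ennreal_mult[symmetric] lower_gamma_reg_nn_integral(2)) auto
  also have "x / \<theta>' = r\<^sup>2 * x / \<theta>" using r2 by (simp add: \<theta>'_def)
  finally show ?thesis .
qed

section \<open>Sums of correlated exponentials\<close>

lemma nn_integral_kibble_swap:
  fixes f :: "real \<times> real \<Rightarrow> ennreal"
  assumes [measurable]: "f \<in> borel_measurable (borel \<Otimes>\<^sub>M borel)"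
  shows "(\<integral>\<^sup>+z. f (snd z, fst z) \<partial>kibble a r) = (\<integral>\<^sup>+z. f z \<partial>kibble a r)"
proof -
  let ?g = "\<lambda>k x. ennreal (gamma_density (a + real k) (1 - r\<^sup>2) x)"
  have "(\<integral>\<^sup>+x. ?g k x * (\<integral>\<^sup>+y. ?g k y * f (y, x) \<partial>lborel) \<partial>lborel)
      = (\<integral>\<^sup>+x. ?g k x * (\<integral>\<^sup>+y. ?g k y * f (x, y) \<partial>lborel) \<partial>lborel)" for k
  proof -
    have "(\<integral>\<^sup>+x. ?g k x * (\<integral>\<^sup>+y. ?g k y * f (y, x) \<partial>lborel) \<partial>lborel)
        = (\<integral>\<^sup>+x. \<integral>\<^sup>+y. ?g k x * (?g k y * f (y, x)) \<partial>lborel \<partial>lborel)"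
      by (rule nn_integral_cong, rule nn_integral_cmult[symmetric]) measurable
    also have "\<dots> = (\<integral>\<^sup>+y. \<integral>\<^sup>+x. ?g k x * (?g k y * f (y, x)) \<partial>lborel \<partial>lborel)"
      by (rule lborel_pair.Fubini'[symmetric]) measurable
    also have "\<dots> = (\<integral>\<^sup>+x. \<integral>\<^sup>+y. ?g k x * (?g k y * f (x, y)) \<partial>lborel \<partial>lborel)"
      by (simp only: mult.left_commute)
    also have "\<dots> = (\<integral>\<^sup>+x. ?g k x * (\<integral>\<^sup>+y. ?g k y * f (x, y) \<partial>lborel) \<partial>lborel)"
      by (rule nn_integral_cong, rule nn_integral_cmult) measurable
    finally show ?thesis .
  qed
  note swap = this
  have "(\<integral>\<^sup>+z. f (snd z, fst z) \<partial>kibble a r) = (\<Sum>k. ennreal (kibble_weight a r k) *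
      (\<integral>\<^sup>+x. ?g k x * (\<integral>\<^sup>+y. ?g k y * f (snd (x, y), fst (x, y)) \<partial>lborel) \<partial>lborel))"
    by (rule nn_integral_kibble) measurable
  also have "\<dots> = (\<Sum>k. ennreal (kibble_weight a r k) *
      (\<integral>\<^sup>+x. ?g k x * (\<integral>\<^sup>+y. ?g k y * f (x, y) \<partial>lborel) \<partial>lborel))"
    by (simp only: fst_conv snd_conv swap)
  also have "\<dots> = (\<integral>\<^sup>+z. f z \<partial>kibble a r)"
    by (rule nn_integral_kibble[symmetric]) measurable
  finally show ?thesis .
qed

text \<open>For shape 1 the weights are geometric, and the mixture of Gamma densities sums to
  exp(-x/\<theta>) exp(r^2 x/\<theta>) = exp(-x).\<close>

lemma kibble_1_marginal:
  fixes f :: "real \<Rightarrow> ennreal"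
  assumes [measurable]: "f \<in> borel_measurable borel" and r: "\<bar>r\<bar> < 1"
  shows "(\<integral>\<^sup>+z. f (fst z) \<partial>kibble 1 r) = (\<integral>\<^sup>+x. ennreal (exponential_density 1 x) * f x \<partial>lborel)"
proof -
  define \<theta> where "\<theta> = 1 - r\<^sup>2"
  have \<theta>: "\<theta> > 0" using r by (simp add: \<theta>_def abs_square_less_1)
  define \<kappa> where "\<kappa> = r\<^sup>2 / \<theta>"
  let ?g = "\<lambda>k x. gamma_density (1 + real k) \<theta> x"
  have total: "(\<integral>\<^sup>+y. ennreal (?g k y) * f x \<partial>lborel) = f x" for k x
    using nn_integral_gamma_density[of "1 + real k" \<theta>] \<theta> by (subst nn_integral_multc) auto
  have "(\<integral>\<^sup>+z. f (fst z) \<partial>kibble 1 r)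
      = (\<Sum>k. ennreal (kibble_weight 1 r k) * (\<integral>\<^sup>+x. ennreal (?g k x) * f x \<partial>lborel))"
    by (subst nn_integral_kibble) (simp_all add: \<theta>_def[symmetric] total)
  also have "\<dots> = (\<Sum>k. (\<integral>\<^sup>+x. ennreal (kibble_weight 1 r k) * ennreal (?g k x) * f x \<partial>lborel))"
    by (simp add: nn_integral_cmult mult.assoc)
  also have "\<dots> = (\<integral>\<^sup>+x. (\<Sum>k. ennreal (kibble_weight 1 r k) * ennreal (?g k x) * f x) \<partial>lborel)"
    by (rule nn_integral_suminf[symmetric]) measurable
  also have "\<dots> = (\<integral>\<^sup>+x. ennreal (exponential_density 1 x) * f x \<partial>lborel)"
  \<comment> \<open>At 0 the exponential density is 1 whereas \<open>gamma_density\<close> is 0, so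
    this point is discarded as a null set.\<close>
  proof (rule nn_integral_cong_AE, use AE_lborel_singleton[of "0::real"] in eventually_elim)
    fix x :: real assume "x \<noteq> 0"
    show "(\<Sum>k. ennreal (kibble_weight 1 r k) * ennreal (?g k x) * f x) = ennreal (exponential_density 1 x) * f x"
    proof (cases "x > 0")
      case True
      have "(\<lambda>k. exp (- x / \<theta>) * ((\<kappa> * x) ^ k /\<^sub>R fact k)) sums (exp (- x / \<theta>) * exp (\<kappa> * x))"
        by (intro sums_mult exp_converges)
      moreover have "exp (- x / \<theta>) * exp (\<kappa> * x) = exp (- x)"
      proof -
        have "- x / \<theta> + \<kappa> * x = - x"
          using \<theta> unfolding \<kappa>_def by (simp add: field_simps) (simp add: \<theta>_def algebra_simps)
        then show ?thesis by (simp only: exp_add[symmetric])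
      qed
      moreover have "kibble_weight 1 r k * ?g k x = exp (- x / \<theta>) * ((\<kappa> * x) ^ k /\<^sub>R fact k)" for k
      proof -
        have w: "kibble_weight 1 r k = \<theta> * r ^ (2 * k)"
          using \<theta> by (simp add: kibble_weight_def \<theta>_def[symmetric] pochhammer_fact[symmetric])
        have "\<theta> powr (1 + real k) = \<theta> * \<theta> ^ k" using \<theta> by (simp add: powr_add powr_realpow)
        then have g: "?g k x = x ^ k * exp (- x / \<theta>) / (fact k * (\<theta> * \<theta> ^ k))"
          using True Gamma_fact[of k, where 'a=real] by (simp add: gamma_density_def powr_realpow)
        have kx: "(\<kappa> * x) ^ k = r ^ (2 * k) * x ^ k / \<theta> ^ k"
          by (simp add: \<kappa>_def power_mult_distrib power_divide power_mult)
        show ?thesis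
          unfolding w g kx using \<theta> by (simp add: field_simps)
      qed
      ultimately have "(\<lambda>k. kibble_weight 1 r k * ?g k x) sums exp (- x)" by simp
      then have "(\<Sum>k. ennreal (kibble_weight 1 r k * ?g k x)) = ennreal (exp (- x))"
        by (intro suminf_ennreal_eq) (auto simp: kibble_weight_nonneg gamma_density_nonneg)
      moreover have "ennreal (kibble_weight 1 r k * ?g k x) = ennreal (kibble_weight 1 r k) * ennreal (?g k x)" for k
        by (intro ennreal_mult) (auto simp: kibble_weight_nonneg gamma_density_nonneg)
      ultimately show ?thesis
        using True by (simp add: ennreal_suminf_multc exponential_density_def)
    qed (use \<open>x \<noteq> 0\<close> in \<open>simp add: gamma_density_def exponential_density_def\<close>)
  qed
  finally show ?thesis .
qed

text \<open>Independence makes the joint law a product, so an integral under the law of the sum is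
  the iterated integral of \<open>nn_integral_kibble_add\<close>.\<close>

lemma (in prob_space) indep_kibble_add:
  fixes Z Z' :: "'a \<Rightarrow> real \<times> real"
  assumes ind: "indep_var (borel \<Otimes>\<^sub>M borel) Z (borel \<Otimes>\<^sub>M borel) Z'"
    and Z: "distr M (borel \<Otimes>\<^sub>M borel) Z = kibble a r"
    and Z': "distr M (borel \<Otimes>\<^sub>M borel) Z' = kibble b r"
    and ab: "a > 0" "b > 0" and r: "\<bar>r\<bar> < 1"
  shows "distr M (borel \<Otimes>\<^sub>M borel) (\<lambda>\<omega>. (fst (Z \<omega>) + fst (Z' \<omega>), snd (Z \<omega>) + snd (Z' \<omega>))) = kibble (a + b) r"
proof (rule measure_eqI)
  have [measurable]: "Z \<in> measurable M (borel \<Otimes>\<^sub>M borel)" "Z' \<in> measurable M (borel \<Otimes>\<^sub>M borel)"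
    using ind by (auto dest: indep_var_rv1 indep_var_rv2)
  interpret Z': prob_space "kibble b r"
    unfolding Z'[symmetric] by (rule prob_space_distr) measurable
  have law: "distr M ((borel \<Otimes>\<^sub>M borel) \<Otimes>\<^sub>M (borel \<Otimes>\<^sub>M borel)) (\<lambda>\<omega>. (Z \<omega>, Z' \<omega>)) = kibble a r \<Otimes>\<^sub>M kibble b r"
    using ind unfolding indep_var_distribution_eq Z Z' by simp
  fix A assume "A \<in> sets (distr M (borel \<Otimes>\<^sub>M borel) (\<lambda>\<omega>. (fst (Z \<omega>) + fst (Z' \<omega>), snd (Z \<omega>) + snd (Z' \<omega>))))"
  then have [measurable]: "A \<in> sets (borel \<Otimes>\<^sub>M borel)" by simp
  let ?F = "\<lambda>p :: (real \<times> real) \<times> (real \<times> real).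
      indicator A (fst (fst p) + fst (snd p), snd (fst p) + snd (snd p)) :: ennreal"
  have "emeasure (distr M (borel \<Otimes>\<^sub>M borel) (\<lambda>\<omega>. (fst (Z \<omega>) + fst (Z' \<omega>), snd (Z \<omega>) + snd (Z' \<omega>)))) A
      = (\<integral>\<^sup>+\<omega>. ?F (Z \<omega>, Z' \<omega>) \<partial>M)"
    by (subst nn_integral_indicator[symmetric], simp, subst nn_integral_distr) auto
  also have "\<dots> = (\<integral>\<^sup>+p. ?F p \<partial>distr M ((borel \<Otimes>\<^sub>M borel) \<Otimes>\<^sub>M (borel \<Otimes>\<^sub>M borel)) (\<lambda>\<omega>. (Z \<omega>, Z' \<omega>)))"
    by (subst nn_integral_distr) auto
  also have "\<dots> = (\<integral>\<^sup>+z. \<integral>\<^sup>+z'. ?F (z, z') \<partial>kibble b r \<partial>kibble a r)"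
    unfolding law by (rule Z'.nn_integral_fst[symmetric]) measurable
  also have "\<dots> = (\<integral>\<^sup>+z. indicator A z \<partial>kibble (a + b) r)"
    using nn_integral_kibble_add[of "indicator A" a b r] ab r by simp
  finally show "emeasure (distr M (borel \<Otimes>\<^sub>M borel) (\<lambda>\<omega>. (fst (Z \<omega>) + fst (Z' \<omega>), snd (Z \<omega>) + snd (Z' \<omega>)))) A
      = emeasure (kibble (a + b) r) A" by simp
qed simp

text \<open>The distribution function of a sum of m independent unit exponentials, indexed by the
  number of summands. For m = 0 it is the unit step at 0, so the empty increment is covered
  too.\<close>

definition erlang_cdf :: "nat \<Rightarrow> real \<Rightarrow> real" where
  "erlang_cdf m z = (if z < 0 then 0 else 1 - (\<Sum>j<m. z ^ j * exp (- z) / fact j))"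

lemma erlang_cdf_Suc: "erlang_cdf (Suc m) = erlang_CDF m 1"
  by (simp add: erlang_cdf_def erlang_CDF_def fun_eq_iff lessThan_Suc_atMost)

text \<open>At least m arrivals but not m + 1 means exactly m; this is where the Poisson weights
  enter.\<close>

lemma erlang_cdf_diff: "erlang_cdf m z - erlang_cdf (Suc m) z = poisson_prob m z"
  by (simp add: erlang_cdf_def poisson_prob_def)

lemma erlang_cdf_measurable [measurable]: "erlang_cdf m \<in> borel_measurable borel"
  unfolding erlang_cdf_def by measurable

lemma erlang_cdf_nonneg: "0 \<le> erlang_cdf m z"
  by (cases m) (simp_all add: erlang_cdf_Suc erlang_cdf_def[of 0])

lemma erlang_cdf_le_1: "erlang_cdf m z \<le> 1"
  by (auto simp: erlang_cdf_def intro!: sum_nonneg)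

lemma erlang_cdf_tendsto_0: "(\<lambda>m. erlang_cdf m z) \<longlonglongrightarrow> 0"
proof (cases "z < 0")
  case False
  have "(\<lambda>j. z ^ j /\<^sub>R fact j * exp (- z)) sums (exp z * exp (- z))"
    by (intro sums_mult2 exp_converges)
  then have "(\<lambda>m. \<Sum>j<m. z ^ j * exp (- z) / fact j) \<longlonglongrightarrow> 1"
    by (simp add: sums_def exp_minus divide_inverse ac_simps)
  from tendsto_diff[OF tendsto_const this, of 1] show ?thesis
    using False by (simp add: erlang_cdf_def)
qed (simp add: erlang_cdf_def)

definition partial_sum :: "(nat \<Rightarrow> 'w \<Rightarrow> real) \<Rightarrow> nat \<Rightarrow> 'w \<Rightarrow> real" where
  "partial_sum X n \<omega> = (\<Sum>k=1..n. X k \<omega>)"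

lemma partial_sum_0 [simp]: "partial_sum X 0 \<omega> = 0"
  by (simp add: partial_sum_def)

text \<open>What remains of the field at two locations after multiplying the inter-arrival times by
  the respective intensities: pairs that are independent over k, dependent within a pair, with a law
  that depends on r alone. The intensities survive only as the horizons x and y.\<close>

locale kibble_arrivals = prob_space M for M :: "'w measure" +
  fixes X Y :: "nat \<Rightarrow> 'w \<Rightarrow> real" and r :: real
  assumes indep: "indep_vars (\<lambda>_. borel \<Otimes>\<^sub>M borel) (\<lambda>k \<omega>. (X k \<omega>, Y k \<omega>)) {1..}"
    and law: "k \<ge> 1 \<Longrightarrow> distr M (borel \<Otimes>\<^sub>M borel) (\<lambda>\<omega>. (X k \<omega>, Y k \<omega>)) = kibble 1 r"
    and r: "\<bar>r\<bar> < 1"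
begin

lemma pair_measurable: "k \<ge> 1 \<Longrightarrow> (\<lambda>\<omega>. (X k \<omega>, Y k \<omega>)) \<in> measurable M (borel \<Otimes>\<^sub>M borel)"
  using indep by (simp add: indep_vars_def)

lemma X_measurable: "k \<ge> 1 \<Longrightarrow> X k \<in> borel_measurable M"
  and Y_measurable: "k \<ge> 1 \<Longrightarrow> Y k \<in> borel_measurable M"
  using measurable_compose[OF pair_measurable measurable_fst] measurable_compose[OF pair_measurable measurable_snd]
  by auto

text \<open>Symmetry of the law lets each result be reused with the two locations interchanged, by a
  second interpretation of the locale.\<close>

lemma swap: "kibble_arrivals M Y X r"
proof (unfold_locales)
  have "indep_vars (\<lambda>_. borel \<Otimes>\<^sub>M borel) (\<lambda>k \<omega>. (\<lambda>z. (snd z, fst z)) (X k \<omega>, Y k \<omega>)) {1..}"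
    by (rule indep_vars_compose2[OF indep]) measurable
  then show "indep_vars (\<lambda>_. borel \<Otimes>\<^sub>M borel) (\<lambda>k \<omega>. (Y k \<omega>, X k \<omega>)) {1..}" by simp
  fix k :: nat assume k: "k \<ge> 1"
  note [measurable] = X_measurable[OF k] Y_measurable[OF k]
  show "distr M (borel \<Otimes>\<^sub>M borel) (\<lambda>\<omega>. (Y k \<omega>, X k \<omega>)) = kibble 1 r"
  proof (rule measure_eqI)
    fix A assume "A \<in> sets (distr M (borel \<Otimes>\<^sub>M borel) (\<lambda>\<omega>. (Y k \<omega>, X k \<omega>)))"
    then have [measurable]: "A \<in> sets (borel \<Otimes>\<^sub>M borel)" by simp
    have "emeasure (distr M (borel \<Otimes>\<^sub>M borel) (\<lambda>\<omega>. (Y k \<omega>, X k \<omega>))) A = (\<integral>\<^sup>+\<omega>. indicator A (Y k \<omega>, X k \<omega>) \<partial>M)"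
      by (subst nn_integral_indicator[symmetric], simp, subst nn_integral_distr) auto
    also have "\<dots> = (\<integral>\<^sup>+z. indicator A (snd z, fst z) \<partial>distr M (borel \<Otimes>\<^sub>M borel) (\<lambda>\<omega>. (X k \<omega>, Y k \<omega>)))"
      by (subst nn_integral_distr) auto
    also have "\<dots> = (\<integral>\<^sup>+z. indicator A z \<partial>kibble 1 r)"
      unfolding law[OF k] by (rule nn_integral_kibble_swap) measurable
    finally show "emeasure (distr M (borel \<Otimes>\<^sub>M borel) (\<lambda>\<omega>. (Y k \<omega>, X k \<omega>))) A = emeasure (kibble 1 r) A" by simp
  qed simp
qed (rule r)

abbreviation SX :: "nat \<Rightarrow> 'w \<Rightarrow> real" where "SX \<equiv> partial_sum X"
abbreviation SY :: "nat \<Rightarrow> 'w \<Rightarrow> real" where "SY \<equiv> partial_sum Y"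

lemma SX_measurable [measurable]: "SX n \<in> borel_measurable M"
  unfolding partial_sum_def by (intro borel_measurable_sum X_measurable) auto

lemma SY_measurable [measurable]: "SY n \<in> borel_measurable M"
  unfolding partial_sum_def by (intro borel_measurable_sum Y_measurable) auto

text \<open>The semigroup law applied along the sequence. The induction starts at 1 because the
  empty sum sits at the origin and has no density.\<close>

lemma sums_law:
  assumes "n \<ge> 1"
  shows "distr M (borel \<Otimes>\<^sub>M borel) (\<lambda>\<omega>. (SX n \<omega>, SY n \<omega>)) = kibble (real n) r"
  using assms
proof (induction n rule: nat_induct_at_least)
  case base
  then show ?case using law[of 1] by (simp add: partial_sum_def)
next
  case (Suc n)
  let ?P = "\<lambda>k \<omega>. (X k \<omega>, Y k \<omega>)"
  have "indep_var (\<Pi>\<^sub>M k\<in>{1..n}. borel \<Otimes>\<^sub>M borel) (\<lambda>\<omega>. restrict (\<lambda>k. ?P k \<omega>) {1..n})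
      (\<Pi>\<^sub>M k\<in>{Suc n}. borel \<Otimes>\<^sub>M borel) (\<lambda>\<omega>. restrict (\<lambda>k. ?P k \<omega>) {Suc n})"
    by (rule indep_var_restrict[OF indep]) auto
  then have "indep_var (borel \<Otimes>\<^sub>M borel) ((\<lambda>f. (\<Sum>k=1..n. fst (f k), \<Sum>k=1..n. snd (f k))) \<circ> (\<lambda>\<omega>. restrict (\<lambda>k. ?P k \<omega>) {1..n}))
      (borel \<Otimes>\<^sub>M borel) ((\<lambda>f. f (Suc n)) \<circ> (\<lambda>\<omega>. restrict (\<lambda>k. ?P k \<omega>) {Suc n}))"
    by (rule indep_var_compose) measurable
  note ind = this
  have "indep_var (borel \<Otimes>\<^sub>M borel) (\<lambda>\<omega>. (SX n \<omega>, SY n \<omega>)) (borel \<Otimes>\<^sub>M borel) (\<lambda>\<omega>. (X (Suc n) \<omega>, Y (Suc n) \<omega>))"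
  proof -
    have "(\<lambda>f. (\<Sum>k=1..n. fst (f k), \<Sum>k=1..n. snd (f k))) \<circ> (\<lambda>\<omega>. restrict (\<lambda>k. ?P k \<omega>) {1..n}) = (\<lambda>\<omega>. (SX n \<omega>, SY n \<omega>))"
      by (auto simp: fun_eq_iff partial_sum_def intro!: sum.cong)
    moreover have "(\<lambda>f. f (Suc n)) \<circ> (\<lambda>\<omega>. restrict (\<lambda>k. ?P k \<omega>) {Suc n}) = ?P (Suc n)"
      by (auto simp: fun_eq_iff)
    ultimately show ?thesis
      using ind by (simp only:)
  qed
  from indep_kibble_add[OF this Suc.IH law] Suc.hyps r show ?case
    by (simp add: partial_sum_def add.commute)
qed

lemma X_exponential: "k \<ge> 1 \<Longrightarrow> distributed M lborel (X k) (exponential_density 1)"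
proof -
  assume k: "k \<ge> 1"
  note [measurable] = X_measurable[OF k] Y_measurable[OF k]
  have "distr M lborel (X k) = density lborel (exponential_density 1)"
  proof (rule measure_eqI)
    fix A assume "A \<in> sets (distr M lborel (X k))"
    then have [measurable]: "A \<in> sets borel" by simp
    have "emeasure (distr M lborel (X k)) A = (\<integral>\<^sup>+\<omega>. indicator A (X k \<omega>) \<partial>M)"
      by (subst nn_integral_indicator[symmetric], simp, subst nn_integral_distr) auto
    also have "\<dots> = (\<integral>\<^sup>+z. indicator A (fst z) \<partial>distr M (borel \<Otimes>\<^sub>M borel) (\<lambda>\<omega>. (X k \<omega>, Y k \<omega>)))"
      by (subst nn_integral_distr) auto
    also have "\<dots> = (\<integral>\<^sup>+x. ennreal (exponential_density 1 x) * indicator A x \<partial>lborel)"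
      unfolding law[OF k] by (rule kibble_1_marginal[OF _ r]) measurable
    finally show "emeasure (distr M lborel (X k)) A = emeasure (density lborel (exponential_density 1)) A"
      by (simp add: emeasure_density)
  qed simp
  then show ?thesis
    unfolding distributed_def by auto
qed

text \<open>The block after index b is what is added to the b-th arrival. The index m - 1 appears
  because \<open>erlang_density k\<close> has shape k + 1.\<close>

lemma X_sum_erlang:
  assumes "m \<ge> 1"
  shows "distributed M lborel (\<lambda>\<omega>. \<Sum>k\<in>{b+1..b+m}. X k \<omega>) (erlang_density (m - 1) 1)"
proof -
  have "indep_vars (\<lambda>_. borel) (\<lambda>k \<omega>. fst (X k \<omega>, Y k \<omega>)) {1..}"
    by (rule indep_vars_compose2[OF indep]) measurable
  then have "indep_vars (\<lambda>_. borel) X {b+1..b+m}"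
    using indep_vars_subset[of "\<lambda>_. borel" X "{1..}" "{b+1..b+m}"] by auto
  moreover have "{b+1..b+m} \<noteq> {}" using assms by auto
  ultimately show ?thesis
    using exponential_distributed_sum[where I = "{b+1..b+m}" and X = X and l = 1] X_exponential by simp
qed

end

section \<open>Joint distribution functions of the two arrival times and their differences\<close>

definition joint_cdf ::
  "'w measure \<Rightarrow> (nat \<Rightarrow> 'w \<Rightarrow> real) \<Rightarrow> (nat \<Rightarrow> 'w \<Rightarrow> real) \<Rightarrow> real \<Rightarrow> real \<Rightarrow> nat \<Rightarrow> nat \<Rightarrow> real" where
  "joint_cdf M X Y x y a b = measure M {\<omega> \<in> space M. partial_sum X a \<omega> \<le> x \<and> partial_sum Y b \<omega> \<le> y}"

lemma joint_cdf_swap: "joint_cdf M X Y x y a b = joint_cdf M Y X y x b a"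
  unfolding joint_cdf_def by (simp only: conj_commute)

text \<open>The way back to real series: a finite extended sum of nonnegative terms is already a
  convergence proof.\<close>

lemma ennreal_suminf_eq_sums:
  assumes t: "\<And>k. t k \<ge> 0" and D: "D \<ge> 0" and eq: "(\<Sum>k. ennreal (t k)) = ennreal D"
  shows "t sums D"
proof -
  have "summable t" by (rule summable_suminf_not_top[OF t]) (simp add: eq)
  moreover from suminf_ennreal2[OF t this] eq have "suminf t = D"
    using D suminf_nonneg[OF \<open>summable t\<close> t] by simp
  ultimately show ?thesis by (simp add: sums_iff)
qed

text \<open>The hockey-stick identity, that is, multiplying the power series of (1 - t)^(-b) by 1/(1
  - t). It says that the mixture coefficients for b + 1 are partial sums of those for b, which is
  the source of the double series in (c) and (d).\<close>

lemma sum_pochhammer_div_fact: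
  fixes b :: real
  shows "(\<Sum>l\<le>m. pochhammer b l / fact l) = pochhammer (b + 1) m / (fact m :: real)"
proof (induction m)
  case (Suc m)
  show ?case
    unfolding sum.atMost_Suc Suc.IH pochhammer_rec[of b m] pochhammer_Suc[of "b + 1" m] fact_Suc
    by (simp add: divide_simps) (simp add: algebra_simps)
qed simp

text \<open>Given the mixture index the coordinates are independent, so the bound on the second one
  splits off as an incomplete Gamma factor and leaves a one-dimensional integral.\<close>

lemma nn_integral_kibble_rect:
  fixes \<phi> :: "real \<Rightarrow> real"
  assumes [measurable]: "\<phi> \<in> borel_measurable borel" and \<phi>: "\<And>u. \<phi> u \<ge> 0"
    and b: "b > 0" and r: "\<bar>r\<bar> < 1" and y: "y \<ge> 0"
  shows "(\<integral>\<^sup>+z. ennreal (indicator {..y} (snd z) * \<phi> (fst z)) \<partial>kibble b r)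
    = (\<Sum>k. ennreal (kibble_weight b r k * lower_gamma_reg (b + real k) (y / (1 - r\<^sup>2))) *
        (\<integral>\<^sup>+u. ennreal (gamma_density (b + real k) (1 - r\<^sup>2) u) * ennreal (\<phi> u) \<partial>lborel))"
proof -
  define \<theta> where "\<theta> = 1 - r\<^sup>2"
  have \<theta>: "\<theta> > 0" using r by (simp add: \<theta>_def abs_square_less_1)
  let ?g = "\<lambda>k u. ennreal (gamma_density (b + real k) \<theta> u)"
  let ?l = "\<lambda>k. lower_gamma_reg (b + real k) (y / \<theta>)"
  have "(\<integral>\<^sup>+z. ennreal (indicator {..y} (snd z) * \<phi> (fst z)) \<partial>kibble b r)
      = (\<Sum>k. ennreal (kibble_weight b r k) * (\<integral>\<^sup>+u. ?g k u * (\<integral>\<^sup>+v. ?g k v * ennreal (indicator {..y} (snd (u, v)) * \<phi> (fst (u, v))) \<partial>lborel) \<partial>lborel))"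
    unfolding \<theta>_def by (rule nn_integral_kibble) measurable
  also have "\<dots> = (\<Sum>k. ennreal (kibble_weight b r k * ?l k) * (\<integral>\<^sup>+u. ?g k u * ennreal (\<phi> u) \<partial>lborel))"
  proof (rule arg_cong[where f=suminf], rule ext)
    fix k
    have bk: "b + real k > 0" using b by simp
    have inner: "(\<integral>\<^sup>+v. ?g k v * ennreal (indicator {..y} (snd (u, v)) * \<phi> (fst (u, v))) \<partial>lborel) = ennreal (\<phi> u) * ennreal (?l k)" for u
    proof -
      have "(\<integral>\<^sup>+v. ?g k v * ennreal (indicator {..y} (snd (u, v)) * \<phi> (fst (u, v))) \<partial>lborel)
          = (\<integral>\<^sup>+v. ennreal (\<phi> u) * (?g k v * indicator {..y} v) \<partial>lborel)"
        by (rule nn_integral_cong) (auto split: split_indicator simp: mult.commute)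
      also have "\<dots> = ennreal (\<phi> u) * ennreal (?l k)"
        by (subst nn_integral_cmult, measurable, subst lower_gamma_reg_nn_integral(1)[OF bk \<theta> y]) simp
      finally show ?thesis .
    qed
    have "(\<integral>\<^sup>+u. ?g k u * (\<integral>\<^sup>+v. ?g k v * ennreal (indicator {..y} (snd (u, v)) * \<phi> (fst (u, v))) \<partial>lborel) \<partial>lborel)
        = (\<integral>\<^sup>+u. ennreal (?l k) * (?g k u * ennreal (\<phi> u)) \<partial>lborel)"
      unfolding inner by (rule nn_integral_cong) (simp only: mult_ac)
    also have "\<dots> = ennreal (?l k) * (\<integral>\<^sup>+u. ?g k u * ennreal (\<phi> u) \<partial>lborel)"
      by (rule nn_integral_cmult) measurable
    finally show "ennreal (kibble_weight b r k) * (\<integral>\<^sup>+u. ?g k u * (\<integral>\<^sup>+v. ?g k v * ennreal (indicator {..y} (snd (u, v)) * \<phi> (fst (u, v))) \<partial>lborel) \<partial>lborel)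
        = ennreal (kibble_weight b r k * ?l k) * (\<integral>\<^sup>+u. ?g k u * ennreal (\<phi> u) \<partial>lborel)"
      using lower_gamma_reg_nn_integral(2)[OF bk \<theta> y] kibble_weight_nonneg[OF b]
      by (simp add: ennreal_mult mult.assoc)
  qed
  finally show ?thesis unfolding \<theta>_def .
qed

context kibble_arrivals
begin

lemma prob_space_kibble: "n \<ge> 1 \<Longrightarrow> prob_space (kibble (real n) r)"
  unfolding sums_law[symmetric] by (rule prob_space_distr) measurable

text \<open>Only the first sequence is continued beyond b; its increment is padded by 0 to a planar
  vector.\<close>

lemma sums_indep_increment:
  "indep_var (borel \<Otimes>\<^sub>M borel) (\<lambda>\<omega>. (SX b \<omega>, SY b \<omega>))
     (borel \<Otimes>\<^sub>M borel) (\<lambda>\<omega>. (\<Sum>k\<in>{b+1..b+m}. X k \<omega>, 0))"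
proof -
  let ?P = "\<lambda>k \<omega>. (X k \<omega>, Y k \<omega>)"
  have "indep_var (\<Pi>\<^sub>M k\<in>{1..b}. borel \<Otimes>\<^sub>M borel) (\<lambda>\<omega>. restrict (\<lambda>k. ?P k \<omega>) {1..b})
      (\<Pi>\<^sub>M k\<in>{b+1..b+m}. borel \<Otimes>\<^sub>M borel) (\<lambda>\<omega>. restrict (\<lambda>k. ?P k \<omega>) {b+1..b+m})"
    by (rule indep_var_restrict[OF indep]) auto
  then have ind: "indep_var (borel \<Otimes>\<^sub>M borel) ((\<lambda>f. (\<Sum>k=1..b. fst (f k), \<Sum>k=1..b. snd (f k))) \<circ> (\<lambda>\<omega>. restrict (\<lambda>k. ?P k \<omega>) {1..b}))
      (borel \<Otimes>\<^sub>M borel) ((\<lambda>f. (\<Sum>k\<in>{b+1..b+m}. fst (f k), 0 :: real)) \<circ> (\<lambda>\<omega>. restrict (\<lambda>k. ?P k \<omega>) {b+1..b+m}))"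
    by (rule indep_var_compose) measurable
  have "(\<lambda>f. (\<Sum>k=1..b. fst (f k), \<Sum>k=1..b. snd (f k))) \<circ> (\<lambda>\<omega>. restrict (\<lambda>k. ?P k \<omega>) {1..b}) = (\<lambda>\<omega>. (SX b \<omega>, SY b \<omega>))"
    by (auto simp: fun_eq_iff partial_sum_def intro!: sum.cong)
  moreover have "(\<lambda>f. (\<Sum>k\<in>{b+1..b+m}. fst (f k), 0 :: real)) \<circ> (\<lambda>\<omega>. restrict (\<lambda>k. ?P k \<omega>) {b+1..b+m})
      = (\<lambda>\<omega>. (\<Sum>k\<in>{b+1..b+m}. X k \<omega>, 0 :: real))"
    by (auto simp: fun_eq_iff intro!: sum.cong)
  ultimately show ?thesis using ind by (simp only:)
qed

lemma partial_sum_split: "SX (b + m) \<omega> = SX b \<omega> + (\<Sum>k\<in>{b+1..b+m}. X k \<omega>)"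
  by (induction m) (auto simp: partial_sum_def)

text \<open>Conditioning on both b-th arrivals: the m further steps of X are independent of them and
  Erlang distributed, so they enter through \<open>erlang_cdf\<close> at the remaining time x - u.
  An empty increment has no density and is handled apart.\<close>

lemma emeasure_joint_cdf:
  assumes b: "b \<ge> 1"
  shows "ennreal (joint_cdf M X Y x y (b + m) b)
    = (\<integral>\<^sup>+z. ennreal (indicator {..y} (snd z) * erlang_cdf m (x - fst z)) \<partial>kibble (real b) r)"
proof (cases "m = 0")
  case True
  have "ennreal (joint_cdf M X Y x y (b + m) b) = emeasure M {\<omega> \<in> space M. SX b \<omega> \<le> x \<and> SY b \<omega> \<le> y}"
    using True by (simp add: joint_cdf_def emeasure_eq_measure)
  also have "\<dots> = (\<integral>\<^sup>+\<omega>. indicator {\<omega> \<in> space M. SX b \<omega> \<le> x \<and> SY b \<omega> \<le> y} \<omega> \<partial>M)"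
    by (subst nn_integral_indicator) auto
  also have "\<dots> = (\<integral>\<^sup>+\<omega>. ennreal (indicator {..y} (snd (SX b \<omega>, SY b \<omega>)) * erlang_cdf m (x - fst (SX b \<omega>, SY b \<omega>))) \<partial>M)"
    using True by (intro nn_integral_cong) (auto simp: erlang_cdf_def split: split_indicator)
  also have "\<dots> = (\<integral>\<^sup>+z. ennreal (indicator {..y} (snd z) * erlang_cdf m (x - fst z)) \<partial>kibble (real b) r)"
    unfolding sums_law[OF b, symmetric] by (subst nn_integral_distr) auto
  finally show ?thesis .
next
  case False
  then obtain m' where m': "m = Suc m'" by (cases m) auto
  define R where "R = (\<lambda>\<omega>. \<Sum>k\<in>{b+1..b+m}. X k \<omega>)"
  have R_app: "(\<Sum>k\<in>{b+1..b+m}. X k \<omega>) = R \<omega>" for \<omega> by (simp only: R_def)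
  let ?Z = "\<lambda>\<omega>. (SX b \<omega>, SY b \<omega>)"
  have R_dist: "distributed M lborel R (erlang_density m' 1)"
    using X_sum_erlang[of m b] m' unfolding R_app by simp
  then have R_law: "distr M borel R = density lborel (erlang_density m' 1)"
    unfolding distributed_def by (simp cong: distr_cong)
  have [measurable]: "R \<in> borel_measurable M"
    using R_dist by (simp add: distributed_def)
  let ?Q = "distr M (borel \<Otimes>\<^sub>M borel) (\<lambda>\<omega>. (R \<omega>, 0 :: real))"
  interpret Q: prob_space ?Q by (rule prob_space_distr) measurable
  have law: "distr M ((borel \<Otimes>\<^sub>M borel) \<Otimes>\<^sub>M (borel \<Otimes>\<^sub>M borel)) (\<lambda>\<omega>. (?Z \<omega>, (R \<omega>, 0 :: real))) = kibble (real b) r \<Otimes>\<^sub>M ?Q"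
    using sums_indep_increment[of b m] unfolding R_app indep_var_distribution_eq sums_law[OF b] by simp
  let ?F = "\<lambda>p :: (real \<times> real) \<times> (real \<times> real).
      indicator {..y} (snd (fst p)) * indicator {..x} (fst (fst p) + fst (snd p)) :: ennreal"
  have "ennreal (joint_cdf M X Y x y (b + m) b) = emeasure M {\<omega> \<in> space M. SX (b + m) \<omega> \<le> x \<and> SY b \<omega> \<le> y}"
    by (simp add: joint_cdf_def emeasure_eq_measure)
  also have "\<dots> = (\<integral>\<^sup>+\<omega>. indicator {\<omega> \<in> space M. SX (b + m) \<omega> \<le> x \<and> SY b \<omega> \<le> y} \<omega> \<partial>M)"
    by (subst nn_integral_indicator) auto
  also have "\<dots> = (\<integral>\<^sup>+\<omega>. ?F (?Z \<omega>, (R \<omega>, 0)) \<partial>M)"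
    unfolding partial_sum_split R_app by (intro nn_integral_cong) (auto split: split_indicator)
  also have "\<dots> = (\<integral>\<^sup>+p. ?F p \<partial>distr M ((borel \<Otimes>\<^sub>M borel) \<Otimes>\<^sub>M (borel \<Otimes>\<^sub>M borel)) (\<lambda>\<omega>. (?Z \<omega>, (R \<omega>, 0 :: real))))"
    by (subst nn_integral_distr) auto
  also have "\<dots> = (\<integral>\<^sup>+z. \<integral>\<^sup>+t. ?F (z, t) \<partial>?Q \<partial>kibble (real b) r)"
    unfolding law by (rule Q.nn_integral_fst[symmetric]) measurable
  also have "\<dots> = (\<integral>\<^sup>+z. ennreal (indicator {..y} (snd z) * erlang_cdf m (x - fst z)) \<partial>kibble (real b) r)"
  proof (rule nn_integral_cong)
    fix z :: "real \<times> real"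
    have "(\<integral>\<^sup>+t. ?F (z, t) \<partial>?Q) = (\<integral>\<^sup>+t. ?F (z, (t, 0)) \<partial>distr M borel R)"
      by (subst (1 2) nn_integral_distr) auto
    also have "\<dots> = (\<integral>\<^sup>+t. indicator {..y} (snd z) * indicator {..x - fst z} t \<partial>density lborel (erlang_density m' 1))"
      unfolding R_law by (rule nn_integral_cong) (auto split: split_indicator)
    also have "\<dots> = indicator {..y} (snd z) * emeasure (density lborel (erlang_density m' 1)) {..x - fst z}"
      by (subst nn_integral_cmult_indicator) auto
    also have "\<dots> = ennreal (indicator {..y} (snd z) * erlang_cdf m (x - fst z))"
      by (auto simp: emeasure_erlang_density m' erlang_cdf_Suc split: split_indicator)
    finally show "(\<integral>\<^sup>+t. ?F (z, t) \<partial>?Q) = ennreal (indicator {..y} (snd z) * erlang_cdf m (x - fst z))" .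
  qed
  finally show ?thesis .
qed

text \<open>Subtraction is not faithful in \<open>ennreal\<close>, so the difference is formed
  between bounded Bochner integrals and translated back; its integrand telescopes to a Poisson
  weight.\<close>

lemma joint_cdf_diff:
  assumes b: "b \<ge> 1"
  shows "ennreal (joint_cdf M X Y x y (b + m) b - joint_cdf M X Y x y (b + m + 1) b)
    = (\<integral>\<^sup>+z. ennreal (indicator {..y} (snd z) * poisson_prob m (x - fst z)) \<partial>kibble (real b) r)" (is ?eq)
    and "joint_cdf M X Y x y (b + m) b - joint_cdf M X Y x y (b + m + 1) b \<ge> 0" (is ?nonneg)
proof -
  interpret K: prob_space "kibble (real b) r" by (rule prob_space_kibble[OF b])
  let ?e = "\<lambda>m z. indicator {..y} (snd z) * erlang_cdf m (x - fst z) :: real"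
  have int: "integrable (kibble (real b) r) (?e m)" for m
    by (rule K.integrable_const_bound[of _ 1])
       (auto simp: erlang_cdf_nonneg erlang_cdf_le_1 split: split_indicator)
  have F: "joint_cdf M X Y x y (b + m) b = (LINT z|kibble (real b) r. ?e m z)" for m
  proof -
    have "ennreal (joint_cdf M X Y x y (b + m) b) = ennreal (LINT z|kibble (real b) r. ?e m z)"
      unfolding emeasure_joint_cdf[OF b]
      by (rule nn_integral_eq_integral[OF int]) (auto simp: erlang_cdf_nonneg)
    moreover have "(LINT z|kibble (real b) r. ?e m z) \<ge> 0"
      by (rule integral_nonneg_AE) (auto simp: erlang_cdf_nonneg)
    ultimately show ?thesis by (simp add: joint_cdf_def)
  qed
  have d: "?e m z - ?e (m + 1) z = indicator {..y} (snd z) * poisson_prob m (x - fst z)" for z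
    using erlang_cdf_diff[of m "x - fst z"] by (simp add: right_diff_distrib[symmetric])
  have D: "joint_cdf M X Y x y (b + m) b - joint_cdf M X Y x y (b + m + 1) b
      = (LINT z|kibble (real b) r. indicator {..y} (snd z) * poisson_prob m (x - fst z))"
  proof -
    have "joint_cdf M X Y x y (b + m) b - joint_cdf M X Y x y (b + (m + 1)) b
        = (LINT z|kibble (real b) r. ?e m z - ?e (m + 1) z)"
      unfolding F by (rule Bochner_Integration.integral_diff[OF int int, symmetric])
    then show ?thesis unfolding d by (simp only: add.assoc)
  qed
  have "integrable (kibble (real b) r) (\<lambda>z. indicator {..y} (snd z) * poisson_prob m (x - fst z))"
    unfolding d[symmetric] by (rule Bochner_Integration.integrable_diff[OF int int])
  from nn_integral_eq_integral[OF this] show ?eq unfolding D by simp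
  show ?nonneg unfolding D by (rule integral_nonneg_AE) simp
qed

text \<open>V stands for the closed form of the one-dimensional integral, which has a hypergeometric
  version for general m and an incomplete Gamma version for m = 0.\<close>

lemma joint_cdf_diff_sums:
  fixes V :: "nat \<Rightarrow> real"
  assumes b: "b \<ge> 1" and y: "y \<ge> 0" and V: "\<And>k. V k \<ge> 0"
    and eq: "\<And>k. (\<integral>\<^sup>+u. ennreal (gamma_density (real (b + k)) (1 - r\<^sup>2) u) * ennreal (poisson_prob m (x - u)) \<partial>lborel) = ennreal (V k)"
  shows "(\<lambda>k. kibble_weight (real b) r k * lower_gamma_reg (real (b + k)) (y / (1 - r\<^sup>2)) * V k)
    sums (joint_cdf M X Y x y (b + m) b - joint_cdf M X Y x y (b + m + 1) b)"
proof (rule ennreal_suminf_eq_sums)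
  have w: "kibble_weight (real b) r k * lower_gamma_reg (real (b + k)) (y / (1 - r\<^sup>2)) \<ge> 0" for k
    using b y r lower_gamma_reg_nn_integral(2)[of "real (b + k)" "1 - r\<^sup>2" y]
    by (auto intro!: mult_nonneg_nonneg kibble_weight_nonneg simp: abs_square_less_1)
  then show "kibble_weight (real b) r k * lower_gamma_reg (real (b + k)) (y / (1 - r\<^sup>2)) * V k \<ge> 0" for k
    using V by simp
  show "0 \<le> joint_cdf M X Y x y (b + m) b - joint_cdf M X Y x y (b + m + 1) b"
    by (rule joint_cdf_diff(2)[OF b])
  have "ennreal (joint_cdf M X Y x y (b + m) b - joint_cdf M X Y x y (b + m + 1) b)
      = (\<Sum>k. ennreal (kibble_weight (real b) r k * lower_gamma_reg (real b + real k) (y / (1 - r\<^sup>2))) *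
        (\<integral>\<^sup>+u. ennreal (gamma_density (real b + real k) (1 - r\<^sup>2) u) * ennreal (poisson_prob m (x - u)) \<partial>lborel))"
    unfolding joint_cdf_diff(1)[OF b] using b r y by (intro nn_integral_kibble_rect) auto
  also have "\<dots> = (\<Sum>k. ennreal (kibble_weight (real b) r k * lower_gamma_reg (real (b + k)) (y / (1 - r\<^sup>2)) * V k))"
    using w V eq by (simp add: ennreal_mult[symmetric])
  finally show "(\<Sum>k. ennreal (kibble_weight (real b) r k * lower_gamma_reg (real (b + k)) (y / (1 - r\<^sup>2)) * V k))
      = ennreal (joint_cdf M X Y x y (b + m) b - joint_cdf M X Y x y (b + m + 1) b)" by simp
qed

text \<open>With equal indices no further arrivals occur, so both coordinates yield incomplete Gamma
  factors. Dividing by (1 - r^2)^n removes the common factor of the weights.\<close>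

lemma joint_cdf_diag_sums:
  assumes n: "n \<ge> 1" and x: "x \<ge> 0" and y: "y \<ge> 0"
  shows "(\<lambda>k. r ^ (2 * k) * pochhammer (real n) k / fact k
            * lower_gamma_reg2 (real (n + k)) (x / (1 - r\<^sup>2)) (y / (1 - r\<^sup>2)))
         sums (joint_cdf M X Y x y n n / (1 - r\<^sup>2) ^ n)"
proof -
  have \<theta>: "1 - r\<^sup>2 > 0" using r by (simp add: abs_square_less_1)
  let ?l = "\<lambda>k z. lower_gamma_reg (real n + real k) (z / (1 - r\<^sup>2))"
  have l: "?l k z \<ge> 0" if "z \<ge> 0" for k z
    using n that \<theta> lower_gamma_reg_nn_integral(2)[of "real n + real k" "1 - r\<^sup>2" z] by auto
  have w: "kibble_weight (real n) r k \<ge> 0" for k using n by (intro kibble_weight_nonneg) auto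
  have inner: "(\<integral>\<^sup>+u. ennreal (gamma_density (real n + real k) (1 - r\<^sup>2) u) * ennreal (erlang_cdf 0 (x - u)) \<partial>lborel) = ennreal (?l k x)" for k
  proof -
    have "(\<integral>\<^sup>+u. ennreal (gamma_density (real n + real k) (1 - r\<^sup>2) u) * ennreal (erlang_cdf 0 (x - u)) \<partial>lborel)
        = (\<integral>\<^sup>+u. ennreal (gamma_density (real n + real k) (1 - r\<^sup>2) u) * indicator {..x} u \<partial>lborel)"
      by (rule nn_integral_cong) (auto simp: erlang_cdf_def split: split_indicator)
    then show ?thesis
      using n x \<theta> lower_gamma_reg_nn_integral(1)[of "real n + real k" "1 - r\<^sup>2" x] by simp
  qed
  have "(\<lambda>k. kibble_weight (real n) r k * ?l k y * ?l k x) sums joint_cdf M X Y x y n n"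
  proof (rule ennreal_suminf_eq_sums)
    show "kibble_weight (real n) r k * ?l k y * ?l k x \<ge> 0" for k using l x y w by simp
    show "joint_cdf M X Y x y n n \<ge> 0" by (simp add: joint_cdf_def)
    have "ennreal (joint_cdf M X Y x y n n)
        = (\<integral>\<^sup>+z. ennreal (indicator {..y} (snd z) * erlang_cdf 0 (x - fst z)) \<partial>kibble (real n) r)"
      using emeasure_joint_cdf[OF n, of x y 0] by simp
    also have "\<dots> = (\<Sum>k. ennreal (kibble_weight (real n) r k * ?l k y) *
        (\<integral>\<^sup>+u. ennreal (gamma_density (real n + real k) (1 - r\<^sup>2) u) * ennreal (erlang_cdf 0 (x - u)) \<partial>lborel))"
      using n r y by (intro nn_integral_kibble_rect) (auto simp: erlang_cdf_nonneg)
    also have "\<dots> = (\<Sum>k. ennreal (kibble_weight (real n) r k * ?l k y * ?l k x))"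
    proof (rule arg_cong[where f=suminf], rule ext)
      fix k
      show "ennreal (kibble_weight (real n) r k * ?l k y) *
        (\<integral>\<^sup>+u. ennreal (gamma_density (real n + real k) (1 - r\<^sup>2) u) * ennreal (erlang_cdf 0 (x - u)) \<partial>lborel)
        = ennreal (kibble_weight (real n) r k * ?l k y * ?l k x)"
        unfolding inner using l[OF x] l[OF y] w by (intro ennreal_mult[symmetric]) auto
    qed
    finally show "(\<Sum>k. ennreal (kibble_weight (real n) r k * ?l k y * ?l k x)) = ennreal (joint_cdf M X Y x y n n)" by simp
  qed
  then have "(\<lambda>k. kibble_weight (real n) r k * ?l k y * ?l k x / (1 - r\<^sup>2) ^ n) sums (joint_cdf M X Y x y n n / (1 - r\<^sup>2) ^ n)"
    by (rule sums_divide)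
  moreover have "kibble_weight (real n) r k * ?l k y * ?l k x / (1 - r\<^sup>2) ^ n
      = r ^ (2 * k) * pochhammer (real n) k / fact k * lower_gamma_reg2 (real (n + k)) (x / (1 - r\<^sup>2)) (y / (1 - r\<^sup>2))" for k
    using \<theta> by (simp add: kibble_weight_def lower_gamma_reg2_def powr_realpow)
  ultimately show ?thesis by simp
qed

text \<open>The integral is taken at shape b + k with a - b further arrivals. The powers of \<theta>
  from the weight and from the integral cancel except for \<theta>^(-k), which joins r^(2k) x^k to
  form q^k.\<close>

lemma joint_cdf_diff_hyp_sums:
  fixes a b :: nat
  assumes b: "b \<ge> 1" and ab: "a \<ge> b" and x: "x > 0" and y: "y \<ge> 0"
  defines "q \<equiv> r\<^sup>2 * x / (1 - r\<^sup>2)"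
  shows "(\<lambda>k. pochhammer (real b) k / fact k * q ^ k * hyp1F1_reg (real (a - b + 1)) (real (a + k + 1)) q
            * lower_gamma_reg (real (b + k)) (y / (1 - r\<^sup>2)))
         sums ((joint_cdf M X Y x y a b - joint_cdf M X Y x y (a + 1) b) / (x ^ a * exp (- x / (1 - r\<^sup>2))))"
proof -
  define \<theta> where "\<theta> = 1 - r\<^sup>2"
  have \<theta>: "\<theta> > 0" using r by (simp add: \<theta>_def abs_square_less_1)
  define m where "m = a - b"
  have a: "a = b + m" using ab by (simp add: m_def)
  let ?H = "\<lambda>k. hyp1F1_reg (real m + 1) (real (b + k + m + 1)) q"
  let ?V = "\<lambda>k. x ^ (b + k + m) * exp (- x / \<theta>) / \<theta> ^ (b + k) * ?H k"
  have q: "q \<ge> 0" using x \<theta> by (simp add: q_def \<theta>_def[symmetric])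
  have H: "?H k \<ge> 0" for k
    using hyp1F1_reg_sums(2)[OF q, of "b + k + 1" m] by (simp add: ac_simps)
  have "(\<lambda>k. kibble_weight (real b) r k * lower_gamma_reg (real (b + k)) (y / (1 - r\<^sup>2)) * ?V k)
      sums (joint_cdf M X Y x y (b + m) b - joint_cdf M X Y x y (b + m + 1) b)"
  proof (rule joint_cdf_diff_sums[OF b y])
    show "?V k \<ge> 0" for k using H x \<theta> by simp
    show "(\<integral>\<^sup>+u. ennreal (gamma_density (real (b + k)) (1 - r\<^sup>2) u) * ennreal (poisson_prob m (x - u)) \<partial>lborel) = ennreal (?V k)" for k
      unfolding q_def \<theta>_def using r b x by (intro nn_integral_gamma_density_poisson) auto
  qed
  then have "(\<lambda>k. kibble_weight (real b) r k * lower_gamma_reg (real (b + k)) (y / (1 - r\<^sup>2)) * ?V k / (x ^ a * exp (- x / \<theta>)))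
      sums ((joint_cdf M X Y x y a b - joint_cdf M X Y x y (a + 1) b) / (x ^ a * exp (- x / \<theta>)))"
    unfolding a by (rule sums_divide)
  moreover have "kibble_weight (real b) r k * lower_gamma_reg (real (b + k)) (y / (1 - r\<^sup>2)) * ?V k / (x ^ a * exp (- x / \<theta>))
      = pochhammer (real b) k / fact k * q ^ k * hyp1F1_reg (real (a - b + 1)) (real (a + k + 1)) q
            * lower_gamma_reg (real (b + k)) (y / (1 - r\<^sup>2))" for k
  proof -
    have H: "hyp1F1_reg (real (a - b + 1)) (real (a + k + 1)) q = ?H k"
      by (simp add: a ac_simps)
    have w: "kibble_weight (real b) r k = \<theta> ^ b * (r ^ (2 * k) * pochhammer (real b) k / fact k)"
      using \<theta> by (simp add: kibble_weight_def \<theta>_def[symmetric] powr_realpow)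
    have qk: "q ^ k = r ^ (2 * k) * x ^ k / \<theta> ^ k"
      by (simp add: q_def \<theta>_def power_mult_distrib power_divide power_mult)
    have xa: "x ^ (b + k + m) = x ^ a * x ^ k" by (simp add: a power_add)
    show ?thesis
      unfolding H w qk xa power_add[of \<theta>] using x \<theta> by simp
  qed
  ultimately show ?thesis by (simp add: \<theta>_def)
qed

text \<open>The factor r^(2k) of the weight cancels against r^(-2(n+k)) of the tilted Gamma law.
  What is left, (\<theta>/r^2)^n, is the prefactor in (c), and no power of r remains in the
  series.\<close>

lemma joint_cdf_diff_diag_sums:
  assumes n: "n \<ge> 1" and x: "x > 0" and y: "y \<ge> 0" and r0: "r \<noteq> 0"
  shows "(\<lambda>k. pochhammer (real n) k / fact k * exp (- x)
            * lower_gamma_reg2 (real (n + k)) (r\<^sup>2 * x / (1 - r\<^sup>2)) (y / (1 - r\<^sup>2)))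
         sums ((joint_cdf M X Y x y n n - joint_cdf M X Y x y (n + 1) n) / ((1 - r\<^sup>2) / r\<^sup>2) ^ n)"
proof -
  define \<theta> where "\<theta> = 1 - r\<^sup>2"
  have \<theta>: "\<theta> > 0" using r by (simp add: \<theta>_def abs_square_less_1)
  have r2: "r\<^sup>2 > 0" using r0 by simp
  define \<theta>' where "\<theta>' = \<theta> / r\<^sup>2"
  have \<theta>': "\<theta>' > 0" using \<theta> r2 by (simp add: \<theta>'_def)
  let ?L = "\<lambda>k. lower_gamma_reg (real (n + k)) (r\<^sup>2 * x / \<theta>)"
  let ?V = "\<lambda>k. exp (- x) / r ^ (2 * (n + k)) * ?L k"
  have L: "?L k \<ge> 0" for k
    using lower_gamma_reg_nn_integral(2)[of "real (n + k)" \<theta>' x] n x \<theta>' by (simp add: \<theta>'_def ac_simps)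
  have "(\<lambda>k. kibble_weight (real n) r k * lower_gamma_reg (real (n + k)) (y / (1 - r\<^sup>2)) * ?V k)
      sums (joint_cdf M X Y x y (n + 0) n - joint_cdf M X Y x y (n + 0 + 1) n)"
  proof (rule joint_cdf_diff_sums[OF n y])
    show "?V k \<ge> 0" for k by (intro mult_nonneg_nonneg divide_nonneg_nonneg L exp_ge_zero zero_le_even_power) simp
    show "(\<integral>\<^sup>+u. ennreal (gamma_density (real (n + k)) (1 - r\<^sup>2) u) * ennreal (poisson_prob 0 (x - u)) \<partial>lborel) = ennreal (?V k)" for k
      unfolding \<theta>_def using r r0 n x by (intro nn_integral_gamma_density_poisson_0) auto
  qed
  then have "(\<lambda>k. kibble_weight (real n) r k * lower_gamma_reg (real (n + k)) (y / (1 - r\<^sup>2)) * ?V k / (\<theta> / r\<^sup>2) ^ n)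
      sums ((joint_cdf M X Y x y n n - joint_cdf M X Y x y (n + 1) n) / (\<theta> / r\<^sup>2) ^ n)"
    using sums_divide by fastforce
  moreover have "kibble_weight (real n) r k * lower_gamma_reg (real (n + k)) (y / (1 - r\<^sup>2)) * ?V k / (\<theta> / r\<^sup>2) ^ n
      = pochhammer (real n) k / fact k * exp (- x)
            * lower_gamma_reg2 (real (n + k)) (r\<^sup>2 * x / (1 - r\<^sup>2)) (y / (1 - r\<^sup>2))" for k
  proof -
    have w: "kibble_weight (real n) r k = \<theta> ^ n * (r ^ (2 * k) * pochhammer (real n) k / fact k)"
      using \<theta> by (simp add: kibble_weight_def \<theta>_def[symmetric] powr_realpow)
    have p: "r ^ (2 * (n + k)) = r ^ (2 * n) * r ^ (2 * k)" by (simp add: power_add[symmetric])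
    have q: "(\<theta> / r\<^sup>2) ^ n = \<theta> ^ n / r ^ (2 * n)" by (simp add: power_divide power_mult)
    show ?thesis
      unfolding w p q lower_gamma_reg2_def \<theta>_def[symmetric] using \<theta> r0 by simp
  qed
  ultimately show ?thesis by (simp add: \<theta>_def)
qed

end

section \<open>Joint counting probabilities\<close>

text \<open>The event that the counts are n and m, written with thresholds instead of a maximum; the
  two descriptions agree almost surely.\<close>

definition window_prob ::
  "'w measure \<Rightarrow> (nat \<Rightarrow> 'w \<Rightarrow> real) \<Rightarrow> (nat \<Rightarrow> 'w \<Rightarrow> real) \<Rightarrow> real \<Rightarrow> real \<Rightarrow> nat \<Rightarrow> nat \<Rightarrow> real" where
  "window_prob M X Y x y n m = measure M {\<omega> \<in> space M.
     partial_sum X n \<omega> \<le> x \<and> x < partial_sum X (n + 1) \<omega> \<and> partial_sum Y m \<omega> \<le> y \<and> y < partial_sum Y (m + 1) \<omega>}"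

lemma window_prob_swap: "window_prob M X Y x y n m = window_prob M Y X y x m n"
  unfolding window_prob_def by (rule arg_cong[where f="measure M"]) auto

context kibble_arrivals
begin

lemma AE_X_nonneg: "AE \<omega> in M. \<forall>k\<ge>1. 0 \<le> X k \<omega>"
proof -
  have "AE \<omega> in M. 0 \<le> X k \<omega>" if k: "k \<ge> 1" for k
  proof -
    note [measurable] = X_measurable[OF k]
    have "\<P>(\<omega> in M. X k \<omega> \<le> 0) = 0"
      using erlang_distributed_le[OF X_exponential[OF k], of 0] by (simp add: erlang_CDF_at0)
    then have "AE \<omega> in M. \<not> X k \<omega> \<le> 0"
      by (subst (asm) prob_Collect_eq_0) auto
    then show ?thesis by eventually_elim simp
  qed
  then show ?thesis by (simp add: AE_all_countable)
qed

lemma prob_SX_le: "x \<ge> 0 \<Longrightarrow> \<P>(\<omega> in M. SX n \<omega> \<le> x) = erlang_cdf n x"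
proof (cases n)
  case 0
  assume "x \<ge> 0"
  with 0 show ?thesis by (simp add: erlang_cdf_def prob_space)
next
  case (Suc m)
  assume x: "x \<ge> 0"
  have "(\<lambda>\<omega>. \<Sum>k\<in>{0+1..0+n}. X k \<omega>) = SX n" by (simp add: partial_sum_def fun_eq_iff)
  with X_sum_erlang[of n 0] Suc have "distributed M lborel (SX n) (erlang_density m 1)" by simp
  from erlang_distributed_le[OF this _ x] show ?thesis by (simp add: Suc erlang_cdf_Suc)
qed

text \<open>Staying below x forever has probability at most \<open>erlang_cdf n x\<close> for every
  n, hence zero. This makes the set under \<open>Max\<close> finite almost surely.\<close>

lemma AE_SX_exceeds:
  assumes x: "x \<ge> 0"
  shows "AE \<omega> in M. \<exists>n. x < SX n \<omega>"
proof -
  have "\<P>(\<omega> in M. \<forall>n. SX n \<omega> \<le> x) \<le> erlang_cdf n x" for n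
    unfolding prob_SX_le[OF x, symmetric] by (rule finite_measure_mono) auto
  then have "\<P>(\<omega> in M. \<forall>n. SX n \<omega> \<le> x) \<le> 0"
    by (intro LIMSEQ_le_const[OF erlang_cdf_tendsto_0[of x]]) auto
  then have "\<P>(\<omega> in M. \<forall>n. SX n \<omega> \<le> x) = 0"
    by (intro antisym measure_nonneg)
  then have "AE \<omega> in M. \<not> (\<forall>n. SX n \<omega> \<le> x)"
    by (subst (asm) prob_Collect_eq_0) auto
  then show ?thesis by eventually_elim (auto simp: not_le)
qed

text \<open>The boundary case b = 0, to which conditioning on the b-th arrivals does not apply: the
  empty sum never exceeds y.\<close>

lemma joint_cdf_0:
  assumes "x \<ge> 0" "y \<ge> 0"
  shows "joint_cdf M X Y x y n 0 = erlang_cdf n x"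
  using prob_SX_le[OF assms(1), of n] assms by (simp add: joint_cdf_def)

text \<open>The indicator of the window is the product of (I n - I (n+1)) and (J m - J (m+1)). This
  holds only almost everywhere, because it needs the partial sums to be increasing.\<close>

lemma window_prob_eq:
  "window_prob M X Y x y n m = joint_cdf M X Y x y n m - joint_cdf M X Y x y (n + 1) m
     - joint_cdf M X Y x y n (m + 1) + joint_cdf M X Y x y (n + 1) (m + 1)"
proof -
  interpret S: kibble_arrivals M Y X r by (rule swap)
  let ?I = "\<lambda>a \<omega>. indicator {..x} (SX a \<omega>) :: real" and ?J = "\<lambda>b \<omega>. indicator {..y} (SY b \<omega>) :: real"
  have int: "integrable M (\<lambda>\<omega>. ?I a \<omega> * ?J b \<omega>)" for a b
    by (rule integrable_const_bound[of _ 1]) (auto split: split_indicator)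
  have F: "joint_cdf M X Y x y a b = (LINT \<omega>|M. ?I a \<omega> * ?J b \<omega>)" for a b
  proof -
    have "joint_cdf M X Y x y a b = (LINT \<omega>|M. indicator {\<omega> \<in> space M. SX a \<omega> \<le> x \<and> SY b \<omega> \<le> y} \<omega>)"
      unfolding joint_cdf_def by (subst Bochner_Integration.integral_indicator) (auto intro!: arg_cong[where f="measure M"])
    also have "\<dots> = (LINT \<omega>|M. ?I a \<omega> * ?J b \<omega>)"
      by (rule Bochner_Integration.integral_cong) (auto split: split_indicator)
    finally show ?thesis .
  qed
  let ?W = "{\<omega> \<in> space M. SX n \<omega> \<le> x \<and> x < SX (n + 1) \<omega> \<and> SY m \<omega> \<le> y \<and> y < SY (m + 1) \<omega>}"
  have "window_prob M X Y x y n m = (LINT \<omega>|M. indicator ?W \<omega>)"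
    unfolding window_prob_def by (subst Bochner_Integration.integral_indicator) (auto intro!: arg_cong[where f="measure M"])
  also have "\<dots> = (LINT \<omega>|M. ?I n \<omega> * ?J m \<omega> - ?I (n + 1) \<omega> * ?J m \<omega> - ?I n \<omega> * ?J (m + 1) \<omega> + ?I (n + 1) \<omega> * ?J (m + 1) \<omega>)"
  proof (rule integral_cong_AE)
    show "AE \<omega> in M. indicator ?W \<omega> = ?I n \<omega> * ?J m \<omega> - ?I (n + 1) \<omega> * ?J m \<omega> - ?I n \<omega> * ?J (m + 1) \<omega> + ?I (n + 1) \<omega> * ?J (m + 1) \<omega>"
      using AE_X_nonneg S.AE_X_nonneg AE_space
    proof eventually_elim
      case (elim \<omega>)
      have "SX n \<omega> \<le> SX (n + 1) \<omega>" "SY m \<omega> \<le> SY (m + 1) \<omega>"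
        using elim by (auto simp: partial_sum_def)
      then show ?case using elim(3) by (auto split: split_indicator)
    qed
  qed measurable
  also have "\<dots> = joint_cdf M X Y x y n m - joint_cdf M X Y x y (n + 1) m
     - joint_cdf M X Y x y n (m + 1) + joint_cdf M X Y x y (n + 1) (m + 1)"
    using int by (simp add: F)
  finally show ?thesis .
qed

text \<open>The elementary part is 1 - (1 - exp(-x)) - (1 - exp(-y)); the series is the joint
  distribution function of the two first arrivals, where (1)_k / k! = 1.\<close>

lemma window_prob_0_0:
  assumes x: "x > 0" and y: "y > 0"
  shows "window_prob M X Y x y 0 0 = - 1 + exp (- x) + exp (- y)
       + (1 - r\<^sup>2) * (\<Sum>k. r ^ (2 * k) * lower_gamma_reg2 (real (k + 1)) (x / (1 - r\<^sup>2)) (y / (1 - r\<^sup>2)))"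
proof -
  interpret S: kibble_arrivals M Y X r by (rule swap)
  have \<theta>: "1 - r\<^sup>2 > 0" using r by (simp add: abs_square_less_1)
  have "(\<lambda>k. r ^ (2 * k) * lower_gamma_reg2 (real (k + 1)) (x / (1 - r\<^sup>2)) (y / (1 - r\<^sup>2)))
      sums (joint_cdf M X Y x y 1 1 / (1 - r\<^sup>2))"
    using joint_cdf_diag_sums[of 1 x y] x y by (simp add: pochhammer_fact[symmetric] add.commute)
  then have "joint_cdf M X Y x y 1 1 = (1 - r\<^sup>2) * (\<Sum>k. r ^ (2 * k) * lower_gamma_reg2 (real (k + 1)) (x / (1 - r\<^sup>2)) (y / (1 - r\<^sup>2)))"
    using \<theta> by (simp add: sums_iff)
  moreover have "joint_cdf M X Y x y 0 0 = 1" "joint_cdf M X Y x y 1 0 = 1 - exp (- x)"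
    using x y by (simp_all add: joint_cdf_0 erlang_cdf_def)
  moreover have "joint_cdf M X Y x y 0 1 = 1 - exp (- y)"
    using x y by (subst joint_cdf_swap) (simp add: S.joint_cdf_0 erlang_cdf_def)
  ultimately show ?thesis unfolding window_prob_eq by simp
qed

text \<open>The four terms pair into a difference at b = 0, which is a Poisson mass, minus a
  difference at b = 1, where (1)_l / l! = 1 and the first hypergeometric parameter n - 1 + 1 is
  n.\<close>

lemma window_prob_g:
  assumes x: "x > 0" and y: "y > 0" and n: "n \<ge> 1"
  shows "window_prob M X Y x y n 0 = g_fun n x y r"
proof -
  define C where "C = x ^ n * exp (- x / (1 - r\<^sup>2))"
  have C: "C > 0" using x by (simp add: C_def)
  define q where "q = r\<^sup>2 * x / (1 - r\<^sup>2)"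
  let ?t = "\<lambda>l. q ^ l * hyp1F1_reg (real n) (real (n + l + 1)) q * lower_gamma_reg (real (l + 1)) (y / (1 - r\<^sup>2))"
  have "?t sums ((joint_cdf M X Y x y n 1 - joint_cdf M X Y x y (n + 1) 1) / C)"
    using joint_cdf_diff_hyp_sums[of 1 n x y] x y n unfolding q_def[symmetric] C_def[symmetric]
    by (simp add: pochhammer_fact[symmetric] add.commute)
  then have D: "joint_cdf M X Y x y n 1 - joint_cdf M X Y x y (n + 1) 1 = C * (\<Sum>l. ?t l)"
    using C by (simp add: sums_iff)
  have "joint_cdf M X Y x y n 0 - joint_cdf M X Y x y (n + 1) 0 = poisson_prob n x"
    using x y erlang_cdf_diff[of n x] by (simp add: joint_cdf_0)
  with D show ?thesis
    unfolding window_prob_eq g_fun_def q_def[symmetric] using x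
    by (simp add: C_def poisson_prob_def)
qed

text \<open>The four terms pair into the difference at b minus the difference at b + 1; the latter
  is available because a > b. Its first hypergeometric parameter drops to a - b, and its
  coefficients are partial sums of those at b, so it unfolds into the double series.\<close>

lemma window_prob_h:
  assumes x: "x > 0" and y: "y > 0" and b: "b \<ge> 1" and ab: "a > b"
  shows "window_prob M X Y x y a b = h_fun a b x y r"
proof -
  have \<theta>: "1 - r\<^sup>2 > 0" using r by (simp add: abs_square_less_1)
  define C where "C = x ^ a * exp (- x / (1 - r\<^sup>2))"
  have C: "C > 0" using x by (simp add: C_def)
  define q where "q = r\<^sup>2 * x / (1 - r\<^sup>2)"
  have q: "q \<ge> 0" using x \<theta> by (simp add: q_def)
  let ?t = "\<lambda>l. pochhammer (real b) l / fact l * q ^ l * hyp1F1_reg (real (a - b + 1)) (real (a + l + 1)) q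
      * lower_gamma_reg (real (b + l)) (y / (1 - r\<^sup>2))"
  have "?t sums ((joint_cdf M X Y x y a b - joint_cdf M X Y x y (a + 1) b) / C)"
    using joint_cdf_diff_hyp_sums[of b a x y] x y b ab unfolding q_def[symmetric] C_def[symmetric] by simp
  then have D1: "joint_cdf M X Y x y a b - joint_cdf M X Y x y (a + 1) b = C * (\<Sum>l. ?t l)"
    using C by (simp add: sums_iff)
  define T where "T = (\<lambda>j. q ^ j * hyp1F1_reg (real (a - b)) (real (a + j + 1)) q * lower_gamma_reg (real (b + j + 1)) (y / (1 - r\<^sup>2)))"
  have T: "T j \<ge> 0" for j
  proof -
    \<comment> \<open>Brings the parameters to the shape \<open>m + 1\<close> and
      \<open>c + m\<close> with m = a - b - 1 and c = b + j + 2.\<close>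
    have eq: "real (a - b) = real (a - b - 1) + 1" "real (a + j + 1) = real ((b + j + 2) + (a - b - 1))"
      using ab by auto
    have "hyp1F1_reg (real (a - b)) (real (a + j + 1)) q \<ge> 0"
      unfolding eq by (rule hyp1F1_reg_sums(2)[OF q]) simp
    then show ?thesis
      unfolding T_def using q y \<theta> by (intro mult_nonneg_nonneg lower_gamma_reg_nn_integral(2)) auto
  qed
  define c where "c = (\<lambda>l. pochhammer (real b) l / fact l)"
  have c: "c l \<ge> 0" for l using b by (simp add: c_def pochhammer_nonneg)
  have "(\<lambda>j. (\<Sum>l\<le>j. c l) * T j) sums ((joint_cdf M X Y x y a (b + 1) - joint_cdf M X Y x y (a + 1) (b + 1)) / C)"
  proof -
    have "a - (b + 1) + 1 = a - b" using ab by simp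
    then show ?thesis
      using joint_cdf_diff_hyp_sums[of "b + 1" a x y] x y ab
      unfolding q_def[symmetric] C_def[symmetric] c_def sum_pochhammer_div_fact T_def
      by (simp add: ac_simps)
  qed
  then have sm: "summable (\<lambda>j. (\<Sum>l\<le>j. c l) * T j)"
    and D2: "joint_cdf M X Y x y a (b + 1) - joint_cdf M X Y x y (a + 1) (b + 1) = C * (\<Sum>j. (\<Sum>l\<le>j. c l) * T j)"
    using C by (simp_all add: sums_iff)
  have "(\<Sum>k. \<Sum>l. pochhammer (real b) l / fact l * q ^ (k + l)
            * hyp1F1_reg (real (a - b)) (real (a + k + l + 1)) q
            * lower_gamma_reg (real (b + k + l + 1)) (y / (1 - r\<^sup>2))) = (\<Sum>k. \<Sum>l. c l * T (k + l))"
    by (simp add: c_def T_def ac_simps)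
  also have "\<dots> = (\<Sum>j. (\<Sum>l\<le>j. c l) * T j)"
    by (rule suminf_diagonal_nonneg[OF c T sm])
  finally have "h_fun a b x y r = C * ((\<Sum>l. ?t l) - (\<Sum>j. (\<Sum>l\<le>j. c l) * T j))"
    unfolding h_fun_def q_def[symmetric] C_def by simp
  then show ?thesis
    unfolding window_prob_eq using D1 D2 by (simp add: algebra_simps)
qed

text \<open>On the diagonal the pairing used off it would leave a difference with a < b. Writing F
  for \<open>joint_cdf\<close>, the sum is regrouped as -F(n,n) + (F(n,n) - F(n+1,n)) + (F(n,n) -
  F(n,n+1)) + F(n+1,n+1), which matches the three series of (c) and explains the leading minus
  sign.\<close>

lemma window_prob_diag:
  assumes x: "x > 0" and y: "y > 0" and n: "n \<ge> 1" and r0: "r \<noteq> 0"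
  shows "window_prob M X Y x y n n =
       - ((1 - r\<^sup>2) ^ n) * (\<Sum>k. r ^ (2 * k) * pochhammer (real n) k / fact k
           * lower_gamma_reg2 (real (n + k)) (x / (1 - r\<^sup>2)) (y / (1 - r\<^sup>2)))
       + ((1 - r\<^sup>2) / r\<^sup>2) ^ n * (\<Sum>k. \<Sum>l\<in>{0..1}. pochhammer (real n) k / fact k
           * exp (- x * (1 - real l) - y * real l)
           * lower_gamma_reg2 (real (n + k))
               (r ^ (2 * (1 - l)) * x / (1 - r\<^sup>2)) (r ^ (2 * l) * y / (1 - r\<^sup>2)))
       + (1 - r\<^sup>2) ^ (n + 1) * (\<Sum>k. \<Sum>l. r ^ (2 * k + 2 * l) * pochhammer (real n) l / fact l
           * lower_gamma_reg2 (real (n + l + k + 1)) (x / (1 - r\<^sup>2)) (y / (1 - r\<^sup>2)))"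
proof -
  interpret S: kibble_arrivals M Y X r by (rule swap)
  define \<theta> where "\<theta> = 1 - r\<^sup>2"
  have \<theta>: "\<theta> > 0" using r by (simp add: \<theta>_def abs_square_less_1)
  let ?F = "joint_cdf M X Y x y"
  let ?s1 = "\<lambda>k. r ^ (2 * k) * pochhammer (real n) k / fact k * lower_gamma_reg2 (real (n + k)) (x / \<theta>) (y / \<theta>)"
  have "?s1 sums (?F n n / \<theta> ^ n)"
    using joint_cdf_diag_sums[OF n, of x y] x y by (simp add: \<theta>_def)
  then have 1: "?F n n = \<theta> ^ n * suminf ?s1"
    using \<theta> by (simp add: sums_iff)
  \<comment> \<open>The index l = 0 belongs to one more arrival in X, l = 1 to one more in Y; the
    latter comes from the interchanged interpretation.\<close>
  let ?s2 = "\<lambda>k. \<Sum>l\<in>{0..1}. pochhammer (real n) k / fact k * exp (- x * (1 - real l) - y * real l)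
      * lower_gamma_reg2 (real (n + k)) (r ^ (2 * (1 - l)) * x / \<theta>) (r ^ (2 * l) * y / \<theta>)"
  have "(\<lambda>k. pochhammer (real n) k / fact k * exp (- x) * lower_gamma_reg2 (real (n + k)) (r\<^sup>2 * x / \<theta>) (y / \<theta>)
      + pochhammer (real n) k / fact k * exp (- y) * lower_gamma_reg2 (real (n + k)) (r\<^sup>2 * y / \<theta>) (x / \<theta>))
      sums ((?F n n - ?F (n + 1) n) / (\<theta> / r\<^sup>2) ^ n + (?F n n - ?F n (n + 1)) / (\<theta> / r\<^sup>2) ^ n)"
    using sums_add[OF joint_cdf_diff_diag_sums[OF n, of x y] S.joint_cdf_diff_diag_sums[OF n, of y x]] x y r0
    by (simp add: \<theta>_def joint_cdf_swap[of M Y X])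
  also have "(\<lambda>k. pochhammer (real n) k / fact k * exp (- x) * lower_gamma_reg2 (real (n + k)) (r\<^sup>2 * x / \<theta>) (y / \<theta>)
      + pochhammer (real n) k / fact k * exp (- y) * lower_gamma_reg2 (real (n + k)) (r\<^sup>2 * y / \<theta>) (x / \<theta>)) = ?s2"
    by (simp add: fun_eq_iff lower_gamma_reg2_def ac_simps power2_eq_square atLeast0_atMost_Suc)
  finally have "?s2 sums ((?F n n - ?F (n + 1) n) / (\<theta> / r\<^sup>2) ^ n + (?F n n - ?F n (n + 1)) / (\<theta> / r\<^sup>2) ^ n)" .
  then have s2: "suminf ?s2 = ((?F n n - ?F (n + 1) n) + (?F n n - ?F n (n + 1))) / (\<theta> / r\<^sup>2) ^ n"
    by (simp only: sums_iff add_divide_distrib)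
  have "(\<theta> / r\<^sup>2) ^ n \<noteq> 0" using \<theta> r0 by simp
  then have 2: "(?F n n - ?F (n + 1) n) + (?F n n - ?F n (n + 1)) = (\<theta> / r\<^sup>2) ^ n * suminf ?s2"
    by (simp only: s2 times_divide_eq_right nonzero_mult_div_cancel_left not_False_eq_True)
  define T where "T = (\<lambda>j. r ^ (2 * j) * lower_gamma_reg2 (real (n + j + 1)) (x / \<theta>) (y / \<theta>))"
  have T: "T j \<ge> 0" for j
    unfolding T_def lower_gamma_reg2_def using x y \<theta>
    by (intro mult_nonneg_nonneg lower_gamma_reg_nn_integral(2) zero_le_even_power) auto
  define c where "c = (\<lambda>l. pochhammer (real n) l / fact l)"
  have c: "c l \<ge> 0" for l using n by (simp add: c_def pochhammer_nonneg)
  have "(\<lambda>j. (\<Sum>l\<le>j. c l) * T j) sums (?F (n + 1) (n + 1) / \<theta> ^ (n + 1))"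
    using joint_cdf_diag_sums[of "n + 1" x y] x y unfolding c_def sum_pochhammer_div_fact T_def \<theta>_def
    by (simp add: ac_simps)
  then have sm: "summable (\<lambda>j. (\<Sum>l\<le>j. c l) * T j)"
    and 3: "?F (n + 1) (n + 1) = \<theta> ^ (n + 1) * (\<Sum>j. (\<Sum>l\<le>j. c l) * T j)"
    using \<theta> by (simp_all add: sums_iff)
  have "(\<Sum>j. (\<Sum>l\<le>j. c l) * T j) = (\<Sum>k. \<Sum>l. c l * T (k + l))"
    by (rule suminf_diagonal_nonneg[OF c T sm, symmetric])
  also have "\<dots> = (\<Sum>k. \<Sum>l. r ^ (2 * k + 2 * l) * pochhammer (real n) l / fact l
           * lower_gamma_reg2 (real (n + l + k + 1)) (x / \<theta>) (y / \<theta>))"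
    by (simp add: c_def T_def ac_simps distrib_left)
  finally have "?F (n + 1) (n + 1) = \<theta> ^ (n + 1) * (\<Sum>k. \<Sum>l. r ^ (2 * k + 2 * l) * pochhammer (real n) l / fact l
           * lower_gamma_reg2 (real (n + l + k + 1)) (x / \<theta>) (y / \<theta>))"
    using 3 by simp
  with 1 2 show ?thesis
    unfolding window_prob_eq \<theta>_def[symmetric] by linarith
qed

end

section \<open>The Poisson random field\<close>

text \<open>By monotonicity the indices with sum at most 1 are exactly those below the first index m
  that exceeds 1, so the maximum is m - 1. Existence of m rules out an infinite set under
  \<open>Max\<close>.\<close>

lemma arrival_count_eq_iff:
  assumes nonneg: "\<forall>k\<ge>1. 0 \<le> Y k s \<omega>" and ex: "\<exists>n. 1 < arrival Y n s \<omega>"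
  shows "arrival_count Y s \<omega> = n \<longleftrightarrow> arrival Y n s \<omega> \<le> 1 \<and> 1 < arrival Y (n + 1) s \<omega>"
proof -
  let ?S = "\<lambda>n. arrival Y n s \<omega>"
  have "mono ?S"
    unfolding mono_iff_le_Suc using nonneg by (simp add: arrival_def)
  then have mono: "?S a \<le> ?S b" if "a \<le> b" for a b using that by (rule monoD)
  define m where "m = (LEAST n. 1 < ?S n)"
  have m: "1 < ?S m" unfolding m_def by (rule LeastI_ex[OF ex])
  have le1: "?S k \<le> 1 \<longleftrightarrow> k < m" for k
    using mono[of m k] m not_less_Least[of k "\<lambda>n. 1 < ?S n"] unfolding m_def[symmetric]
    by (cases "k < m") auto
  \<comment> \<open>The empty sum is 0, so m - 1 is a true predecessor; for m = 1 the set under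
    \<open>Max\<close> is empty and the first branch of the definition applies.\<close>
  have "m > 0" using le1[of 0] by (simp add: arrival_def)
  have "arrival_count Y s \<omega> = m - 1"
  proof (cases "m = 1")
    case True
    then show ?thesis using m by (simp add: arrival_count_def)
  next
    case False
    then have "\<not> ?S 1 > 1" using le1[of 1] \<open>m > 0\<close> by auto
    moreover have "Max {n. n \<ge> 1 \<and> ?S n \<le> 1} = m - 1"
      unfolding le1 using False \<open>m > 0\<close> by (intro Max_eqI) (auto intro: finite_subset[of _ "{..m}"])
    ultimately show ?thesis by (simp add: arrival_count_def)
  qed
  then show ?thesis
    using le1[of n] le1[of "n + 1"] \<open>m > 0\<close> by auto
qed

lemma arrival_count_measurable:
  assumes [measurable]: "\<And>k. k \<ge> 1 \<Longrightarrow> Y k s \<in> borel_measurable M"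
  shows "arrival_count Y s \<in> measurable M (count_space UNIV)"
proof -
  have [measurable]: "arrival Y n s \<in> borel_measurable M" for n
    unfolding arrival_def by (intro borel_measurable_sum) auto
  show ?thesis unfolding arrival_count_def by measurable
qed

lemma field_path_measurable:
  "random_field M A X \<Longrightarrow> field_path A X \<in> measurable M (\<Pi>\<^sub>M s\<in>A. borel)"
  unfolding random_field_def field_path_def by (intro measurable_restrict) auto

text \<open>Equality of the laws of whole fields is used only through functions h that read off two
  locations.\<close>

lemma distr_eq_field_lawD:
  assumes "random_field M A X" "random_field M A Z" "field_law M A X = field_law M A Z"
    and "h \<in> measurable (\<Pi>\<^sub>M s\<in>A. borel) N"
  shows "distr M N (\<lambda>\<omega>. h (field_path A X \<omega>)) = distr M N (\<lambda>\<omega>. h (field_path A Z \<omega>))"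
  using distr_distr[OF assms(4) field_path_measurable[OF assms(1)]]
    distr_distr[OF assms(4) field_path_measurable[OF assms(2)]] assms(3)
  by (simp add: field_law_def comp_def)

lemma gaussian_field_half_squares:
  assumes M: "prob_space M" and G: "standard_stationary_gaussian_field M A \<rho> G"
    and st: "s \<in> A" "t \<in> A" "s \<noteq> t" and r: "\<bar>\<rho> (s - t)\<bar> < 1"
  shows "distr M (borel \<Otimes>\<^sub>M borel) (\<lambda>\<omega>. ((G s \<omega>)\<^sup>2 / 2, (G t \<omega>)\<^sup>2 / 2)) = kibble (1 / 2) (\<rho> (s - t))"
proof (rule gaussian_pair_half_squares[OF M])
  fix a b :: real
  \<comment> \<open>Distinctness of s and t makes the sum over {s, t} consist of two separate terms
    with coefficients a and b.\<close>
  define c where "c = (\<lambda>u. if u = s then a else b)"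
  have "\<forall>F c. finite F \<and> F \<subseteq> A \<longrightarrow> gaussian_rv M (\<lambda>\<omega>. \<Sum>u\<in>F. c u * G u \<omega>)"
    using G by (simp add: standard_stationary_gaussian_field_def gaussian_field_def)
  from this[rule_format, of "{s, t}" c] show "gaussian_rv M (\<lambda>\<omega>. a * G s \<omega> + b * G t \<omega>)"
    using st by (simp add: c_def)
next
  show "mean M (G s) = 0" "mean M (G t) = 0" "covariance M (G s) (G s) = 1" "covariance M (G t) (G t) = 1"
    using G st unfolding standard_stationary_gaussian_field_def by auto
  have "correlation M (G s) (G t) = \<rho> (s - t)"
    using G st unfolding standard_stationary_gaussian_field_def by auto
  then show "covariance M (G s) (G t) = \<rho> (s - t)"
    using G st unfolding standard_stationary_gaussian_field_def correlation_def by simp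
qed (rule r)

text \<open>Multiplying by \<open>lam\<close> cancels the intensity and leaves the sum of two
  independent pairs of half squares, so the shapes 1/2 and 1/2 add up to 1.\<close>

lemma (in prob_space) exponential_field_pair_law:
  assumes G: "standard_stationary_gaussian_field M A \<rho> G"
    and Gc: "independent_copies M A {1, 2 :: nat} Gc G"
    and st: "s \<in> A" "t \<in> A" "s \<noteq> t" and r: "\<bar>\<rho> (s - t)\<bar> < 1"
    and lam: "lam s > 0" "lam t > 0"
  shows "distr M (borel \<Otimes>\<^sub>M borel) (\<lambda>\<omega>. (lam s * exponential_field lam (Gc 1) (Gc 2) s \<omega>,
           lam t * exponential_field lam (Gc 1) (Gc 2) t \<omega>)) = kibble 1 (\<rho> (s - t))"
proof -
  define h where "h = (\<lambda>f. ((f s)\<^sup>2 / 2, (f t)\<^sup>2 / 2) :: real \<times> real)"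
  note [measurable] = measurable_component_singleton[OF st(1)] measurable_component_singleton[OF st(2)]
  have h: "h \<in> measurable (\<Pi>\<^sub>M s\<in>A. borel) (borel \<Otimes>\<^sub>M borel)"
    unfolding h_def using st by measurable
  have hp: "h (field_path A X \<omega>) = ((X s \<omega>)\<^sup>2 / 2, (X t \<omega>)\<^sup>2 / 2)" for X and \<omega> :: 'a
    using st by (simp add: h_def field_path_def)
  have rf: "random_field M A G"
    using G by (simp add: standard_stationary_gaussian_field_def gaussian_field_def)
  let ?Z = "\<lambda>k \<omega>. ((Gc k s \<omega>)\<^sup>2 / 2, (Gc k t \<omega>)\<^sup>2 / 2)"
  have law: "distr M (borel \<Otimes>\<^sub>M borel) (?Z k) = kibble (1 / 2) (\<rho> (s - t))" if "k \<in> {1, 2}" for k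
  proof -
    have "random_field M A (Gc k)" "field_law M A (Gc k) = field_law M A G"
      using Gc that unfolding independent_copies_def by blast+
    from distr_eq_field_lawD[OF this(1) rf this(2) h] show ?thesis
      unfolding hp gaussian_field_half_squares[OF prob_space_axioms G st r] .
  qed
  have "indep_vars (\<lambda>_. borel \<Otimes>\<^sub>M borel) (\<lambda>k \<omega>. h (field_path A (Gc k) \<omega>)) {1, 2}"
    using Gc unfolding independent_copies_def by (intro indep_vars_compose2[OF _ h]) auto
  then have "indep_vars (\<lambda>_. borel \<Otimes>\<^sub>M borel) ?Z {1, 2}" unfolding hp .
  then have "indep_var (\<Pi>\<^sub>M k\<in>{1}. borel \<Otimes>\<^sub>M borel) (\<lambda>\<omega>. restrict (\<lambda>k. ?Z k \<omega>) {1})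
      (\<Pi>\<^sub>M k\<in>{2}. borel \<Otimes>\<^sub>M borel) (\<lambda>\<omega>. restrict (\<lambda>k. ?Z k \<omega>) {2})"
    by (rule indep_var_restrict) auto
  then have "indep_var (borel \<Otimes>\<^sub>M borel) ((\<lambda>f. f 1) \<circ> (\<lambda>\<omega>. restrict (\<lambda>k. ?Z k \<omega>) {1}))
      (borel \<Otimes>\<^sub>M borel) ((\<lambda>f. f 2) \<circ> (\<lambda>\<omega>. restrict (\<lambda>k. ?Z k \<omega>) {2}))"
    by (rule indep_var_compose) measurable
  then have "indep_var (borel \<Otimes>\<^sub>M borel) (?Z 1) (borel \<Otimes>\<^sub>M borel) (?Z 2)"
    by (simp add: comp_def)
  from indep_kibble_add[OF this law law _ _ r]
  have "distr M (borel \<Otimes>\<^sub>M borel) (\<lambda>\<omega>. (fst (?Z 1 \<omega>) + fst (?Z 2 \<omega>), snd (?Z 1 \<omega>) + snd (?Z 2 \<omega>))) = kibble (1 / 2 + 1 / 2) (\<rho> (s - t))"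
    by simp
  moreover have "(lam s * exponential_field lam (Gc 1) (Gc 2) s \<omega>, lam t * exponential_field lam (Gc 1) (Gc 2) t \<omega>)
      = (fst (?Z 1 \<omega>) + fst (?Z 2 \<omega>), snd (?Z 1 \<omega>) + snd (?Z 2 \<omega>))" for \<omega>
    using lam by (simp add: exponential_field_def field_simps)
  ultimately show ?thesis by simp
qed

lemma (in prob_space) arrivals_kibble:
  assumes G: "standard_stationary_gaussian_field M A \<rho> G"
    and Gc: "independent_copies M A {1, 2 :: nat} Gc G"
    and Y: "independent_copies M A {1..} Y (exponential_field lam (Gc 1) (Gc 2))"
    and st: "s \<in> A" "t \<in> A" "s \<noteq> t" and r: "\<bar>\<rho> (s - t)\<bar> < 1"
    and lam: "lam s > 0" "lam t > 0"
  shows "kibble_arrivals M (\<lambda>k \<omega>. lam s * Y k s \<omega>) (\<lambda>k \<omega>. lam t * Y k t \<omega>) (\<rho> (s - t))"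
proof (unfold_locales)
  define h where "h = (\<lambda>f. (lam s * f s, lam t * f t) :: real \<times> real)"
  note [measurable] = measurable_component_singleton[OF st(1)] measurable_component_singleton[OF st(2)]
  have h: "h \<in> measurable (\<Pi>\<^sub>M s\<in>A. borel) (borel \<Otimes>\<^sub>M borel)"
    unfolding h_def using st by measurable
  have hp: "h (field_path A X \<omega>) = (lam s * X s \<omega>, lam t * X t \<omega>)" for X and \<omega> :: 'a
    using st by (simp add: h_def field_path_def)
  have "indep_vars (\<lambda>_. borel \<Otimes>\<^sub>M borel) (\<lambda>k \<omega>. h (field_path A (Y k) \<omega>)) {1..}"
    using Y unfolding independent_copies_def by (intro indep_vars_compose2[OF _ h]) auto
  then show "indep_vars (\<lambda>_. borel \<Otimes>\<^sub>M borel) (\<lambda>k \<omega>. (lam s * Y k s \<omega>, lam t * Y k t \<omega>)) {1..}"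
    unfolding hp .
  fix k :: nat assume "k \<ge> 1"
  then have Yk: "random_field M A (Y k)" "field_law M A (Y k) = field_law M A (exponential_field lam (Gc 1) (Gc 2))"
    using Y unfolding independent_copies_def by auto
  have Gc_rf: "random_field M A (Gc 1)" "random_field M A (Gc 2)"
    using Gc unfolding independent_copies_def by auto
  \<comment> \<open>\<open>independent_copies\<close> asserts measurability of the copies only, so
    it has to be established for the exponential field itself before its law can be pushed
    forward.\<close>
  have rf: "random_field M A (exponential_field lam (Gc 1) (Gc 2))"
    unfolding random_field_def
  proof
    fix u assume "u \<in> A"
    then have Gu: "Gc 1 u \<in> borel_measurable M" "Gc 2 u \<in> borel_measurable M"
      using Gc_rf unfolding random_field_def by blast+
    have "(\<lambda>\<omega>. 1 / (2 * lam u) * ((Gc 1 u \<omega>)\<^sup>2 + (Gc 2 u \<omega>)\<^sup>2)) \<in> borel_measurable M"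
      by (intro borel_measurable_times borel_measurable_add borel_measurable_power borel_measurable_const Gu)
    then show "exponential_field lam (Gc 1) (Gc 2) u \<in> borel_measurable M"
      by (simp only: exponential_field_def[abs_def])
  qed
  show "distr M (borel \<Otimes>\<^sub>M borel) (\<lambda>\<omega>. (lam s * Y k s \<omega>, lam t * Y k t \<omega>)) = kibble 1 (\<rho> (s - t))"
    using distr_eq_field_lawD[OF Yk(1) rf Yk(2) h] unfolding hp exponential_field_pair_law[OF G Gc st r lam] .
qed (rule r)

text \<open>Scaling by the intensities moves them from the inter-arrival times into the thresholds:
  a sum is at most 1 exactly when the scaled sum is at most \<open>lam\<close>. Negative increments
  and never exceeding the threshold are null events.\<close>

lemma joint_prob_eq_window_prob:
  assumes N: "poisson_random_field M A \<rho> lam N" and st: "s \<in> A" "t \<in> A" "s \<noteq> t" and r: "\<bar>\<rho> (s - t)\<bar> < 1"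
  obtains X X' where "kibble_arrivals M X X' (\<rho> (s - t))"
    and "\<And>n m. joint_prob M N s t n m = window_prob M X X' (lam s) (lam t) n m"
proof -
  obtain G Gc Y where G: "standard_stationary_gaussian_field M A \<rho> G"
    and Gc: "independent_copies M A {1, 2 :: nat} Gc G"
    and Y: "independent_copies M A {1..} Y (exponential_field lam (Gc 1) (Gc 2))"
    and NY: "\<forall>s\<in>A. \<forall>\<omega>\<in>space M. N s \<omega> = arrival_count Y s \<omega>"
    and M: "prob_space M" and lam: "\<forall>s\<in>A. lam s > 0"
    using N unfolding poisson_random_field_def by blast
  interpret prob_space M by (rule M)
  have lam_st: "lam s > 0" "lam t > 0" using lam st by auto
  define X where "X = (\<lambda>k \<omega>. lam s * Y k s \<omega>)"
  define X' where "X' = (\<lambda>k \<omega>. lam t * Y k t \<omega>)"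
  have K: "kibble_arrivals M X X' (\<rho> (s - t))"
    unfolding X_def X'_def by (rule arrivals_kibble[OF G Gc Y st r lam_st])
  interpret K: kibble_arrivals M X X' "\<rho> (s - t)" by (rule K)
  interpret K': kibble_arrivals M X' X "\<rho> (s - t)" by (rule K.swap)
  have sum_X: "partial_sum X n \<omega> = lam s * arrival Y n s \<omega>" "partial_sum X' n \<omega> = lam t * arrival Y n t \<omega>" for n \<omega>
    by (simp_all add: partial_sum_def X_def X'_def arrival_def sum_distrib_left)
  have thr: "partial_sum X n \<omega> \<le> lam s \<longleftrightarrow> arrival Y n s \<omega> \<le> 1" "lam s < partial_sum X n \<omega> \<longleftrightarrow> 1 < arrival Y n s \<omega>"
    "partial_sum X' n \<omega> \<le> lam t \<longleftrightarrow> arrival Y n t \<omega> \<le> 1" "lam t < partial_sum X' n \<omega> \<longleftrightarrow> 1 < arrival Y n t \<omega>" for n \<omega>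
    using lam_st by (simp_all add: sum_X)
  have "Y k u \<in> borel_measurable M" if "k \<ge> 1" "u \<in> A" for k u
    using Y that unfolding independent_copies_def random_field_def by auto
  then have [measurable]: "arrival_count Y s \<in> measurable M (count_space UNIV)" "arrival_count Y t \<in> measurable M (count_space UNIV)"
    using st by (auto intro!: arrival_count_measurable)
  have "joint_prob M N s t n m = window_prob M X X' (lam s) (lam t) n m" for n m
  proof -
    have "joint_prob M N s t n m = measure M {\<omega> \<in> space M. arrival_count Y s \<omega> = n \<and> arrival_count Y t \<omega> = m}"
      unfolding joint_prob_def using NY st by (intro arg_cong[where f="measure M"]) auto
    also have "\<dots> = window_prob M X X' (lam s) (lam t) n m"
      unfolding window_prob_def
    proof (rule measure_eq_AE)
      show "AE \<omega> in M. \<omega> \<in> {\<omega> \<in> space M. arrival_count Y s \<omega> = n \<and> arrival_count Y t \<omega> = m} \<longleftrightarrow>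
          \<omega> \<in> {\<omega> \<in> space M. partial_sum X n \<omega> \<le> lam s \<and> lam s < partial_sum X (n + 1) \<omega>
            \<and> partial_sum X' m \<omega> \<le> lam t \<and> lam t < partial_sum X' (m + 1) \<omega>}"
        using K.AE_X_nonneg K'.AE_X_nonneg K.AE_SX_exceeds[OF less_imp_le[OF lam_st(1)]]
          K'.AE_SX_exceeds[OF less_imp_le[OF lam_st(2)]]
      proof eventually_elim
        case (elim \<omega>)
        have "\<forall>k\<ge>1. 0 \<le> Y k s \<omega>" "\<forall>k\<ge>1. 0 \<le> Y k t \<omega>"
          using elim(1,2) lam_st by (auto simp: X_def X'_def zero_le_mult_iff)
        moreover have "\<exists>n. 1 < arrival Y n s \<omega>" "\<exists>n. 1 < arrival Y n t \<omega>"
          using elim(3,4) unfolding thr by auto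
        ultimately show ?case
          by (simp add: arrival_count_eq_iff thr)
      qed
    qed measurable
    finally show ?thesis .
  qed
  with K show ?thesis by (rule that)
qed

theorem theorem2:
  fixes M :: "'w measure"
    and A :: "(real ^ 'd) set"
    and \<rho> lam :: "real ^ 'd \<Rightarrow> real"
    and N :: "real ^ 'd \<Rightarrow> 'w \<Rightarrow> nat"
    and s\<^sub>i s\<^sub>j :: "real ^ 'd"
    and lam\<^sub>i lam\<^sub>j r :: real
    and p :: "nat \<Rightarrow> nat \<Rightarrow> real"
  assumes "poisson_random_field M A \<rho> lam N"
    and "s\<^sub>i \<in> A" and "s\<^sub>j \<in> A" and "s\<^sub>i \<noteq> s\<^sub>j"
  defines "lam\<^sub>i \<equiv> lam s\<^sub>i" and "lam\<^sub>j \<equiv> lam s\<^sub>j" and "r \<equiv> \<rho> (s\<^sub>i - s\<^sub>j)"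
    and "p \<equiv> joint_prob M N s\<^sub>i s\<^sub>j"
  assumes "\<bar>r\<bar> < 1"
  shows
    "(p 0 0 = - 1 + exp (- lam\<^sub>i) + exp (- lam\<^sub>j)
       + (1 - r\<^sup>2) * (\<Sum>k. r ^ (2 * k)
           * lower_gamma_reg2 (real (k + 1)) (lam\<^sub>i / (1 - r\<^sup>2)) (lam\<^sub>j / (1 - r\<^sup>2))))
   \<and> (\<forall>n\<ge>1. p n 0 = g_fun n lam\<^sub>i lam\<^sub>j r)
   \<and> (\<forall>m\<ge>1. p 0 m = g_fun m lam\<^sub>j lam\<^sub>i r)
   \<and> (r \<noteq> 0 \<longrightarrow> (\<forall>n\<ge>1. p n n =
       - ((1 - r\<^sup>2) ^ n) * (\<Sum>k. r ^ (2 * k) * pochhammer (real n) k / fact k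
           * lower_gamma_reg2 (real (n + k)) (lam\<^sub>i / (1 - r\<^sup>2)) (lam\<^sub>j / (1 - r\<^sup>2)))
       + ((1 - r\<^sup>2) / r\<^sup>2) ^ n * (\<Sum>k. \<Sum>l\<in>{0..1}. pochhammer (real n) k / fact k
           * exp (- lam\<^sub>i * (1 - real l) - lam\<^sub>j * real l)
           * lower_gamma_reg2 (real (n + k))
               (r ^ (2 * (1 - l)) * lam\<^sub>i / (1 - r\<^sup>2)) (r ^ (2 * l) * lam\<^sub>j / (1 - r\<^sup>2)))
       + (1 - r\<^sup>2) ^ (n + 1) * (\<Sum>k. \<Sum>l. r ^ (2 * k + 2 * l) * pochhammer (real n) l / fact l
           * lower_gamma_reg2 (real (n + l + k + 1)) (lam\<^sub>i / (1 - r\<^sup>2)) (lam\<^sub>j / (1 - r\<^sup>2)))))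
   \<and> (\<forall>n m. n \<ge> 2 \<and> m \<ge> 1 \<and> n > m \<longrightarrow> p n m = h_fun n m lam\<^sub>i lam\<^sub>j r)
   \<and> (\<forall>n m. m \<ge> 2 \<and> n \<ge> 1 \<and> m > n \<longrightarrow> p n m = h_fun m n lam\<^sub>j lam\<^sub>i r)"
proof -
  have lam: "lam\<^sub>i > 0" "lam\<^sub>j > 0"
    using assms(1-3) unfolding lam\<^sub>i_def lam\<^sub>j_def poisson_random_field_def by auto
  obtain X X' where K: "kibble_arrivals M X X' r"
    and p: "\<And>n m. p n m = window_prob M X X' lam\<^sub>i lam\<^sub>j n m"
    using joint_prob_eq_window_prob[OF assms(1-4)] \<open>\<bar>r\<bar> < 1\<close>
    unfolding lam\<^sub>i_def lam\<^sub>j_def r_def p_def by metis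
  interpret K: kibble_arrivals M X X' r by (rule K)
  interpret K': kibble_arrivals M X' X r by (rule K.swap)
  \<comment> \<open>The same probability seen from the interchanged sequences; it yields the parts
    of (b) and (d) in which the second count is the larger one.\<close>
  have p': "p n m = window_prob M X' X lam\<^sub>j lam\<^sub>i m n" for n m
    unfolding p by (rule window_prob_swap)
  show ?thesis
    using K.window_prob_0_0[OF lam] K.window_prob_g[OF lam] K'.window_prob_g[OF lam(2,1)]
      K.window_prob_diag[OF lam] K.window_prob_h[OF lam] K'.window_prob_h[OF lam(2,1)]
    by (intro conjI allI impI) (simp_all only: p[symmetric] p'[symmetric] not_False_eq_True)
qed

end
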